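(* Let $q,k\in\mathbb N$, $m\in\mathbb N_*$, $e\in\mathcal E$. (i) $B_q(k,m,e)\subset\mathcal S_{q,k,m,e}\subset W^{q,e}$ (the last inclusion meaning that every $\mu\in\mathcal S_{q,k,m,e}$ is absolutely continuous with density in $W^{q,e}$). (ii) Suppose moreover $e\in\mathcal E_{\alpha,\gamma}$ with $0\le\alpha<\frac{2m+k+q}{d(2m-1)}$ and $\gamma\ge 0$, and $m>d/2$. Then for every $f\in W^{q+1,2m,e}$ the measure $f(x)\,dx$ belongs to $B_q(k,m,e)$; i.e. $W^{q+1,2m,e}\subset B_q(k,m,e)\subset\mathcal S_{q,k,m,e}\subset W^{q,e}$.
   Context: A Young function is a function $e:\mathbb R\to\mathbb R_+$ which is symmetric, strictly convex, nonnegative, with $e(0)=0$. $\mathcal E$ denotes the set of Young functions such that (i) there is $\lambda>0$ with $e(2s)\le\lambda e(s)$ for all $s$; (ii) $s\mapsto e(s)/s$ is nondecreasing on $(0,\infty)$. For measurable $f:\mathbb R^d\to\mathbb R$, $\|f\|_{(e)}=\inf\{c>0:\int e(f(x)/c)\,dx\le 1\}$. Set $e^{-1}(a)=\sup\{c:e(c)\le a\}$ and $\beta_e(R)=R/e^{-1}(R)$. For multi-indices $\alpha,\gamma$, $\partial_\alpha$ is the corresponding partial derivative and $x^\gamma=\prod_i x_i^{\gamma_i}$. Norms: $\|f\|_{k,(e)}=\sum_{|\alpha|\le k}\|\partial_\alpha f\|_{(e)}$, $W^{k,e}=\{f:\|f\|_{k,(e)}<\infty\}$; $\|f\|_{k,l,(e)}=\sum_{|\gamma|\le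 l}\sum_{|\alpha|\le k}\|x^\gamma\partial_\alpha f\|_{(e)}$, $W^{k,l,e}=\{f:\|f\|_{k,l,(e)}<\infty\}$; $\|\phi\|_{k,\infty}=\sum_{|\alpha|\le k}\sup|\partial_\alpha\phi|$. $\mathcal M$: finite signed Borel measures on $\mathbb R^d$; $\mathcal M_a$: those absolutely continuous, with density $p_\mu$. $d_k(\mu,\nu)=\sup\{|\int\phi\,d\mu-\int\phi\,d\nu|:\phi\in C^\infty,\|\phi\|_{k,\infty}\le1\}$, and $d_k(\mu,A)=\inf_{\nu\in A}d_k(\mu,\nu)$. $\pi_{q,k,m,e}(\mu,(\mu_n)_n)=\sum_{n\ge0}2^{n(q+k)}\beta_e(2^{nd})d_k(\mu,\mu_n)+\sum_{n\ge0}2^{-2nm}\|p_{\mu_n}\|_{2m+q,2m,(e)}$ for $(\mu_n)\subset\mathcal M_a$; $\rho_{q,k,m,e}(\mu)=\inf$ of this over all such sequences; $\mathcal S_{q,k,m,e}=\{\mu\in\mathcal M:\rho_{q,k,m,e}(\mu)<\infty\}$. $M_{m,q,e}(R)=\{\mu\in\mathcal M_a:\|p_\mu\|_{2m+q,2m,(e)}\le R\}$; $L_a(R)=R(\ln R)^a$ for $a>1$. $B_q(k,m,e)$ is the set of $\mu\in\mathcal M$ for which there exists $a>1$ with $$\limsup_{R\to\infty}\frac{L_a(R)^{1+\frac{k+q}{2m}}\,\beta_e\big(L_a(R)^{\frac d{2m}}\big)}{R}\,d_k(\mu,M_{m,q,e}(R))<\infty.$$ For $\alpha,\gamma\ge0$,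 $\mathcal E_{\alpha,\gamma}$ is the set of $e\in\mathcal E$ with $0<\liminf_{R\to\infty}\frac{\beta_e(R)}{R^\alpha(\ln R)^\gamma}\le\limsup_{R\to\infty}\frac{\beta_e(R)}{R^\alpha(\ln R)^\gamma}<\infty$. *)

theory Defs
  imports "HOL-Analysis.Analysis" "HOL-Library.Liminf_Limsup"
begin

(* Ambient space R^d is real^'n, d = CARD('n). Multi-indices are functions 'n => nat. *)

definition young :: "(real \<Rightarrow> real) \<Rightarrow> bool" where
  "young e \<longleftrightarrow> (\<forall>s. e (-s) = e s) \<and> (\<forall>s. 0 \<le> e s) \<and> e 0 = 0 \<and>
     (\<forall>x y t. x \<noteq> y \<and> 0 < t \<and> t < 1 \<longrightarrow> e (t * x + (1 - t) * y) < t * e x + (1 - t) * e y)"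

definition classE :: "(real \<Rightarrow> real) set" where
  "classE = {e. young e \<and> (\<exists>lam>0. \<forall>s. e (2 * s) \<le> lam * e s) \<and>
                 mono_on {0<..} (\<lambda>s. e s / s)}"

definition einv :: "(real \<Rightarrow> real) \<Rightarrow> real \<Rightarrow> real" where
  "einv e a = Sup {c. e c \<le> a}"

definition beta :: "(real \<Rightarrow> real) \<Rightarrow> real \<Rightarrow> real" where
  "beta e R = R / einv e R"

definition classE_ag :: "real \<Rightarrow> real \<Rightarrow> (real \<Rightarrow> real) set" where
  "classE_ag al ga = {e \<in> classE.
     0 < Liminf at_top (\<lambda>R. ereal (beta e R / (R powr al * ln R powr ga))) \<and>
     Limsup at_top (\<lambda>R. ereal (beta e R / (R powr al * ln R powr ga))) < \<infinity>}"

definition mi_abs :: "('n::finite \<Rightarrow> nat) \<Rightarrow> nat" where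
  "mi_abs a = (\<Sum>i\<in>UNIV. a i)"

definition mi_upto :: "nat \<Rightarrow> ('n::finite \<Rightarrow> nat) set" where
  "mi_upto k = {a. mi_abs a \<le> k}"

definition xpow :: "('n::finite \<Rightarrow> nat) \<Rightarrow> real^'n \<Rightarrow> real" where
  "xpow g x = (\<Prod>i\<in>UNIV. (x $ i) ^ (g i))"

definition partial :: "'n::finite \<Rightarrow> (real^'n \<Rightarrow> real) \<Rightarrow> real^'n \<Rightarrow> real" where
  "partial i f x = deriv (\<lambda>t. f (x + t *\<^sub>R axis i 1)) 0"

fun pderivs :: "'n::finite list \<Rightarrow> (real^'n \<Rightarrow> real) \<Rightarrow> real^'n \<Rightarrow> real" where
  "pderivs [] f = f"
| "pderivs (i # is) f = partial i (pderivs is f)"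

definition smooth :: "(real^'n::finite \<Rightarrow> real) \<Rightarrow> bool" where
  "smooth f \<longleftrightarrow> (\<forall>is x. pderivs is f differentiable (at x))"

(* a list of directions realising the multi-index (order irrelevant for smooth functions) *)
definition mi_list :: "('n::finite \<Rightarrow> nat) \<Rightarrow> 'n list" where
  "mi_list a = (SOME xs. \<forall>i. count_list xs i = a i)"

definition Dm :: "('n::finite \<Rightarrow> nat) \<Rightarrow> (real^'n \<Rightarrow> real) \<Rightarrow> real^'n \<Rightarrow> real" where
  "Dm a f = pderivs (mi_list a) f"

definition test_fun :: "(real^'n::finite \<Rightarrow> real) \<Rightarrow> bool" where
  "test_fun \<phi> \<longleftrightarrow> smooth \<phi> \<and> (\<exists>K. compact K \<and> (\<forall>x. x \<notin> K \<longrightarrow> \<phi> x = 0))"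

definition loc_int :: "(real^'n::finite \<Rightarrow> real) \<Rightarrow> bool" where
  "loc_int f \<longleftrightarrow> f \<in> borel_measurable lborel \<and> (\<forall>K. compact K \<longrightarrow> set_integrable lborel K f)"

definition weak_deriv :: "('n::finite \<Rightarrow> nat) \<Rightarrow> (real^'n \<Rightarrow> real) \<Rightarrow> (real^'n \<Rightarrow> real) \<Rightarrow> bool" where
  "weak_deriv a f g \<longleftrightarrow> loc_int f \<and> loc_int g \<and>
     (\<forall>\<phi>. test_fun \<phi> \<longrightarrow>
        (\<integral>x. f x * Dm a \<phi> x \<partial>lborel) = (-1) ^ mi_abs a * (\<integral>x. g x * \<phi> x \<partial>lborel))"

definition wd :: "('n::finite \<Rightarrow> nat) \<Rightarrow> (real^'n \<Rightarrow> real) \<Rightarrow> real^'n \<Rightarrow> real" where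
  "wd a f = (SOME g. weak_deriv a f g)"

definition orlicz :: "(real \<Rightarrow> real) \<Rightarrow> (real^'n::finite \<Rightarrow> real) \<Rightarrow> ennreal" where
  "orlicz e f = (INF c \<in> {c. 0 < c \<and> (\<integral>\<^sup>+ x. ennreal (e (f x / c)) \<partial>lborel) \<le> 1}. ennreal c)"

definition wsob :: "nat \<Rightarrow> nat \<Rightarrow> (real \<Rightarrow> real) \<Rightarrow> (real^'n::finite \<Rightarrow> real) \<Rightarrow> ennreal" where
  "wsob k l e f = (if \<forall>a \<in> mi_upto k. \<exists>g. weak_deriv a f g
     then (\<Sum>g\<in>mi_upto l. \<Sum>a\<in>mi_upto k. orlicz e (\<lambda>x. xpow g x * wd a f x))
     else \<infinity>)"

definition sob :: "nat \<Rightarrow> (real \<Rightarrow> real) \<Rightarrow> (real^'n::finite \<Rightarrow> real) \<Rightarrow> ennreal" where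
  "sob k e f = (if \<forall>a \<in> mi_upto k. \<exists>g. weak_deriv a f g
     then (\<Sum>a\<in>mi_upto k. orlicz e (wd a f))
     else \<infinity>)"

definition W :: "nat \<Rightarrow> (real \<Rightarrow> real) \<Rightarrow> (real^'n::finite \<Rightarrow> real) set" where
  "W k e = {f. sob k e f < \<infinity>}"

definition Wkl :: "nat \<Rightarrow> nat \<Rightarrow> (real \<Rightarrow> real) \<Rightarrow> (real^'n::finite \<Rightarrow> real) set" where
  "Wkl k l e = {f. wsob k l e f < \<infinity>}"

(* a finite signed Borel measure is represented as a difference M1 - M2 of two finite
   Borel measures; all notions below only depend on the difference *)
type_synonym 'a smeas = "'a measure \<times> 'a measure"

definition fsm :: "(real^'n::finite) smeas set" where
  "fsm = {(M1, M2). finite_measure M1 \<and> finite_measure M2 \<and>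
                     sets M1 = sets borel \<and> sets M2 = sets borel}"

definition sint :: "(real^'n::finite) smeas \<Rightarrow> (real^'n \<Rightarrow> real) \<Rightarrow> real" where
  "sint \<mu> \<phi> = (\<integral>x. \<phi> x \<partial>fst \<mu>) - (\<integral>x. \<phi> x \<partial>snd \<mu>)"

definition is_density :: "(real^'n::finite) smeas \<Rightarrow> (real^'n \<Rightarrow> real) \<Rightarrow> bool" where
  "is_density \<mu> p \<longleftrightarrow> integrable lborel p \<and>
     (\<forall>A \<in> sets borel. measure (fst \<mu>) A - measure (snd \<mu>) A = set_lebesgue_integral lborel A p)"

definition Ma :: "(real^'n::finite) smeas set" where
  "Ma = {\<mu> \<in> fsm. \<exists>p. is_density \<mu> p}"

definition pdens :: "(real^'n::finite) smeas \<Rightarrow> real^'n \<Rightarrow> real" where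
  "pdens \<mu> = (SOME p. is_density \<mu> p)"

definition fmeas :: "(real^'n::finite \<Rightarrow> real) \<Rightarrow> (real^'n) smeas" where
  "fmeas f = (density lborel (\<lambda>x. ennreal (f x)), density lborel (\<lambda>x. ennreal (- f x)))"

definition cnorm :: "nat \<Rightarrow> (real^'n::finite \<Rightarrow> real) \<Rightarrow> ennreal" where
  "cnorm k \<phi> = (\<Sum>a\<in>mi_upto k. (SUP x. ennreal \<bar>Dm a \<phi> x\<bar>))"

definition dk :: "nat \<Rightarrow> (real^'n::finite) smeas \<Rightarrow> (real^'n) smeas \<Rightarrow> ennreal" where
  "dk k \<mu> \<nu> = (SUP \<phi> \<in> {\<phi>. smooth \<phi> \<and> cnorm k \<phi> \<le> 1}. ennreal \<bar>sint \<mu> \<phi> - sint \<nu> \<phi>\<bar>)"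

definition dk_set :: "nat \<Rightarrow> (real^'n::finite) smeas \<Rightarrow> (real^'n) smeas set \<Rightarrow> ennreal" where
  "dk_set k \<mu> A = (INF \<nu> \<in> A. dk k \<mu> \<nu>)"

definition piF :: "nat \<Rightarrow> nat \<Rightarrow> nat \<Rightarrow> (real \<Rightarrow> real) \<Rightarrow> (real^'n::finite) smeas
                    \<Rightarrow> (nat \<Rightarrow> (real^'n) smeas) \<Rightarrow> ennreal" where
  "piF q k m e \<mu> \<mu>s =
     (\<Sum>n. ennreal (2 ^ (n * (q + k)) * beta e (2 ^ (n * CARD('n)))) * dk k \<mu> (\<mu>s n))
   + (\<Sum>n. ennreal (inverse (2 ^ (2 * n * m))) * wsob (2 * m + q) (2 * m) e (pdens (\<mu>s n)))"

definition rho :: "nat \<Rightarrow> nat \<Rightarrow> nat \<Rightarrow> (real \<Rightarrow> real) \<Rightarrow> (real^'n::finite) smeas \<Rightarrow> ennreal" where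
  "rho q k m e \<mu> = (INF \<mu>s \<in> {\<mu>s. \<forall>n. \<mu>s n \<in> Ma}. piF q k m e \<mu> \<mu>s)"

definition Sspace :: "nat \<Rightarrow> nat \<Rightarrow> nat \<Rightarrow> (real \<Rightarrow> real) \<Rightarrow> (real^'n::finite) smeas set" where
  "Sspace q k m e = {\<mu> \<in> fsm. rho q k m e \<mu> < \<infinity>}"

definition Mball :: "nat \<Rightarrow> nat \<Rightarrow> (real \<Rightarrow> real) \<Rightarrow> real \<Rightarrow> (real^'n::finite) smeas set" where
  "Mball m q e R = {\<mu> \<in> Ma. wsob (2 * m + q) (2 * m) e (pdens \<mu>) \<le> ennreal R}"

definition La :: "real \<Rightarrow> real \<Rightarrow> real" where
  "La a R = R * (ln R) powr a"

definition Bq :: "nat \<Rightarrow> nat \<Rightarrow> nat \<Rightarrow> (real \<Rightarrow> real) \<Rightarrow> (real^'n::finite) smeas set" where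
  "Bq q k m e = {\<mu> \<in> fsm. \<exists>a>1.
     Limsup at_top (\<lambda>R::real.
        ennreal (La a R powr (1 + real (k + q) / (2 * real m))
                 * beta e (La a R powr (real CARD('n) / (2 * real m))) / R)
        * dk_set k \<mu> (Mball m q e R)) < \<infinity>}"

end

(* Measures and functions are regularised by convolution with tensor products phi_d of rescaled
   copies of a compactly supported smooth kernel H on the line with vanishing moments of orders
   1, ..., N - 1. Then 2 H(2 .) - H is the N-th derivative of a compactly supported smooth function,
   and phi_{d/2} - phi_d is d^N times a sum of N-th pure partial derivatives of kernels at scale d.

   S is contained in W^{q,e}: take N = 2m, d = 2^{-n} and split mu * (phi_{d/2} - phi_d) into
   (mu - mu_n) * (phi_{d/2} - phi_d) and p_{mu_n} * (phi_{d/2} - phi_d). In the first part d_k controls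
   the sup norm, and by duality the L^1 norm; a function with L^1 norm at most A and sup norm at most
   A R has Orlicz norm at most A beta_e(R). In the second part 2m derivatives are moved to p_{mu_n}
   and Jensen's inequality gives Young's inequality for convolutions. Hence the telescoping series
   of derivatives of mu * phi_d converges in the Orlicz norm.

   B is contained in S: choose near-minimisers at radii R_n with L_a(R_n) = 2^{2mn}.

   W^{q+1,2m,e} is contained in B: take N = q + 1 + k. In the pairing of f * (phi_{d/2} - phi_d) with
   a test function, q + 1 derivatives go to f and k to the test function, so that
   d_k(f, f * phi_d) = O(d^N), while the weighted Sobolev norm of f * phi_d is O(d^{-(2m-1)}).

   Using tensor products of functions of one variable throughout avoids any question about the
   order of the partial derivatives. *)

theory Submission
  imports Defs
begin

subsection \<open>Kernels on the line\<close>

text \<open>The two sums in \<open>piF\<close> are the two errors at the scale \<delta> = 2^(-n), in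
  dimension d. Testing against a kernel differentiated at most q times, in a norm that takes k
  derivatives, costs \<delta>^-(q+k); the bound for the sup norm exceeds that for the L^1 norm by
  \<delta>^-d, which is the argument of \<open>beta\<close>; the smooth part gains \<delta>^(2m).
  Such a gain requires the increment of the kernel to be a high derivative that can be moved to a
  smooth factor, and vanishing moments are exactly what permits compactly supported primitives. The
  logarithm in \<open>La\<close> turns the balance of the two errors into terms of order n^(-a),
  summable since a > 1. For the last inclusion \<delta>^-(2m-1) is matched with R, and the
  restriction on \<alpha> says precisely that the power of R left over is negative, which leaves
  room for every logarithm. The condition m > d/2 makes (1 + |x|)^(-2m) integrable, so that f and
  its derivatives are integrable.\<close>

definition smooth1 :: "(real \<Rightarrow> real) \<Rightarrow> bool" where
  "smooth1 h \<longleftrightarrow> (\<forall>n t. (deriv ^^ n) h differentiable (at t))"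

text \<open>Smoothness is proved by exhibiting a family of functions closed under differentiation,
  so that no formula for the n-th derivative is required.\<close>

lemma smooth1_coinduct:
  assumes "h \<in> S"
    and step: "\<And>f. f \<in> S \<Longrightarrow> \<exists>f'\<in>S. \<forall>t. (f has_real_derivative f' t) (at t)"
  shows "smooth1 h"
proof -
  have *: "(deriv ^^ n) h \<in> S" for n
  proof (induction n)
    case (Suc n)
    obtain f' where f': "f' \<in> S" "\<forall>t. ((deriv ^^ n) h has_real_derivative f' t) (at t)"
      using step[OF Suc] by auto
    then have "deriv ((deriv ^^ n) h) = f'" using DERIV_imp_deriv by blast
    then show ?case using f' by simp
  qed (use assms in simp)
  show ?thesis unfolding smooth1_def
    using step[OF *] real_differentiable_def by blast
qed

lemma smooth1_deriv: "smooth1 h \<Longrightarrow> smooth1 (deriv h)"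
  unfolding smooth1_def
proof (intro allI)
  fix n t assume "\<forall>n t. (deriv ^^ n) h differentiable at t"
  then have "(deriv ^^ (Suc n)) h differentiable at t" by blast
  then show "(deriv ^^ n) (deriv h) differentiable at t" by (simp only: funpow_Suc_right o_apply)
qed

lemma smooth1_has_deriv: "smooth1 h \<Longrightarrow> (h has_real_derivative deriv h t) (at t)"
  unfolding smooth1_def
  by (metis DERIV_imp_deriv funpow_0 real_differentiable_def)

lemma smooth1_antideriv:
  assumes "smooth1 h" "\<And>t. (g has_real_derivative h t) (at t)"
  shows "smooth1 g"
  by (rule smooth1_coinduct[where S = "insert g {f. smooth1 f}"])
    (use assms smooth1_deriv smooth1_has_deriv in blast)+

lemma smooth1_add: "smooth1 f \<Longrightarrow> smooth1 g \<Longrightarrow> smooth1 (\<lambda>t. f t + g t)"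
proof (rule smooth1_coinduct[where S = "{\<lambda>t. f t + g t | f g. smooth1 f \<and> smooth1 g}"], goal_cases)
  case (2 u)
  then obtain f g where u: "u = (\<lambda>t. f t + g t)" "smooth1 f" "smooth1 g" by auto
  show ?case
    by (rule bexI[of _ "\<lambda>t. deriv f t + deriv g t"])
      (use u in \<open>auto intro!: derivative_eq_intros smooth1_has_deriv intro: smooth1_deriv\<close>)
qed auto

lemma smooth1_affine: "smooth1 f \<Longrightarrow> smooth1 (\<lambda>t. c * f (b * t + d))"
proof (rule smooth1_coinduct[where S = "{\<lambda>t. c * f (b * t + d) | c f. smooth1 f}"], goal_cases)
  case (2 u)
  then obtain c f where u: "u = (\<lambda>t. c * f (b * t + d))" "smooth1 f" by auto
  have "(u has_real_derivative c * b * deriv f (b * t + d)) (at t)" for t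
    unfolding u by (auto intro!: derivative_eq_intros DERIV_chain2[OF smooth1_has_deriv[OF u(2)]])
  then show ?case
    by (intro bexI[of _ "\<lambda>t. c * b * deriv f (b * t + d)"]) (use u smooth1_deriv in auto)
qed auto

text \<open>A single product is not closed under differentiation, but finite sums of products of
  smooth functions are; the product rule replaces each pair in the list by two.\<close>

lemma smooth1_mult:
  assumes "smooth1 f" "smooth1 g" shows "smooth1 (\<lambda>t. f t * g t)"
proof (rule smooth1_coinduct)
  let ?S = "{\<lambda>t. \<Sum>(f,g)\<leftarrow>xs. f t * g t | xs. \<forall>(f,g)\<in>set xs. smooth1 f \<and> smooth1 g}"
  show "(\<lambda>t. f t * g t) \<in> ?S"
    using assms by (intro CollectI exI[of _ "[(f,g)]"]) auto
  fix u assume "u \<in> ?S"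
  then obtain xs where xs: "u = (\<lambda>t. \<Sum>(f,g)\<leftarrow>xs. f t * g t)" "\<forall>(f,g)\<in>set xs. smooth1 f \<and> smooth1 g"
    by auto
  have "\<exists>ys. (\<forall>(f,g)\<in>set ys. smooth1 f \<and> smooth1 g) \<and>
    (\<forall>t. ((\<lambda>t. \<Sum>(f,g)\<leftarrow>xs. f t * g t) has_real_derivative (\<Sum>(f,g)\<leftarrow>ys. f t * g t)) (at t))"
    using xs(2)
  proof (induction xs)
    case Nil
    show ?case by (intro exI[of _ "[]"]) auto
  next
    case (Cons a xs)
    obtain f g where a: "a = (f, g)" "smooth1 f" "smooth1 g" using Cons.prems by auto
    obtain ys where ys: "(\<forall>(f,g)\<in>set ys. smooth1 f \<and> smooth1 g)"
     "\<And>t. ((\<lambda>t. \<Sum>(f,g)\<leftarrow>xs. f t * g t) has_real_derivative (\<Sum>(f,g)\<leftarrow>ys. f t * g t)) (at t)"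
      using Cons by auto
    show ?case
      by (intro exI[of _ "(deriv f, g) # (f, deriv g) # ys"])
        (use a ys in \<open>auto intro!: derivative_eq_intros smooth1_has_deriv simp: smooth1_deriv\<close>)
  qed
  then show "\<exists>f'\<in>?S. \<forall>t. (u has_real_derivative f' t) (at t)"
    unfolding xs(1) by (elim exE conjE, intro bexI) auto
qed

section \<open>The flat function exp(-1/t)\<close>

definition expinv :: "real \<Rightarrow> real" where
  "expinv t = (if t \<le> 0 then 0 else exp (- (1 / t)))"

text \<open>With x = 1/t this is the decay of exp(-x) against polynomials as x tends to infinity. It
  settles differentiability at the origin.\<close>

lemma poly_exp_inv_tendsto_0: "((\<lambda>t. poly p (1 / t) * exp (- (1 / t))) \<longlongrightarrow> 0) (at_right (0::real))"
proof -
  have "((\<lambda>x. poly p x * exp (- x)) \<longlongrightarrow> 0) (at_top :: real filter)"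
  proof (induction p)
    case (pCons a p)
    have "((\<lambda>x. a * (x ^ 0 / exp x)) \<longlongrightarrow> a * 0) (at_top :: real filter)"
      by (intro tendsto_mult tendsto_const tendsto_power_div_exp_0)
    moreover have "((\<lambda>x. x * (poly p x * exp (-x))) \<longlongrightarrow> 0) (at_top :: real filter)"
    proof -
      have "((\<lambda>x. \<Sum>i\<le>degree p. coeff p i * (x ^ (i + 1) / exp x)) \<longlongrightarrow> (\<Sum>i\<le>degree p. coeff p i * 0)) (at_top :: real filter)"
        by (intro tendsto_sum tendsto_mult tendsto_const tendsto_power_div_exp_0)
      moreover have "(\<lambda>x. \<Sum>i\<le>degree p. coeff p i * (x ^ (i + 1) / exp x)) = (\<lambda>x. x * (poly p x * exp (-x)))"
        by (auto simp: poly_altdef exp_minus divide_inverse sum_distrib_left sum_distrib_right fun_eq_iff mult_ac intro!: sum.cong)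
      ultimately show ?thesis by simp
    qed
    ultimately have "((\<lambda>x. a * (x ^ 0 / exp x) + x * (poly p x * exp (-x))) \<longlongrightarrow> a * 0 + 0) (at_top :: real filter)"
      by (rule tendsto_add)
    then show ?case by (simp add: exp_minus divide_inverse algebra_simps)
  qed simp
  then have "((\<lambda>t. poly p (inverse t) * exp (- (inverse t))) \<longlongrightarrow> 0) (at_right (0::real))"
    by (rule filterlim_compose[OF _ filterlim_inverse_at_top_right])
  then show ?thesis by (simp add: inverse_eq_divide)
qed

text \<open>The invariant family consists of the functions p(1/t) exp(-1/t), extended by zero, with
  p a polynomial. At the origin the right difference quotient is again of this form and tends to
  0.\<close>

lemma smooth1_expinv: "smooth1 expinv"
proof (rule smooth1_coinduct)
  let ?F = "\<lambda>p t. if t \<le> 0 then 0 else poly p (1/t) * exp (- (1 / t)) :: real"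
  show "expinv \<in> range ?F"
    by (rule image_eqI[of _ _ 1]) (auto simp: expinv_def)
  fix f assume "f \<in> range ?F"
  then obtain p where f: "f = ?F p" by auto
  \<comment> \<open>With X = 1/t the chain rule gives the factor X^2 for the exponential and -X^2
    for p, hence the new polynomial X^2 (p - p').\<close>
  let ?q = "[:0, 0, 1:] * (p - pderiv p)"
  have "(f has_real_derivative ?F ?q t) (at t)" for t
  proof (cases "t = 0")
    case False
    show ?thesis
    proof (cases "t < 0")
      case True
      have "(f has_real_derivative 0) (at t) \<longleftrightarrow> ((\<lambda>_. 0) has_real_derivative 0) (at t)"
        using True unfolding f
        by (intro DERIV_cong_ev refl eventually_mono[OF eventually_nhds_in_open[of "{..<0}"]]) auto
      then show ?thesis using True by simp
    next
      case F: False
      have d: "((\<lambda>t. 1/t) has_real_derivative - (1/t) * (1/t)) (at t)"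
        using DERIV_inverse[of t UNIV] F False by (simp add: inverse_eq_divide power2_eq_square)
      have "((\<lambda>t. poly p (1/t) * exp (- (1/t))) has_real_derivative
          poly (pderiv p) (1/t) * (- (1/t) * (1/t)) * exp (- (1/t)) +
          exp (- (1/t)) * (- (- (1/t) * (1/t))) * poly p (1/t)) (at t)"
        by (intro DERIV_mult DERIV_chain2[OF poly_DERIV d] DERIV_chain2[OF DERIV_exp DERIV_minus[OF d]])
      then have "((\<lambda>t. poly p (1/t) * exp (- (1/t))) has_real_derivative (?F ?q t)) (at t)"
        by (rule DERIV_cong) (use F False in \<open>simp add: algebra_simps\<close>)
      moreover have "(f has_real_derivative (?F ?q t)) (at t) \<longleftrightarrow> ((\<lambda>t. poly p (1/t) * exp (- (1/t))) has_real_derivative (?F ?q t)) (at t)"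
        using F False unfolding f
        by (intro DERIV_cong_ev refl eventually_mono[OF eventually_nhds_in_open[of "{0<..}"]]) auto
      ultimately show ?thesis by blast
    qed
  next
    case True
    have "((\<lambda>h. f h / h) \<longlongrightarrow> 0) (at_left 0)"
      by (rule tendsto_eventually) (auto simp: f eventually_at_filter intro!: always_eventually)
    moreover have "((\<lambda>h. f h / h) \<longlongrightarrow> 0) (at_right 0)"
    proof -
      have "((\<lambda>t. poly ([:0,1:] * p) (1 / t) * exp (- (1 / t))) \<longlongrightarrow> 0) (at_right (0::real))"
        by (rule poly_exp_inv_tendsto_0)
      then show ?thesis
        by (rule Lim_transform_eventually)
          (auto simp: f eventually_at_filter intro!: always_eventually)
    qed
    ultimately have "((\<lambda>h. f h / h) \<longlongrightarrow> 0) (at 0)"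
      by (simp add: filterlim_at_split)
    then show ?thesis using True by (simp add: has_field_derivative_iff f)
  qed
  then show "\<exists>f'\<in>range ?F. \<forall>t. (f has_real_derivative f' t) (at t)"
    by (intro bexI[of _ "?F ?q"]) auto
qed

section \<open>Smooth functions of compact support on the line\<close>

definition csm :: "(real \<Rightarrow> real) \<Rightarrow> bool" where
  "csm h \<longleftrightarrow> smooth1 h \<and> (\<exists>r. \<forall>t. r < \<bar>t\<bar> \<longrightarrow> h t = 0)"

lemma csmE:
  assumes "csm h" obtains r where "r > 0" "\<And>t. r < \<bar>t\<bar> \<Longrightarrow> h t = 0"
proof -
  obtain r where "\<forall>t. r < \<bar>t\<bar> \<longrightarrow> h t = 0" using assms csm_def by blast
  then show ?thesis by (intro that[of "max r 1"]) auto
qed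

lemma csm_ex: "csm h \<Longrightarrow> \<exists>r>0. \<forall>t. r < \<bar>t\<bar> \<longrightarrow> h t = 0"
  by (erule csmE) blast

lemma csm_smooth1: "csm h \<Longrightarrow> smooth1 h"
  by (simp add: csm_def)

lemma csm_has_deriv: "csm h \<Longrightarrow> (h has_real_derivative deriv h t) (at t)"
  by (simp add: csm_smooth1 smooth1_has_deriv)

lemma csm_deriv: assumes "csm h" shows "csm (deriv h)"
proof -
  obtain r where r: "r > 0" "\<And>t. r < \<bar>t\<bar> \<Longrightarrow> h t = 0" using csmE[OF assms] by blast
  have "deriv h t = 0" if "r < \<bar>t\<bar>" for t
  proof -
    have "(h has_real_derivative 0) (at t) \<longleftrightarrow> ((\<lambda>_. 0) has_real_derivative 0) (at t)"
      using that r(2)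
      by (intro DERIV_cong_ev refl eventually_mono[OF eventually_nhds_in_open[of "{t. r < \<bar>t\<bar>}"]])
         (auto intro!: open_Collect_less continuous_intros)
    then show ?thesis by (simp add: DERIV_imp_deriv)
  qed
  then show ?thesis using assms smooth1_deriv unfolding csm_def by blast
qed

lemma csm_derivs: "csm h \<Longrightarrow> csm ((deriv ^^ n) h)"
  by (induction n) (auto intro: csm_deriv)

lemma csm_add: assumes "csm f" "csm g" shows "csm (\<lambda>t. f t + g t)"
proof -
  obtain r where r: "r > 0" "\<And>t. r < \<bar>t\<bar> \<Longrightarrow> f t = 0" using csmE[OF assms(1)] by blast
  obtain s where s: "s > 0" "\<And>t. s < \<bar>t\<bar> \<Longrightarrow> g t = 0" using csmE[OF assms(2)] by blast
  show ?thesis unfolding csm_def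
    using assms smooth1_add r s by (auto simp: csm_def intro!: exI[of _ "max r s"])
qed

lemma csm_affine: assumes "csm f" "b \<noteq> 0" shows "csm (\<lambda>t. c * f (b * t + d))"
proof -
  obtain r where r: "r > 0" "\<And>t. r < \<bar>t\<bar> \<Longrightarrow> f t = 0" using csmE[OF assms(1)] by blast
  have "f (b * t + d) = 0" if "(r + \<bar>d\<bar>) / \<bar>b\<bar> < \<bar>t\<bar>" for t
  proof (rule r(2))
    have "r + \<bar>d\<bar> < \<bar>b * t\<bar>" using that assms(2) by (simp add: field_simps abs_mult)
    then show "r < \<bar>b * t + d\<bar>" by linarith
  qed
  then show ?thesis unfolding csm_def
    using assms smooth1_affine by (auto simp: csm_def)
qed

lemma csm_cmult: "csm f \<Longrightarrow> csm (\<lambda>t. c * f t)"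
  using csm_affine[of f 1 c 0] by simp

lemma csm_reflect: "csm f \<Longrightarrow> csm (\<lambda>t. f (d - t))"
  using csm_affine[of f "-1" 1 d] by simp

text \<open>The product of the two flat functions vanishes outside (a, b). The factor
  \<open>c\<close> steepens both flanks: letting it tend to infinity yields the kernels
  \<open>boxt\<close> that approximate indicators.\<close>

lemma csm_bump: "csm (\<lambda>t. expinv (c * (t - a)) * expinv (c * (b - t)))" if "c > 0"
proof -
  have *: "smooth1 (\<lambda>t. 1 * expinv (c * t + (- c * a)))" "smooth1 (\<lambda>t. 1 * expinv ((-c) * t + c * b))"
    by (intro smooth1_affine smooth1_expinv)+
  have "smooth1 (\<lambda>t. expinv (c * (t - a)) * expinv (c * (b - t)))"
    using smooth1_mult[OF *] by (simp add: algebra_simps)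
  moreover have "expinv (c * (t - a)) * expinv (c * (b - t)) = 0" if "\<bar>a\<bar> + \<bar>b\<bar> < \<bar>t\<bar>" for t
  proof -
    have "t - a \<le> 0 \<or> b - t \<le> 0" using that by linarith
    then show ?thesis using \<open>c > 0\<close> by (auto simp: expinv_def mult_nonneg_nonpos)
  qed
  ultimately show ?thesis unfolding csm_def by blast
qed

lemma csm_continuous: "csm h \<Longrightarrow> continuous_on S h"
  by (meson DERIV_continuous continuous_at_imp_continuous_on csm_has_deriv)

section \<open>Primitives and moments\<close>

lemma indicator_Icc_support:
  fixes u :: "real \<Rightarrow> real"
  assumes "\<And>t. r < \<bar>t\<bar> \<Longrightarrow> u t = 0"
  shows "(\<lambda>t. indicator {-r..r} t *\<^sub>R u t) = u"
proof
  fix t show "indicator {-r..r} t *\<^sub>R u t = u t"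
    using assms[of t] by (cases "t \<in> {-r..r}") (auto simp: abs_if split: if_splits)
qed

lemma csm_integrable_mult:
  assumes "csm h" "continuous_on UNIV g"
  shows "integrable lborel (\<lambda>t. g t * h t)"
proof -
  obtain r where r: "r > 0" "\<And>t. r < \<bar>t\<bar> \<Longrightarrow> h t = 0" using csmE[OF assms(1)] by blast
  have "set_integrable lborel {-r..r} (\<lambda>t. g t * h t)"
    by (intro borel_integrable_atLeastAtMost' continuous_intros csm_continuous assms
          continuous_on_subset[OF assms(2)]) auto
  moreover have "(\<lambda>t. indicator {-r..r} t *\<^sub>R (g t * h t)) = (\<lambda>t. g t * h t)"
    by (rule indicator_Icc_support) (use r in auto)
  ultimately show ?thesis by (simp add: set_integrable_def)
qed

lemma csm_integrable: "csm h \<Longrightarrow> integrable lborel h"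
  using csm_integrable_mult[of h "\<lambda>_. 1"] by simp

lemma csm_integral_Icc:
  assumes "csm h" "\<And>t. r < \<bar>t\<bar> \<Longrightarrow> h t = 0"
    "\<And>t. (F has_real_derivative h t) (at t)" "r > 0"
  shows "(\<integral>t. h t \<partial>lborel) = F r - F (-r)"
proof -
  have "(\<integral>t. indicator {-r..r} t *\<^sub>R h t \<partial>lborel) = F r - F (-r)"
    by (rule integral_FTC_Icc) (use assms csm_continuous in
        \<open>auto simp: has_real_derivative_iff_has_vector_derivative[symmetric] intro: has_field_derivative_at_within\<close>)
  moreover have "(\<lambda>t. indicator {-r..r} t *\<^sub>R h t) = h"
    by (rule indicator_Icc_support) (use assms in auto)
  ultimately show ?thesis by simp
qed

text \<open>A primitive that vanishes to the right of the support is constant to the left of it, and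
  the constant is minus the integral of \<open>h\<close>.\<close>

lemma csm_antideriv:
  assumes "csm h" "(\<integral>t. h t \<partial>lborel) = 0"
  obtains F where "csm F" "deriv F = h"
proof -
  obtain r where r: "r > 0" "\<And>t. r < \<bar>t\<bar> \<Longrightarrow> h t = 0" using csmE[OF assms(1)] by blast
  have cont: "isCont h t" for t using csm_has_deriv[OF assms(1)] by (rule DERIV_isCont)
  obtain F0 where F0: "\<And>t. (F0 has_real_derivative h t) (at t)"
  proof -
    have "\<exists>F. \<forall>x. - \<infinity> < ereal x \<longrightarrow> ereal x < \<infinity> \<longrightarrow> (F has_vector_derivative h x) (at x)"
      by (rule einterval_antiderivative) (use cont in auto)
    then show ?thesis using that by (auto simp: has_real_derivative_iff_has_vector_derivative)
  qed
  define F where "F t = F0 t - F0 r" for t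
  have F: "(F has_real_derivative h t) (at t)" for t
    unfolding F_def by (auto intro!: derivative_eq_intros F0)
  have "F r - F (-r) = 0"
    using csm_integral_Icc[OF assms(1) r(2) F r(1)] assms(2) by simp
  then have ends: "F r = 0" "F (-r) = 0" by (auto simp: F_def)
  have cF: "continuous_on S F" for S
    using F by (meson DERIV_isCont continuous_at_imp_continuous_on)
  have "F t = 0" if "r < \<bar>t\<bar>" for t
  proof (cases "t > 0")
    case True
    then have "r < t" using that by simp
    have "DERIV F x :> 0" if "r < x" for x using F[of x] r that by simp
    from DERIV_isconst_end[OF \<open>r < t\<close> cF this] show ?thesis using ends by simp
  next
    case False
    then have "t < -r" using that by simp
    have "DERIV F x :> 0" if "x < -r" for x using F[of x] r that by simp
    from DERIV_isconst_end[OF \<open>t < -r\<close> cF this] show ?thesis using ends by simp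
  qed
  moreover have "smooth1 F" using smooth1_antideriv F assms(1) csm_smooth1 by blast
  ultimately have "csm F" by (auto simp: csm_def)
  moreover have "deriv F = h" using F DERIV_imp_deriv by blast
  ultimately show ?thesis by (rule that)
qed

text \<open>Passing to a primitive shifts moments down by one order, so a function with N vanishing
  moments has a primitive with N - 1 of them. This drives the induction in
  \<open>csm_antiderivs\<close>.\<close>

lemma csm_integral_by_parts:
  assumes "csm h"
  shows "(\<integral>t. t ^ Suc j * deriv h t \<partial>lborel) = - real (Suc j) * (\<integral>t. t ^ j * h t \<partial>lborel)"
proof -
  obtain r where r: "r > 0" "\<And>t. r < \<bar>t\<bar> \<Longrightarrow> h t = 0" using csmE[OF assms(1)] by blast
  obtain r' where r': "r' > 0" "\<And>t. r' < \<bar>t\<bar> \<Longrightarrow> deriv h t = 0" using csmE[OF csm_deriv[OF assms(1)]] by blast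
  \<comment> \<open>The boundary terms vanish at s and -s because s lies strictly beyond both
    supports.\<close>
  define s where "s = max r r' + 1"
  have s: "s > 0" "r < s" "r' < s" using r r' by (auto simp: s_def)
  let ?u = "\<lambda>t. t ^ Suc j * h t"
  let ?v = "\<lambda>t. t ^ Suc j * deriv h t + real (Suc j) * (t ^ j * h t)"
  have d: "(?u has_real_derivative ?v t) (at t)" for t
    by (rule DERIV_cong[OF DERIV_mult[OF DERIV_pow csm_has_deriv[OF assms]]]) (simp add: algebra_simps)
  have "(\<integral>t. indicator {-s..s} t *\<^sub>R ?v t \<partial>lborel) = ?u s - ?u (-s)"
    by (rule integral_FTC_Icc) (use s d csm_continuous[OF csm_deriv[OF assms]] csm_continuous[OF assms] in
        \<open>auto simp: has_real_derivative_iff_has_vector_derivative[symmetric] intro!: continuous_intros intro: has_field_derivative_at_within\<close>)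
  moreover have "(\<lambda>t. indicator {-s..s} t *\<^sub>R ?v t) = ?v"
    by (rule indicator_Icc_support) (use r r' s in auto)
  moreover have "?u s - ?u (-s) = 0" using r s by auto
  ultimately have "(\<integral>t. ?v t \<partial>lborel) = 0" by simp
  moreover have "(\<integral>t. ?v t \<partial>lborel) = (\<integral>t. t ^ Suc j * deriv h t \<partial>lborel) + real (Suc j) * (\<integral>t. t ^ j * h t \<partial>lborel)"
    by (subst Bochner_Integration.integral_add)
      (auto intro!: csm_integrable_mult csm_deriv assms continuous_intros)
  ultimately show ?thesis unfolding mult_minus_left by linarith
qed

lemma csm_antiderivs:
  assumes "csm h" "\<And>j. j < N \<Longrightarrow> (\<integral>t. t ^ j * h t \<partial>lborel) = 0"
  shows "\<exists>G. csm G \<and> (deriv ^^ N) G = h"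
  using assms
proof (induction N arbitrary: h)
  case (Suc N)
  obtain F where F: "csm F" "deriv F = h"
    using csm_antideriv[OF Suc.prems(1)] Suc.prems(2)[of 0] by auto
  have "(\<integral>t. t ^ j * F t \<partial>lborel) = 0" if "j < N" for j
    using csm_integral_by_parts[OF F(1), of j] Suc.prems(2)[of "Suc j"] that F(2) by simp
  then obtain G where G: "csm G" "(deriv ^^ N) G = F" using Suc.IH[OF F(1)] by blast
  then show ?case using F(2) by auto
qed auto

section \<open>L^1-normalised dilations and kernels with vanishing moments\<close>

definition sc :: "real \<Rightarrow> (real \<Rightarrow> real) \<Rightarrow> real \<Rightarrow> real" where
  "sc d h t = h (t / d) / d"

lemma csm_sc: "d > 0 \<Longrightarrow> csm h \<Longrightarrow> csm (sc d h)"
  unfolding sc_def[abs_def] using csm_affine[of h "1/d" "1/d" 0] by simp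

lemma deriv_sc: assumes "csm h" "d > 0" shows "deriv (sc d h) = (\<lambda>t. sc d (deriv h) t / d)"
proof
  fix t
  have "(sc d h has_real_derivative sc d (deriv h) t / d) (at t)"
    unfolding sc_def[abs_def] using assms
    by (auto intro!: derivative_eq_intros DERIV_chain2[OF csm_has_deriv[OF assms(1)]] simp: field_simps)
  then show "deriv (sc d h) t = sc d (deriv h) t / d" by (rule DERIV_imp_deriv)
qed

lemma deriv_cmult_csm: "csm h \<Longrightarrow> deriv (\<lambda>t. h t / c) = (\<lambda>t. deriv h t / c)"
  by (intro ext DERIV_imp_deriv DERIV_cdivide csm_has_deriv)

lemma derivs_sc: assumes "csm h" "d > 0" shows "(deriv ^^ n) (sc d h) = (\<lambda>t. sc d ((deriv ^^ n) h) t / d ^ n)"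
proof (induction n)
  case (Suc n)
  have "(deriv ^^ Suc n) (sc d h) = deriv (\<lambda>t. sc d ((deriv ^^ n) h) t / d ^ n)"
    using Suc by simp
  also have "\<dots> = (\<lambda>t. sc d ((deriv ^^ Suc n) h) t / d ^ Suc n)"
    using assms by (subst deriv_cmult_csm) (auto simp: deriv_sc csm_derivs csm_sc)
  finally show ?case .
qed simp

lemma sc_sc: "sc a (sc b h) = sc (a * b) h"
  by (auto simp: sc_def fun_eq_iff)

lemma moment_sc:
  assumes "csm h" "d > 0"
  shows "(\<integral>t. t ^ j * sc d h t \<partial>lborel) = d ^ j * (\<integral>t. t ^ j * h t \<partial>lborel)"
  using lborel_integral_real_affine[of d "\<lambda>t. t ^ j * sc d h t" 0] assms
  by (simp add: sc_def power_mult_distrib mult.assoc)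

text \<open>Richardson extrapolation: an affine combination of \<open>H\<close> and its dilate by \<open>1/2\<close> removes
  one more moment.\<close>

lemma csm_kernel_exists:
  "\<exists>H. csm H \<and> (\<integral>t. H t \<partial>lborel) = 1 \<and> (\<forall>j. 1 \<le> j \<and> j < N \<longrightarrow> (\<integral>t. t ^ j * H t \<partial>lborel) = 0)"
proof (induction N)
  case 0
  let ?h = "\<lambda>t. expinv (1 * (t - 0)) * expinv (1 * (1 - t))"
  have h: "csm ?h" by (rule csm_bump) simp
  have "(\<integral>t. ?h t \<partial>lborel) \<noteq> 0"
  proof
    assume "(\<integral>t. ?h t \<partial>lborel) = 0"
    then have "AE t in lborel. ?h t = 0"
      by (subst (asm) integral_nonneg_eq_0_iff_AE) (auto simp: expinv_def intro!: csm_integrable h[simplified])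
    moreover have "{t. ?h t \<noteq> 0} = {0<..<1}" by (auto simp: expinv_def)
    ultimately have "emeasure lborel {0<..<1::real} = 0"
      by (subst (asm) AE_iff_null) (auto simp: null_sets_def)
    then show False by simp
  qed
  then show ?case
    by (intro exI[of _ "\<lambda>t. (1 / (\<integral>t. ?h t \<partial>lborel)) * ?h t"] conjI csm_cmult h) auto
next
  case (Suc N)
  show ?case
  proof (cases "N = 0")
    \<comment> \<open>For N = 0 the condition 1 \<le> j < 1 is empty, while the general construction
      would divide by 1 - (1/2)^0 = 0.\<close>
    case True
    then show ?thesis using Suc by auto
  next
    case False
    obtain H where H: "csm H" "(\<integral>t. H t \<partial>lborel) = 1" "\<And>j. 1 \<le> j \<Longrightarrow> j < N \<Longrightarrow> (\<integral>t. t ^ j * H t \<partial>lborel) = 0"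
      using Suc by blast
    \<comment> \<open>Dilation by 1/2 multiplies the N-th moment by (1/2)^N, so the weights 1 - b
      and b annihilate it precisely for this \<open>b\<close>; as they sum to 1, the integral stays
      1.\<close>
    define b :: real where "b = 1 / (1 - (1/2) ^ N)"
    have b: "1 - b + b * (1/2) ^ N = 0"
    proof -
      have "(1/2::real) ^ N < 1" using False by (simp add: power_less_one_iff)
      then show ?thesis by (simp add: b_def field_simps)
    qed
    let ?K = "\<lambda>t. (1 - b) * H t + b * sc (1/2) H t"
    have K: "csm ?K" by (intro csm_add csm_cmult csm_sc H) auto
    have mom: "(\<integral>t. t ^ j * ?K t \<partial>lborel) = (1 - b + b * (1/2) ^ j) * (\<integral>t. t ^ j * H t \<partial>lborel)" for j
    proof -
      have i: "integrable lborel (\<lambda>t. t ^ j * H t)" "integrable lborel (\<lambda>t. t ^ j * sc (1/2) H t)"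
        by (intro csm_integrable_mult csm_sc H continuous_intros; simp)+
      have "(\<integral>t. t ^ j * ?K t \<partial>lborel) = (\<integral>t. (1 - b) * (t ^ j * H t) + b * (t ^ j * sc (1/2) H t) \<partial>lborel)"
        by (simp add: algebra_simps)
      also have "\<dots> = (1 - b) * (\<integral>t. t ^ j * H t \<partial>lborel) + b * (\<integral>t. t ^ j * sc (1/2) H t \<partial>lborel)"
        using i by simp
      also have "\<dots> = (1 - b + b * (1/2) ^ j) * (\<integral>t. t ^ j * H t \<partial>lborel)"
        by (subst moment_sc) (use H in \<open>auto simp: algebra_simps\<close>)
      finally show ?thesis .
    qed
    have "(\<integral>t. ?K t \<partial>lborel) = 1" using mom[of 0] H(2) by simp
    moreover have "(\<integral>t. t ^ j * ?K t \<partial>lborel) = 0" if "1 \<le> j" "j < Suc N" for j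
      using mom[of j] b H(3)[of j] that by (cases "j = N") auto
    ultimately show ?thesis using K by (intro exI[of _ ?K]) blast
  qed
qed

text \<open>Dilation preserves the moment of order 0, so that of \<open>H\<close> cancels in the
  difference; the moments of orders 1 to N - 1 vanish for each term. Hence N successive primitives
  keep compact support.\<close>

lemma csm_kernel:
  obtains H G where "csm H" "(\<integral>t. H t \<partial>lborel) = 1" "csm G" "(deriv ^^ N) G = (\<lambda>t. sc (1/2) H t - H t)"
proof -
  obtain H where H: "csm H" "(\<integral>t. H t \<partial>lborel) = 1" "\<And>j. 1 \<le> j \<Longrightarrow> j < N \<Longrightarrow> (\<integral>t. t ^ j * H t \<partial>lborel) = 0"
    using csm_kernel_exists by blast
  let ?D = "\<lambda>t. sc (1/2) H t + (-1) * H t"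
  have D: "csm ?D" by (intro csm_add csm_cmult csm_sc H) auto
  have "(\<integral>t. t ^ j * ?D t \<partial>lborel) = 0" if "j < N" for j
  proof -
    have i: "integrable lborel (\<lambda>t. t ^ j * H t)" "integrable lborel (\<lambda>t. t ^ j * sc (1/2) H t)"
      by (intro csm_integrable_mult csm_sc H continuous_intros; simp)+
    have "(\<integral>t. t ^ j * ?D t \<partial>lborel) = (\<integral>t. t ^ j * sc (1/2) H t \<partial>lborel) - (\<integral>t. t ^ j * H t \<partial>lborel)"
      using i by (simp add: algebra_simps)
    also have "\<dots> = 0"
      by (subst moment_sc) (use H that in \<open>cases "j = 0"; auto\<close>)+
    finally show ?thesis .
  qed
  then obtain G where "csm G" "(deriv ^^ N) G = ?D" using csm_antiderivs[OF D] by blast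
  then show ?thesis using that H by auto
qed

subsection \<open>Tensor products and convolutions\<close>

definition tens :: "('n::finite \<Rightarrow> real \<Rightarrow> real) \<Rightarrow> real^'n \<Rightarrow> real" where
  "tens hs x = (\<Prod>i\<in>UNIV. hs i (x $ i))"

abbreviation csms :: "('n::finite \<Rightarrow> real \<Rightarrow> real) \<Rightarrow> bool" where
  "csms hs \<equiv> (\<forall>i. csm (hs i))"

definition dv :: "('n::finite \<Rightarrow> nat) \<Rightarrow> ('n \<Rightarrow> real \<Rightarrow> real) \<Rightarrow> 'n \<Rightarrow> real \<Rightarrow> real" where
  "dv a hs i = (deriv ^^ a i) (hs i)"

definition scs :: "real \<Rightarrow> ('n::finite \<Rightarrow> real \<Rightarrow> real) \<Rightarrow> 'n \<Rightarrow> real \<Rightarrow> real" where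
  "scs d hs i = sc d (hs i)"

lemma csms_dv: "csms hs \<Longrightarrow> csms (dv a hs)"
  by (simp add: dv_def csm_derivs)

lemma csms_scs: "d > 0 \<Longrightarrow> csms hs \<Longrightarrow> csms (scs d hs)"
  by (simp add: scs_def csm_sc)

lemma dv_dv: "dv a (dv b hs) = dv (\<lambda>i. a i + b i) hs"
  by (auto simp: dv_def fun_eq_iff funpow_add)

lemma dv_0: "dv (\<lambda>_. 0) hs = hs"
  by (auto simp: dv_def fun_eq_iff)

lemma tens_upd: "tens (hs(i := g)) x = g (x $ i) * (\<Prod>j\<in>UNIV-{i}. hs j (x $ j))"
  unfolding tens_def by (subst prod.remove[of _ i]) auto

lemma partial_eqI:
  assumes "(F has_derivative F') (at x)"
  shows "partial i F x = F' (axis i 1)"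
proof -
  interpret bounded_linear F' using assms has_derivative_bounded_linear by blast
  have "((\<lambda>t. F (x + t *\<^sub>R axis i 1)) has_derivative (\<lambda>t. F' (t *\<^sub>R axis i 1))) (at 0)"
    by (rule has_derivative_compose[of "\<lambda>t. x + t *\<^sub>R axis i 1" "\<lambda>t. t *\<^sub>R axis i 1" 0 UNIV F F'])
      (use assms in \<open>auto intro!: derivative_eq_intros\<close>)
  then have "((\<lambda>t. F (x + t *\<^sub>R axis i 1)) has_real_derivative F' (axis i 1)) (at 0)"
    unfolding has_field_derivative_def by (rule has_derivative_eq_rhs) (auto simp: scaleR)
  then show ?thesis unfolding partial_def by (rule DERIV_imp_deriv)
qed

lemma tens_has_derivative:
  assumes "csms hs"
  shows "(tens hs has_derivative (\<lambda>h. \<Sum>i\<in>UNIV. h $ i * tens (hs(i := deriv (hs i))) x)) (at x)"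
proof -
  have "((\<lambda>x. hs i (x $ i)) has_derivative (\<lambda>h. h $ i * deriv (hs i) (x $ i))) (at x)" for i
    by (rule DERIV_compose_FDERIV[OF csm_has_deriv])
      (use assms in \<open>auto intro: bounded_linear_imp_has_derivative bounded_linear_vec_nth\<close>)
  then have "((\<lambda>x. \<Prod>i\<in>UNIV. hs i (x $ i)) has_derivative
     (\<lambda>h. \<Sum>i\<in>UNIV. (h $ i * deriv (hs i) (x $ i)) * (\<Prod>j\<in>UNIV-{i}. hs j (x $ j)))) (at x)"
    by (rule has_derivative_prod)
  moreover have "tens hs = (\<lambda>x. \<Prod>i\<in>UNIV. hs i (x $ i))" by (simp add: tens_def fun_eq_iff)
  ultimately show ?thesis by (simp add: tens_upd mult.assoc del: fun_upd_apply)
qed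

lemma partial_sum_axis: "(\<Sum>i\<in>UNIV. (axis j 1 :: real^'n::finite) $ i * c i) = c j"
  by (subst sum.remove[of _ j]) (auto simp: axis_def intro!: sum.neutral)

lemma partial_tens: "csms hs \<Longrightarrow> partial i (tens hs) = tens (hs(i := deriv (hs i)))"
  by (rule ext) (simp add: partial_eqI[OF tens_has_derivative] partial_sum_axis)

text \<open>A list of directions affects a tensor product only through the number of occurrences of
  each direction; this links \<open>pderivs\<close> with \<open>dv\<close>.\<close>

definition dvl :: "'n::finite list \<Rightarrow> ('n \<Rightarrow> real \<Rightarrow> real) \<Rightarrow> 'n \<Rightarrow> real \<Rightarrow> real" where
  "dvl is = dv (\<lambda>i. count_list is i)"

lemma dvl_simps: "dvl [] hs = hs" "dvl (j # is) hs = (dvl is hs)(j := deriv (dvl is hs j))"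
  by (auto simp: dvl_def dv_def fun_eq_iff)

lemma csms_dvl: "csms hs \<Longrightarrow> csms (dvl is hs)"
  unfolding dvl_def by (rule csms_dv)

lemma pderivs_tens: "csms hs \<Longrightarrow> pderivs is (tens hs) = tens (dvl is hs)"
  by (induction "is") (simp_all add: dvl_simps partial_tens csms_dvl)

lemma smooth_tens: "csms hs \<Longrightarrow> smooth (tens hs)"
  unfolding smooth_def differentiable_def
proof (intro allI)
  fix "is" x assume hs: "csms hs"
  show "\<exists>D. (pderivs is (tens hs) has_derivative D) (at x)"
    unfolding pderivs_tens[OF hs] by (rule exI, rule tens_has_derivative, rule csms_dvl[OF hs])
qed

text \<open>Over a finite index type every multi-index is the multiplicity function of a finite
  multiset, so the choice in \<open>mi_list\<close> is not vacuous.\<close>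

lemma mi_list_count: "count_list (mi_list a) i = a i"
proof -
  have "count (Abs_multiset a) = a" by (rule count_Abs_multiset) simp
  moreover obtain xs where "mset xs = Abs_multiset a" using ex_mset by blast
  ultimately have "\<forall>i. count_list xs i = a i" by (metis count_mset)
  then show ?thesis unfolding mi_list_def by (rule someI2) auto
qed

lemma length_mi_list: "length (mi_list a) = mi_abs a"
  using sum_count_set[of "mi_list a" UNIV] by (simp add: mi_abs_def mi_list_count)

lemma Dm_tens: "csms hs \<Longrightarrow> Dm a (tens hs) = tens (dv a hs)"
  by (simp add: Dm_def pderivs_tens dvl_def mi_list_count)

lemma mi_list_0: "mi_list (\<lambda>_. 0) = []"
  using length_mi_list[of "\<lambda>_. 0"] by (simp add: mi_abs_def)

lemma tens_continuous: "csms hs \<Longrightarrow> continuous_on S (tens hs)"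
  using tens_has_derivative by (meson continuous_at_imp_continuous_on has_derivative_continuous)

lemma tens_support:
  assumes "csms hs"
  obtains r where "r > 0" "\<And>x. r < norm x \<Longrightarrow> tens hs x = 0"
proof -
  have "\<exists>r. \<forall>i. r i > 0 \<and> (\<forall>t. r i < \<bar>t\<bar> \<longrightarrow> hs i t = 0)"
    by (rule choice) (use assms csm_ex in auto)
  then obtain r where r: "\<And>i. r i > 0" "\<And>i t. r i < \<bar>t\<bar> \<Longrightarrow> hs i t = 0" by blast
  have "tens hs x = 0" if "sum r UNIV < norm x" for x
  proof -
    have "\<exists>i. r i < \<bar>x $ i\<bar>"
    proof (rule ccontr)
      assume "\<not> ?thesis"
      then have "(\<Sum>i\<in>UNIV. \<bar>x $ i\<bar>) \<le> sum r UNIV" by (intro sum_mono) (auto simp: not_less)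
      then show False using norm_le_l1_cart[of x] that by simp
    qed
    then obtain i where "hs i (x $ i) = 0" using r by blast
    then show ?thesis unfolding tens_def by (auto intro: prod_zero)
  qed
  moreover have "sum r UNIV > 0" using r by (intro sum_pos) auto
  ultimately show ?thesis using that by blast
qed

lemma continuous_support_bounded:
  fixes g :: "real^'n::finite \<Rightarrow> real"
  assumes "continuous_on UNIV g" "\<And>x. r < norm x \<Longrightarrow> g x = 0"
  obtains B where "B > 0" "\<And>x. \<bar>g x\<bar> \<le> B"
proof -
  have "compact (g ` cball 0 r)"
    by (intro compact_continuous_image continuous_on_subset[OF assms(1)]) auto
  then obtain B where B: "\<And>y. y \<in> g ` cball 0 r \<Longrightarrow> norm y \<le> B"
    using compact_imp_bounded bounded_iff by metis
  have "\<bar>g x\<bar> \<le> max B 1" for x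
    using B[of "g x"] assms(2)[of x] by (cases "norm x \<le> r") auto
  then show ?thesis by (intro that[of "max B 1"]) auto
qed

lemma tens_bounded:
  assumes "csms hs" obtains B where "B > 0" "\<And>x. \<bar>tens hs x\<bar> \<le> B"
  by (metis assms continuous_support_bounded tens_continuous tens_support)

lemma tens_measurable[measurable]: "csms hs \<Longrightarrow> tens hs \<in> borel_measurable borel"
  by (rule borel_measurable_continuous_onI[OF tens_continuous])

text \<open>Measures and functions are convolved uniformly: a finite measure \<open>M\<close> with \<open>f = 1\<close>, or \<open>M = lborel\<close>
  with a locally integrable \<open>f\<close>.\<close>

definition locint :: "(real^'n::finite) measure \<Rightarrow> (real^'n \<Rightarrow> real) \<Rightarrow> bool" where
  "locint M f \<longleftrightarrow> sets M = sets borel \<and> f \<in> borel_measurable borel \<and> (\<forall>r. set_integrable M (cball 0 r) f)"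

lemma locint_loc_int: "loc_int f \<Longrightarrow> locint lborel f"
  by (auto simp: loc_int_def locint_def)

lemma locint_finite: "finite_measure M \<Longrightarrow> sets M = sets borel \<Longrightarrow> locint M (\<lambda>_. 1)"
proof -
  assume "finite_measure M" and s: "sets M = sets borel"
  then interpret finite_measure M by simp
  have "integrable M (\<lambda>_. 1::real)" by simp
  then show "locint M (\<lambda>_. 1)"
    unfolding locint_def set_integrable_def
    by (intro conjI allI integrable_mult_indicator) (simp_all add: s)
qed

lemma loc_int_integrable: "integrable lborel f \<Longrightarrow> loc_int f"
  unfolding loc_int_def set_integrable_def
  by (intro conjI allI impI integrable_mult_indicator) (auto simp: borel_compact)

lemma loc_int_bounded:
  fixes f :: "real^'n::finite \<Rightarrow> real"
  assumes [measurable]: "f \<in> borel_measurable borel" and "\<And>x. \<bar>f x\<bar> \<le> B"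
  shows "loc_int f"
  unfolding loc_int_def set_integrable_def
proof (intro conjI allI impI)
  fix K :: "(real^'n) set" assume K: "compact K"
  have [measurable]: "K \<in> sets borel" using K borel_compact by blast
  have "integrable lborel (\<lambda>x. B * indicator K x)"
    using K by (intro integrable_mult_right integrable_real_indicator) (use emeasure_bounded_finite[OF compact_imp_bounded[OF K]] in auto)
  then show "integrable lborel (\<lambda>x. indicator K x *\<^sub>R f x)"
  proof (rule Bochner_Integration.integrable_bound)
    show "AE x in lborel. norm (indicator K x *\<^sub>R f x) \<le> norm (B * indicator K x :: real)"
    proof (intro always_eventually allI)
      fix x show "norm (indicator K x *\<^sub>R f x) \<le> norm (B * indicator K x :: real)"
        using assms(2)[of x] abs_ge_zero[of "f x"] by (auto simp: indicator_def)
    qed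
  qed simp
qed simp

lemma locint_integrable_mult:
  assumes "locint M f" and [measurable]: "g \<in> borel_measurable borel"
    and "\<And>y. r < norm y \<Longrightarrow> g y = 0" "\<And>y. \<bar>g y\<bar> \<le> B"
  shows "integrable M (\<lambda>y. f y * g y)"
proof -
  have [measurable]: "f \<in> borel_measurable borel" and [measurable_cong]: "sets M = sets borel"
    using assms(1) by (auto simp: locint_def)
  have "integrable M (\<lambda>y. B * (indicator (cball 0 r) y *\<^sub>R f y))"
    using assms(1) unfolding locint_def set_integrable_def by (intro integrable_mult_right) blast
  then show ?thesis
  proof (rule Bochner_Integration.integrable_bound)
    show "AE y in M. norm (f y * g y) \<le> norm (B * (indicator (cball 0 r) y *\<^sub>R f y))"
    proof (intro always_eventually allI)
      fix y
      have "\<bar>f y\<bar> * \<bar>g y\<bar> \<le> \<bar>f y\<bar> * \<bar>B\<bar>"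
        by (intro mult_left_mono) (use assms(4)[of y] in auto)
      then show "norm (f y * g y) \<le> norm (B * (indicator (cball 0 r) y *\<^sub>R f y))"
        using assms(3)[of y] by (cases "norm y \<le> r") (auto simp: abs_mult mult.commute)
    qed
  qed measurable
qed

section \<open>Convolutions and their derivatives\<close>

definition conv :: "(real^'n::finite) measure \<Rightarrow> (real^'n \<Rightarrow> real) \<Rightarrow> (real^'n \<Rightarrow> real) \<Rightarrow> real^'n \<Rightarrow> real" where
  "conv M f g x = (\<integral>y. f y * g (x - y) \<partial>M)"

lemma conv_integrable:
  assumes "locint M f" "csms hs"
  shows "integrable M (\<lambda>y. f y * tens hs (x - y))"
proof -
  obtain B where B: "\<And>x. \<bar>tens hs x\<bar> \<le> B" using tens_bounded[OF assms(2)] by blast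
  obtain r where r: "\<And>x. r < norm x \<Longrightarrow> tens hs x = 0" using tens_support[OF assms(2)] by blast
  note [measurable] = tens_measurable[OF assms(2)]
  show ?thesis
  proof (rule locint_integrable_mult[OF assms(1)])
    fix y :: "(real, 'a) vec" assume "norm x + r < norm y"
    then have "r < norm (x - y)" using norm_triangle_ineq2[of y x] by (simp add: norm_minus_commute)
    then show "tens hs (x - y) = 0" by (rule r)
  qed (use B in auto)
qed

text \<open>The total derivative is obtained at once, by dominated convergence of the remainder
  quotient along an arbitrary null sequence of increments. The kernel is Lipschitz with compact
  support, so the quotient is bounded by 2 L and, as a function of y, lives in a fixed ball, where
  \<open>f\<close> is integrable.\<close>

lemma conv_has_derivative:
  assumes f: "locint M f" and hs: "csms hs"
  shows "(conv M f (tens hs) has_derivative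
    (\<lambda>h. \<Sum>i\<in>UNIV. h $ i * conv M f (tens (hs(i := deriv (hs i)))) x)) (at x)"
proof -
  have fm[measurable]: "f \<in> borel_measurable borel" and [measurable_cong]: "sets M = sets borel"
    using f by (auto simp: locint_def)
  define g where "g = tens hs"
  define D where "D u h = (\<Sum>i\<in>UNIV. h $ i * tens (hs(i := deriv (hs i))) u)" for u h
  have hs': "csms (hs(i := deriv (hs i)))" for i using hs csm_deriv by simp
  have gD: "(g has_derivative D u) (at u)" for u
    unfolding g_def D_def by (rule tens_has_derivative[OF hs])
  have "\<exists>B. \<forall>i. B i > 0 \<and> (\<forall>u. \<bar>tens (hs(i := deriv (hs i))) u\<bar> \<le> B i)"
    by (rule choice) (metis hs' tens_bounded)
  then obtain B where B: "\<And>i. B i > 0" "\<And>i u. \<bar>tens (hs(i := deriv (hs i))) u\<bar> \<le> B i" by blast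
  have "\<exists>r. \<forall>i. r i > 0 \<and> (\<forall>u. r i < norm u \<longrightarrow> tens (hs(i := deriv (hs i))) u = 0)"
    by (rule choice) (metis hs' tens_support)
  then obtain r' where r': "\<And>i. r' i > 0" "\<And>i u. r' i < norm u \<Longrightarrow> tens (hs(i := deriv (hs i))) u = 0" by blast
  obtain r0 where r0: "r0 > 0" "\<And>u. r0 < norm u \<Longrightarrow> g u = 0"
    using tens_support[OF hs] unfolding g_def by blast
  define L where "L = sum B UNIV"
  define r where "r = r0 + sum r' UNIV"
  have rg: "g u = 0" if "r < norm u" for u
  proof -
    have "sum r' UNIV \<ge> 0" using r' by (intro sum_nonneg) (auto simp: less_imp_le)
    then show ?thesis using that r0 unfolding r_def by auto
  qed
  have rD: "D u h = 0" if "r < norm u" for u h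
  proof -
    have "r' i < norm u" for i
    proof -
      have "r' i \<le> sum r' UNIV" using r' by (intro member_le_sum) (auto simp: less_imp_le)
      then show ?thesis using that r0 unfolding r_def by auto
    qed
    then show ?thesis unfolding D_def using r' by (intro sum.neutral) auto
  qed
  have DL: "\<bar>D u h\<bar> \<le> L * norm h" for u h
  proof -
    have "\<bar>D u h\<bar> \<le> (\<Sum>i\<in>UNIV. \<bar>h $ i * tens (hs(i := deriv (hs i))) u\<bar>)"
      unfolding D_def by (rule sum_abs)
    also have "\<dots> \<le> (\<Sum>i\<in>UNIV. norm h * B i)"
      unfolding abs_mult by (intro sum_mono mult_mono B component_le_norm_cart) auto
    finally show ?thesis by (simp add: L_def sum_distrib_left mult.commute)
  qed
  have gL: "\<bar>g (u + h) - g u\<bar> \<le> L * norm h" for u h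
  proof -
    have "norm (g (u + h) - g u) \<le> L * norm ((u + h) - u)"
      by (rule differentiable_bound[where S = UNIV and f' = D])
        (use gD DL in \<open>auto intro!: onorm_bound simp: L_def B less_imp_le sum_nonneg\<close>)
    then show ?thesis by simp
  qed
  have gm[measurable]: "g \<in> borel_measurable borel" unfolding g_def using hs by measurable
  have Dm[measurable]: "(\<lambda>u. D u h) \<in> borel_measurable borel" for h
    unfolding D_def using hs' by measurable
  have i1: "integrable M (\<lambda>y. f y * g (x' - y))" for x'
    unfolding g_def by (rule conv_integrable[OF f hs])
  have i2: "integrable M (\<lambda>y. f y * tens (hs(i := deriv (hs i))) (x - y))" for x i
    by (rule conv_integrable[OF f hs'])
  have i3: "integrable M (\<lambda>y. f y * D (x - y) h)"
       and D_int: "(\<integral>y. f y * D (x - y) h \<partial>M) = (\<Sum>i\<in>UNIV. h $ i * conv M f (tens (hs(i := deriv (hs i)))) x)" for h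
  proof -
    have eq: "(\<lambda>y. f y * D (x - y) h) = (\<lambda>y. \<Sum>i\<in>UNIV. h $ i * (f y * tens (hs(i := deriv (hs i))) (x - y)))"
      by (auto simp: D_def sum_distrib_left mult_ac)
    show "integrable M (\<lambda>y. f y * D (x - y) h)" unfolding eq
      by (intro Bochner_Integration.integrable_sum integrable_mult_right i2)
    show "(\<integral>y. f y * D (x - y) h \<partial>M) = (\<Sum>i\<in>UNIV. h $ i * conv M f (tens (hs(i := deriv (hs i)))) x)"
      unfolding eq conv_def by (subst Bochner_Integration.integral_sum) (auto intro!: integrable_mult_right i2)
  qed
  show ?thesis unfolding has_derivative_at
  proof (intro conjI)
    show "bounded_linear (\<lambda>h. \<Sum>i\<in>UNIV. h $ i * conv M f (tens (hs(i := deriv (hs i)))) x)"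
      by (intro bounded_linear_sum bounded_linear_mult_const bounded_linear_vec_nth)
    show "(\<lambda>h. norm (conv M f (tens hs) (x + h) - conv M f (tens hs) x -
        (\<Sum>i\<in>UNIV. h $ i * conv M f (tens (hs(i := deriv (hs i)))) x)) / norm h) \<midarrow>0\<rightarrow> 0"
      unfolding tendsto_at_iff_sequentially
    proof (intro allI impI)
      fix X :: "nat \<Rightarrow> real^'a" assume X0: "\<forall>n. X n \<in> UNIV - {0}" and X: "X \<longlonglongrightarrow> 0"
      obtain b where b: "\<And>n. norm (X n) \<le> b"
        using X convergentI Bseq_def convergent_imp_Bseq by (metis BseqE)
      define s where "s n y = f y * ((g (x - y + X n) - g (x - y) - D (x - y) (X n)) / norm (X n))" for n y
      have "(\<lambda>n. \<integral>y. s n y \<partial>M) \<longlonglongrightarrow> (\<integral>y. 0 \<partial>M)"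
      proof (rule integral_dominated_convergence)
        \<comment> \<open>The radius allows for the increments: \<open>b\<close> bounds all
          \<open>X n\<close>, so beyond norm x + r + b both x - y and x - y + X n lie outside the
          ball of radius r that supports \<open>g\<close> and \<open>D\<close>.\<close>
        show "integrable M (\<lambda>y. 2 * L * \<bar>indicator (cball 0 (norm x + r + b)) y *\<^sub>R f y\<bar>)"
          using f unfolding locint_def set_integrable_def by (intro integrable_mult_right integrable_abs) blast
        show "AE y in M. (\<lambda>n. s n y) \<longlonglongrightarrow> 0"
        proof (intro always_eventually allI)
          fix y
          have "(\<lambda>h. norm (g (x - y + h) - g (x - y) - D (x - y) h) / norm h) \<midarrow>0\<rightarrow> 0"
            using gD[of "x - y"] unfolding has_derivative_at by blast
          then have "(\<lambda>n. norm (g (x - y + X n) - g (x - y) - D (x - y) (X n)) / norm (X n)) \<longlonglongrightarrow> 0"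
            unfolding tendsto_at_iff_sequentially using X0 X by (auto simp: o_def)
          then have "(\<lambda>n. norm ((g (x - y + X n) - g (x - y) - D (x - y) (X n)) / norm (X n))) \<longlonglongrightarrow> 0"
            by simp
          then have "(\<lambda>n. (g (x - y + X n) - g (x - y) - D (x - y) (X n)) / norm (X n)) \<longlonglongrightarrow> 0"
            by (rule tendsto_norm_zero_cancel)
          then show "(\<lambda>n. s n y) \<longlonglongrightarrow> 0" unfolding s_def by (rule tendsto_mult_right_zero)
        qed
        show "AE y in M. norm (s n y) \<le> 2 * L * \<bar>indicator (cball 0 (norm x + r + b)) y *\<^sub>R f y\<bar>" for n
        proof (intro always_eventually allI)
          fix y
          show "norm (s n y) \<le> 2 * L * \<bar>indicator (cball 0 (norm x + r + b)) y *\<^sub>R f y\<bar>"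
          proof (cases "norm y \<le> norm x + r + b")
            case True
            have "\<bar>(g (x - y + X n) - g (x - y) - D (x - y) (X n)) / norm (X n)\<bar> \<le> 2 * L"
              using gL[of "x - y" "X n"] DL[of "x - y" "X n"] X0 by (simp add: field_simps)
            then have "\<bar>f y\<bar> * \<bar>(g (x - y + X n) - g (x - y) - D (x - y) (X n)) / norm (X n)\<bar> \<le> \<bar>f y\<bar> * (2 * L)"
              by (intro mult_left_mono) auto
            then show ?thesis using True by (simp add: s_def abs_mult mult_ac)
          next
            case False
            have 1: "norm (x - y) > r + b" using False norm_triangle_ineq2[of y x] by (simp add: norm_minus_commute)
            have "norm (x - y + X n) \<ge> norm (x - y) - norm (X n)" by (metis norm_diff_ineq)
            then have "norm (x - y + X n) > r" "norm (x - y) > r"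
              using 1 b[of n] norm_ge_zero[of "X n"] by linarith+
            then show ?thesis using False by (simp add: s_def rg rD)
          qed
        qed
      qed (unfold s_def, measurable)
      then have "(\<lambda>n. norm (\<integral>y. s n y \<partial>M)) \<longlonglongrightarrow> 0" by (intro tendsto_norm_zero) simp
      moreover have "norm (\<integral>y. s n y \<partial>M) = norm (conv M f (tens hs) (x + X n) - conv M f (tens hs) x -
        (\<Sum>i\<in>UNIV. X n $ i * conv M f (tens (hs(i := deriv (hs i)))) x)) / norm (X n)" for n
      proof -
        have "(\<integral>y. s n y \<partial>M) = (\<integral>y. (f y * g ((x + X n) - y) - f y * g (x - y) - f y * D (x - y) (X n)) / norm (X n) \<partial>M)"
          unfolding s_def by (intro Bochner_Integration.integral_cong) (auto simp: algebra_simps diff_divide_distrib)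
        also have "\<dots> = (\<integral>y. (f y * g ((x + X n) - y) - f y * g (x - y) - f y * D (x - y) (X n)) \<partial>M) / norm (X n)"
          by simp
        also have "(\<integral>y. (f y * g ((x + X n) - y) - f y * g (x - y) - f y * D (x - y) (X n)) \<partial>M)
           = (\<integral>y. f y * g ((x + X n) - y) \<partial>M) - (\<integral>y. f y * g (x - y) \<partial>M) - (\<integral>y. f y * D (x - y) (X n) \<partial>M)"
          using i1 i3 by (subst Bochner_Integration.integral_diff) (auto simp: Bochner_Integration.integral_diff)
        finally show ?thesis unfolding D_int by (simp add: conv_def g_def)
      qed
      ultimately show "((\<lambda>h. norm (conv M f (tens hs) (x + h) - conv M f (tens hs) x -
        (\<Sum>i\<in>UNIV. h $ i * conv M f (tens (hs(i := deriv (hs i)))) x)) / norm h) \<circ> X) \<longlonglongrightarrow> 0"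
        by (simp add: o_def)
    qed
  qed
qed

lemma partial_conv:
  "locint M f \<Longrightarrow> csms hs \<Longrightarrow> partial i (conv M f (tens hs)) = conv M f (tens (hs(i := deriv (hs i))))"
  by (rule ext) (simp add: partial_eqI[OF conv_has_derivative] partial_sum_axis)

lemma pderivs_conv:
  "locint M f \<Longrightarrow> csms hs \<Longrightarrow> pderivs is (conv M f (tens hs)) = conv M f (tens (dvl is hs))"
  by (induction "is") (simp_all add: dvl_simps partial_conv csms_dvl)

lemma smooth_conv: "locint M f \<Longrightarrow> csms hs \<Longrightarrow> smooth (conv M f (tens hs))"
  unfolding smooth_def differentiable_def
proof (intro allI)
  fix "is" x assume f: "locint M f" and hs: "csms hs"
  show "\<exists>D. (pderivs is (conv M f (tens hs)) has_derivative D) (at x)"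
    unfolding pderivs_conv[OF f hs] by (rule exI, rule conv_has_derivative[OF f], rule csms_dvl[OF hs])
qed

lemma Dm_conv: "locint M f \<Longrightarrow> csms hs \<Longrightarrow> Dm a (conv M f (tens hs)) = conv M f (tens (dv a hs))"
  by (simp add: Dm_def pderivs_conv dvl_def mi_list_count)

lemma tens_scs:
  fixes hs :: "'n::finite \<Rightarrow> real \<Rightarrow> real"
  shows "tens (scs d hs) x = tens hs (inverse d *\<^sub>R x) / d ^ CARD('n)"
  by (simp add: tens_def scs_def sc_def prod_dividef divide_inverse mult.commute prod.distrib power_inverse)

lemma tens_dv_scs:
  assumes "csms hs" "d > 0"
  shows "tens (dv a (scs d hs)) x = tens (scs d (dv a hs)) x / d ^ mi_abs a"
proof -
  have "tens (dv a (scs d hs)) x = (\<Prod>i\<in>UNIV. sc d ((deriv ^^ a i) (hs i)) (x $ i) / d ^ a i)"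
    unfolding tens_def dv_def scs_def using assms by (simp add: derivs_sc)
  also have "\<dots> = tens (scs d (dv a hs)) x / d ^ mi_abs a"
    by (simp add: prod_dividef tens_def scs_def dv_def mi_abs_def power_sum)
  finally show ?thesis .
qed

lemma integrable_continuous_support:
  fixes g :: "real^'n::finite \<Rightarrow> real"
  assumes "continuous_on UNIV g" "\<And>x. r < norm x \<Longrightarrow> g x = 0"
  shows "integrable lborel g"
proof -
  obtain B where "\<And>x. \<bar>g x\<bar> \<le> B" using continuous_support_bounded[OF assms] by blast
  then have "integrable lborel (\<lambda>x. 1 * g x)"
    by (intro locint_integrable_mult[OF locint_loc_int[OF loc_int_bounded[of _ 1]]] assms(2)
        borel_measurable_continuous_onI assms(1)) auto
  then show ?thesis by simp
qed

lemma tens_integrable: "csms hs \<Longrightarrow> integrable lborel (tens hs)"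
  by (metis integrable_continuous_support tens_continuous tens_support)

section \<open>Scaling and integrals of tensor kernels\<close>

definition L1t :: "('n::finite \<Rightarrow> real \<Rightarrow> real) \<Rightarrow> real" where
  "L1t hs = (\<integral>x. \<bar>tens hs x\<bar> \<partial>lborel)"

lemma L1t_nonneg: "0 \<le> L1t hs"
  by (simp add: L1t_def)

lemma integral_scale:
  fixes g :: "real^'n::finite \<Rightarrow> real"
  assumes "d > 0" and [measurable]: "g \<in> borel_measurable borel"
  shows "(\<integral>x. g (inverse d *\<^sub>R x) / d ^ CARD('n) \<partial>lborel) = (\<integral>x. g x \<partial>lborel)"
proof -
  have "(\<integral>x. g x \<partial>lborel) = (\<integral>x. g x \<partial>(density (distr lborel borel (\<lambda>x::real^'n. 0 + inverse d *\<^sub>R x)) (\<lambda>_. ennreal (\<bar>inverse d\<bar> ^ DIM(real^'n)))))"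
    using assms(1) by (intro arg_cong[where f = "\<lambda>M. integral\<^sup>L M g"] lborel_affine) auto
  also have "\<dots> = (\<integral>x. \<bar>inverse d\<bar> ^ DIM(real^'n) *\<^sub>R g (inverse d *\<^sub>R x) \<partial>lborel)"
    by (subst integral_density) (auto simp: integral_distr)
  finally show ?thesis using assms(1) by (simp add: divide_inverse power_inverse mult.commute)
qed

lemma L1t_scs:
  assumes "csms hs" "d > 0" shows "L1t (scs d hs) = L1t hs"
proof -
  have m: "(\<lambda>x. \<bar>tens hs x\<bar>) \<in> borel_measurable borel"
    using tens_measurable[OF assms(1)] by measurable
  show ?thesis
    unfolding L1t_def integral_scale[OF assms(2) m, symmetric] tens_scs using assms by simp
qed

lemma prod_Basis_vec:
  "(\<Prod>b\<in>Basis. F b) = (\<Prod>i\<in>UNIV. F (axis i (1::real) :: real^'n::finite))"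
proof -
  have "bij_betw (\<lambda>i. axis i (1::real) :: real^'n) UNIV Basis"
    by (auto simp: bij_betw_def inj_on_def axis_eq_axis Basis_vec_def)
  from prod.reindex_bij_betw[OF this, of F] show ?thesis by simp
qed

lemma integral_tens:
  fixes hs :: "'n::finite \<Rightarrow> real \<Rightarrow> real"
  assumes "csms hs"
  shows "(\<integral>x. tens hs x \<partial>lborel) = (\<Prod>i\<in>UNIV. \<integral>t. hs i t \<partial>lborel)"
proof -
  interpret product_sigma_finite "\<lambda>_::real^'n. lborel :: real measure" by standard
  \<comment> \<open>Lebesgue measure on the vector space is a product over \<open>Basis\<close>, so
    the family is transported from coordinates to unit vectors.\<close>
  define F where "F b = hs (SOME i. b = axis i (1::real))" for b :: "real^'n"
  have F: "F (axis i 1) = hs i" for i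
    unfolding F_def by (rule arg_cong[of _ _ hs], rule some_equality) (auto simp: axis_eq_axis)
  have FB: "b \<in> Basis \<Longrightarrow> csm (F b)" for b
    using assms by (auto simp: Basis_vec_def F)
  have tF: "tens hs x = (\<Prod>b\<in>Basis. F b (x \<bullet> b))" for x
    by (simp add: prod_Basis_vec F tens_def inner_axis)
  note tens_measurable[OF assms, measurable]
  have "(\<integral>x. tens hs x \<partial>lborel) = (\<integral>f. tens hs (\<Sum>b\<in>Basis. f b *\<^sub>R b) \<partial>(\<Pi>\<^sub>M b\<in>Basis. lborel))"
    by (subst lborel_eq, subst integral_distr) auto
  also have "\<dots> = (\<integral>f. (\<Prod>b\<in>Basis. F b (f b)) \<partial>(\<Pi>\<^sub>M b\<in>Basis. lborel))"
    unfolding tF by (intro Bochner_Integration.integral_cong refl prod.cong) simp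
  also have "\<dots> = (\<Prod>b\<in>Basis. \<integral>t. F b t \<partial>lborel)"
    by (rule product_integral_prod) (auto intro: csm_integrable FB)
  also have "\<dots> = (\<Prod>i\<in>UNIV. \<integral>t. hs i t \<partial>lborel)"
    by (simp add: prod_Basis_vec F)
  finally show ?thesis .
qed

subsection \<open>Weak derivatives and densities\<close>

lemma integral_lborel_translate:
  fixes f :: "real^'n::finite \<Rightarrow> real"
  assumes [measurable]: "f \<in> borel_measurable borel"
  shows "(\<integral>x. f (c + x) \<partial>lborel) = (\<integral>x. f x \<partial>lborel)"
  by (subst (2) lborel_distr_plus[of c, symmetric]) (simp add: integral_distr)

lemma lborel_distr_reflect: "distr lborel borel (\<lambda>x::real^'n::finite. c - x) = lborel"
  by (subst lborel_affine[of "-1" c], auto simp: density_1)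

lemma nn_integral_lborel_translate:
  fixes f :: "real^'n::finite \<Rightarrow> ennreal"
  assumes [measurable]: "f \<in> borel_measurable borel"
  shows "(\<integral>\<^sup>+x. f (c + x) \<partial>lborel) = (\<integral>\<^sup>+x. f x \<partial>lborel)"
  by (subst (2) lborel_distr_plus[of c, symmetric]) (simp add: nn_integral_distr)

lemma integral_lborel_reflect:
  fixes f :: "real^'n::finite \<Rightarrow> real"
  assumes [measurable]: "f \<in> borel_measurable borel"
  shows "(\<integral>x. f (c - x) \<partial>lborel) = (\<integral>x. f x \<partial>lborel)"
  by (subst (2) lborel_distr_reflect[of c, symmetric]) (simp add: integral_distr)

section \<open>Integration by parts\<close>

lemma pderivs_append: "pderivs (xs @ ys) u = pderivs xs (pderivs ys u)"
  by (induction xs) auto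

lemma smooth_pderivs: "smooth u \<Longrightarrow> smooth (pderivs is u)"
  unfolding smooth_def by (simp add: pderivs_append[symmetric])

lemma smooth_partial: "smooth u \<Longrightarrow> smooth (partial i u)"
  using smooth_pderivs[of u "[i]"] by simp

lemma smooth_differentiable: "smooth u \<Longrightarrow> u differentiable (at x)"
  unfolding smooth_def using pderivs.simps(1) by metis

lemma smooth_continuous: "smooth u \<Longrightarrow> continuous_on S u"
  by (meson continuous_at_imp_continuous_on differentiable_imp_continuous_within smooth_differentiable)

lemma smooth_measurable[measurable]: "smooth u \<Longrightarrow> u \<in> borel_measurable borel"
  by (rule borel_measurable_continuous_onI[OF smooth_continuous])

lemma smooth_has_derivative: "smooth u \<Longrightarrow> (u has_derivative frechet_derivative u (at x)) (at x)"
  using smooth_differentiable frechet_derivative_works by blast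

lemma partial_has_deriv:
  assumes "\<And>x. F differentiable (at x)"
  shows "((\<lambda>t. F (x + t *\<^sub>R axis i 1)) has_real_derivative partial i F (x + t *\<^sub>R axis i 1)) (at t)"
proof -
  let ?y = "x + t *\<^sub>R axis i 1"
  obtain F' where F': "(F has_derivative F') (at ?y)" using assms differentiable_def by blast
  interpret bounded_linear F' using F' has_derivative_bounded_linear by blast
  have "((\<lambda>t. F (x + t *\<^sub>R axis i 1)) has_derivative (\<lambda>s. F' (s *\<^sub>R axis i 1))) (at t)"
    by (rule has_derivative_compose[of "\<lambda>t. x + t *\<^sub>R axis i 1" "\<lambda>t. t *\<^sub>R axis i 1" t UNIV F F'])
      (use F' in \<open>auto intro!: derivative_eq_intros\<close>)
  then show ?thesis unfolding has_field_derivative_def partial_eqI[OF F']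
    by (rule has_derivative_eq_rhs) (auto simp: scaleR)
qed

lemma partial_support:
  assumes "\<And>x. r < norm x \<Longrightarrow> F x = 0" "r < norm x"
  shows "partial i F x = 0"
proof -
  have "(F has_derivative (\<lambda>_. 0)) (at x)"
    by (rule has_derivative_transform_within_open[where f = "\<lambda>_. 0" and s = "{x. r < norm x}"])
      (use assms in \<open>auto intro!: open_Collect_less continuous_intros\<close>)
  then show ?thesis using partial_eqI[of F "\<lambda>_. 0"] by simp
qed

lemma pderivs_support:
  assumes "\<And>x. r < norm x \<Longrightarrow> F x = 0"
  shows "r < norm x \<Longrightarrow> pderivs is F x = 0"
proof (induction "is" arbitrary: x)
  case (Cons i js) then show ?case by (auto intro!: partial_support[of r])
qed (use assms in auto)

lemma test_fun_support:
  assumes "test_fun \<phi>"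
  obtains r where "\<And>x. r < norm x \<Longrightarrow> \<phi> x = 0"
proof -
  obtain K where K: "compact K" "\<And>x. x \<notin> K \<Longrightarrow> \<phi> x = 0" using assms test_fun_def by blast
  obtain r where "\<And>x. x \<in> K \<Longrightarrow> norm x \<le> r" using compact_imp_bounded[OF K(1)] bounded_iff by metis
  then show ?thesis using K that[of r] by (meson not_less)
qed

lemma test_fun_tens: "csms hs \<Longrightarrow> test_fun (tens hs)"
  unfolding test_fun_def
proof (intro conjI smooth_tens)
  assume hs: "csms hs"
  obtain r where r: "\<And>x. r < norm x \<Longrightarrow> tens hs x = 0" using tens_support[OF hs] by blast
  show "\<exists>K. compact K \<and> (\<forall>x. x \<notin> K \<longrightarrow> tens hs x = 0)"
    by (rule exI[of _ "cball 0 r"]) (use r in auto)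
qed

text \<open>Translation invariance makes the integral of every difference quotient of
  \<open>F\<close> vanish, and these quotients converge to \<open>partial i F\<close> under a fixed
  integrable bound. No splitting into coordinates is involved.\<close>

lemma integral_partial_zero:
  fixes F :: "real^'n::finite \<Rightarrow> real"
  assumes d: "\<And>x. F differentiable (at x)" and c: "continuous_on UNIV (partial i F)"
    and s: "\<And>x. r < norm x \<Longrightarrow> F x = 0"
  shows "(\<integral>x. partial i F x \<partial>lborel) = 0"
proof -
  let ?a = "axis i (1::real) :: real^'n"
  have cF: "continuous_on UNIV F" using d by (simp add: continuous_at_imp_continuous_on differentiable_imp_continuous_within)
  have mF[measurable]: "F \<in> borel_measurable borel" by (rule borel_measurable_continuous_onI[OF cF])
  have mP[measurable]: "partial i F \<in> borel_measurable borel" by (rule borel_measurable_continuous_onI[OF c])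
  have ps: "r < norm x \<Longrightarrow> partial i F x = 0" for x by (rule partial_support[where r = r]) (use s in auto)
  have iF: "integrable lborel F" by (rule integrable_continuous_support[OF cF s])
  have iFt: "integrable lborel (\<lambda>x. F (c + x))" for c
  proof (rule integrable_continuous_support)
    show "continuous_on UNIV (\<lambda>x. F (c + x))" by (intro continuous_on_compose2[OF cF] continuous_intros) auto
    fix x :: "real^'n" assume "r + norm c < norm x"
    then have "r < norm (c + x)" using norm_triangle_ineq4[of "c + x" c] by simp
    then show "F (c + x) = 0" by (rule s)
  qed
  obtain B where B: "B > 0" "\<And>x. \<bar>partial i F x\<bar> \<le> B"
    by (rule continuous_support_bounded[OF c ps]) blast+
  define X :: "nat \<Rightarrow> real" where "X n = inverse (real (Suc n))" for n
  have X: "X n > 0" "X n \<le> 1" for n by (auto simp: X_def field_simps)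
  have Xne: "X n \<noteq> 0" for n using X(1)[of n] by simp
  have X0: "X \<longlonglongrightarrow> 0" unfolding X_def by (rule LIMSEQ_inverse_real_of_nat)
  let ?s = "\<lambda>n x. (F (X n *\<^sub>R ?a + x) - F x) / X n"
  have "(\<lambda>n. \<integral>x. ?s n x \<partial>lborel) \<longlonglongrightarrow> (\<integral>x. partial i F x \<partial>lborel)"
  proof (rule integral_dominated_convergence)
    \<comment> \<open>The mean value theorem bounds the quotients by the supremum of the partial
      derivative; the radius grows by 1 because the steps \<open>X n\<close> are at most 1.\<close>
    show "integrable lborel (\<lambda>x. B * indicator (cball 0 (r + 1)) x :: real)"
      by (intro integrable_mult_right integrable_real_indicator) (use emeasure_bounded_finite in auto)
    show "AE x in lborel. (\<lambda>n. ?s n x) \<longlonglongrightarrow> partial i F x"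
    proof (intro always_eventually allI)
      fix x
      have "((\<lambda>t. F (x + t *\<^sub>R ?a)) has_real_derivative partial i F x) (at 0)"
        using partial_has_deriv[OF d, of x i 0] by simp
      then have "(\<lambda>h. (F (x + h *\<^sub>R ?a) - F x) / h) \<midarrow>0\<rightarrow> partial i F x"
        unfolding DERIV_def by simp
      then show "(\<lambda>n. ?s n x) \<longlonglongrightarrow> partial i F x"
        unfolding tendsto_at_iff_sequentially using X0 Xne by (auto simp: o_def add.commute)
    qed
    show "AE x in lborel. norm (?s n x) \<le> B * indicator (cball 0 (r + 1)) x" for n
    proof (intro always_eventually allI)
      fix x
      show "norm (?s n x) \<le> B * indicator (cball 0 (r + 1)) x"
      proof (cases "norm x \<le> r + 1")
        case True
        obtain z where "F (x + X n *\<^sub>R ?a) - F (x + 0 *\<^sub>R ?a) = (X n - 0) * partial i F (x + z *\<^sub>R ?a)"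
          using MVT2[OF X(1), of n "\<lambda>t. F (x + t *\<^sub>R ?a)" "\<lambda>t. partial i F (x + t *\<^sub>R ?a)"]
            partial_has_deriv[OF d] by blast
        then have "?s n x = partial i F (x + z *\<^sub>R ?a)" using X(1)[of n] by (simp add: add.commute)
        then show ?thesis using True B(2) by simp
      next
        case False
        then have "r < norm x" by simp
        moreover have "r < norm (X n *\<^sub>R ?a + x)"
        proof -
          have "norm x \<le> norm (X n *\<^sub>R ?a + x) + norm (X n *\<^sub>R ?a)"
            using norm_triangle_ineq4[of "X n *\<^sub>R ?a + x" "X n *\<^sub>R ?a"] by simp
          moreover have "norm (X n *\<^sub>R ?a) \<le> 1" using X[of n] by (simp add: norm_axis_1)
          ultimately show ?thesis using False by simp
        qed
        ultimately show ?thesis using False s by simp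
      qed
    qed
  qed measurable
  moreover have "(\<lambda>n. \<integral>x. ?s n x \<partial>lborel) = (\<lambda>_. 0)"
  proof
    fix n
    have "(\<integral>x. ?s n x \<partial>lborel) = ((\<integral>x. F (X n *\<^sub>R ?a + x) \<partial>lborel) - (\<integral>x. F x \<partial>lborel)) / X n"
      using iF iFt by simp
    then show "(\<integral>x. ?s n x \<partial>lborel) = 0" by (simp add: integral_lborel_translate)
  qed
  ultimately have "(\<lambda>n. 0) \<longlonglongrightarrow> (\<integral>x. partial i F x \<partial>lborel)" by (simp only:)
  then show ?thesis by (simp add: LIMSEQ_const_iff)
qed

text \<open>By the product rule this is the vanishing of the integral of the partial derivative of
  the product, whose support is bounded through \<open>v\<close>.\<close>

lemma integral_by_parts_partial:
  fixes u v :: "real^'n::finite \<Rightarrow> real"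
  assumes u: "smooth u" and v: "smooth v" and s: "\<And>x. r < norm x \<Longrightarrow> v x = 0"
  shows "(\<integral>x. u x * partial i v x \<partial>lborel) = - (\<integral>x. partial i u x * v x \<partial>lborel)"
proof -
  let ?F = "\<lambda>x. u x * v x"
  have p: "partial i ?F x = u x * partial i v x + partial i u x * v x" for x
    using partial_eqI[OF has_derivative_mult[OF smooth_has_derivative[OF u] smooth_has_derivative[OF v]], of i x]
      partial_eqI[OF smooth_has_derivative[OF u], of i x] partial_eqI[OF smooth_has_derivative[OF v], of i x]
    by simp
  have c: "continuous_on UNIV u" "continuous_on UNIV v" "continuous_on UNIV (partial i u)" "continuous_on UNIV (partial i v)"
    using u v smooth_partial smooth_continuous by blast+
  have ps: "r < norm x \<Longrightarrow> partial i v x = 0" for x by (rule partial_support[where r = r]) (use s in auto)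
  have "(\<integral>x. partial i ?F x \<partial>lborel) = 0"
  proof (rule integral_partial_zero)
    show "?F differentiable at x" for x using u v smooth_differentiable by (intro differentiable_mult) auto
    show "continuous_on UNIV (partial i ?F)" unfolding p[abs_def] using c by (intro continuous_intros)
    show "r < norm x \<Longrightarrow> ?F x = 0" for x using s by simp
  qed
  moreover have "(\<integral>x. partial i ?F x \<partial>lborel) = (\<integral>x. u x * partial i v x \<partial>lborel) + (\<integral>x. partial i u x * v x \<partial>lborel)"
    unfolding p
    by (intro Bochner_Integration.integral_add integrable_continuous_support[where r = r] continuous_intros c)
      (use s ps in auto)
  ultimately show ?thesis by simp
qed

text \<open>Each step takes the outermost derivative off \<open>v\<close> and makes it the innermost
  on \<open>u\<close>, which reverses the list. The order is recorded because no symmetry of mixed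
  derivatives is invoked for general smooth functions.\<close>

lemma integral_by_parts_pderivs:
  fixes u v :: "real^'n::finite \<Rightarrow> real"
  assumes u: "smooth u" and v: "smooth v" and s: "\<And>x. r < norm x \<Longrightarrow> v x = 0"
  shows "(\<integral>x. u x * pderivs is v x \<partial>lborel) = (-1) ^ length is * (\<integral>x. pderivs (rev is) u x * v x \<partial>lborel)"
  using u
proof (induction "is" arbitrary: u)
  case (Cons i js)
  have "(\<integral>x. u x * pderivs (i # js) v x \<partial>lborel) = - (\<integral>x. partial i u x * pderivs js v x \<partial>lborel)"
    using integral_by_parts_partial[OF Cons.prems smooth_pderivs[OF v] pderivs_support[OF s]] by simp
  also have "\<dots> = - ((-1) ^ length js * (\<integral>x. pderivs (rev js) (partial i u) x * v x \<partial>lborel))"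
    using Cons.IH[OF smooth_partial[OF Cons.prems]] by simp
  also have "\<dots> = (-1) ^ length (i # js) * (\<integral>x. pderivs (rev (i # js)) u x * v x \<partial>lborel)"
    by (simp add: pderivs_append)
  finally show ?case .
qed simp

lemma loc_int_continuous:
  fixes u :: "real^'n::finite \<Rightarrow> real"
  assumes "continuous_on UNIV u" shows "loc_int u"
  unfolding loc_int_def set_integrable_def
proof (intro conjI allI impI)
  show "u \<in> borel_measurable lborel" using borel_measurable_continuous_onI[OF assms] by simp
  fix K :: "(real^'n) set" assume K: "compact K"
  show "integrable lborel (\<lambda>x. indicator K x *\<^sub>R u x)"
    by (rule borel_integrable_compact[OF K]) (use assms continuous_on_subset in auto)
qed

lemma weak_deriv_smooth_conv:
  assumes f: "locint M f" and hs: "csms hs"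
  shows "weak_deriv a (conv M f (tens hs)) (conv M f (tens (dv a hs)))"
  unfolding weak_deriv_def
proof (intro conjI allI impI)
  show "loc_int (conv M f (tens hs))" "loc_int (conv M f (tens (dv a hs)))"
    by (intro loc_int_continuous smooth_continuous smooth_conv f hs csms_dv)+
  fix \<phi> :: "real^'a \<Rightarrow> real" assume \<phi>: "test_fun \<phi>"
  obtain r where r: "\<And>x. r < norm x \<Longrightarrow> \<phi> x = 0" using test_fun_support[OF \<phi>] by blast
  have s: "smooth \<phi>" using \<phi> test_fun_def by blast
  \<comment> \<open>The reversal is harmless here, since a derivative of a convolution with a tensor
    product depends only on the multiplicities of the directions.\<close>
  have rv: "dvl (rev (mi_list a)) hs = dv a hs"
    by (simp add: dvl_def mi_list_count)
  have "(\<integral>x. conv M f (tens hs) x * Dm a \<phi> x \<partial>lborel)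
     = (-1) ^ mi_abs a * (\<integral>x. pderivs (rev (mi_list a)) (conv M f (tens hs)) x * \<phi> x \<partial>lborel)"
    unfolding Dm_def by (subst integral_by_parts_pderivs[OF smooth_conv[OF f hs] s r]) (auto simp: length_mi_list)
  then show "(\<integral>x. conv M f (tens hs) x * Dm a \<phi> x \<partial>lborel)
     = (-1) ^ mi_abs a * (\<integral>x. conv M f (tens (dv a hs)) x * \<phi> x \<partial>lborel)"
    by (simp add: pderivs_conv[OF f hs] rv)
qed

text \<open>The function taking y to h(x - y) is a tensor product again. This makes the kernel of a
  convolution an admissible test function, and for x = 0 it is the adjoint kernel in
  \<open>conv_fubini\<close>.\<close>

definition rf :: "real^'n::finite \<Rightarrow> ('n \<Rightarrow> real \<Rightarrow> real) \<Rightarrow> 'n \<Rightarrow> real \<Rightarrow> real" where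
  "rf x hs i t = hs i (x $ i - t)"

lemma csms_rf: "csms hs \<Longrightarrow> csms (rf x hs)"
  unfolding rf_def[abs_def] by (auto intro: csm_reflect)

lemma tens_rf: "tens (rf x hs) y = tens hs (x - y)"
  by (simp add: tens_def rf_def)

lemma derivs_reflect:
  assumes "csm h" shows "(deriv ^^ n) (\<lambda>t. h (c - t)) = (\<lambda>t. (-1) ^ n * (deriv ^^ n) h (c - t))"
proof (induction n)
  case (Suc n)
  have "deriv (\<lambda>t. (-1) ^ n * (deriv ^^ n) h (c - t)) = (\<lambda>t. (-1) ^ Suc n * (deriv ^^ Suc n) h (c - t))"
    by (rule ext, rule DERIV_imp_deriv)
      (auto intro!: derivative_eq_intros DERIV_chain2[OF csm_has_deriv[OF csm_derivs[OF assms]]])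
  then show ?case using Suc by simp
qed simp

lemma tens_dv_rf:
  assumes "csms hs" shows "tens (dv a (rf x hs)) y = (-1) ^ mi_abs a * tens (dv a hs) (x - y)"
  using assms by (simp add: tens_def dv_def rf_def[abs_def] derivs_reflect prod.distrib mi_abs_def power_sum)

text \<open>Testing the weak derivative against the reflected kernel produces the sign (-1)^|a|
  twice, once from its definition and once from the reflection, and the two cancel.\<close>

lemma conv_weak_deriv:
  assumes w: "weak_deriv a f g" and hs: "csms hs"
  shows "conv lborel f (tens (dv a hs)) = conv lborel g (tens hs)"
proof
  fix x
  have "(\<integral>y. f y * Dm a (tens (rf x hs)) y \<partial>lborel) = (-1) ^ mi_abs a * (\<integral>y. g y * tens (rf x hs) y \<partial>lborel)"
    using w test_fun_tens[OF csms_rf[OF hs]] unfolding weak_deriv_def by blast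
  moreover have "(\<integral>y. f y * Dm a (tens (rf x hs)) y \<partial>lborel) = (-1) ^ mi_abs a * conv lborel f (tens (dv a hs)) x"
    by (simp add: Dm_tens[OF csms_rf[OF hs]] tens_dv_rf[OF hs] conv_def mult.left_commute[of _ "(-1) ^ _"])
  ultimately show "conv lborel f (tens (dv a hs)) x = conv lborel g (tens hs) x"
    by (simp add: tens_rf conv_def)
qed

section \<open>Separation of measures by tensor products\<close>

text \<open>As \<open>expinv (c * t) = expinv t powr (1 / c)\<close> for \<open>t > 0\<close>, these kernels increase to the indicator of
  the open box.\<close>

definition boxt :: "nat \<Rightarrow> real^'n::finite \<Rightarrow> real^'n \<Rightarrow> 'n \<Rightarrow> real \<Rightarrow> real" where
  "boxt n a b i t = expinv (real (Suc n) * (t - a $ i)) * expinv (real (Suc n) * (b $ i - t))"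

lemma csms_boxt: "csms (boxt n a b)"
  unfolding boxt_def[abs_def] by (intro allI csm_bump) simp

lemma expinv_bounds: "0 \<le> expinv t" "expinv t \<le> 1"
  by (auto simp: expinv_def)

lemma expinv_scale_tendsto: "t > 0 \<Longrightarrow> (\<lambda>n. expinv (real (Suc n) * t)) \<longlonglongrightarrow> 1"
proof -
  assume t: "t > 0"
  have "(\<lambda>n. exp (- (1 / t * inverse (real (Suc n))))) \<longlonglongrightarrow> exp (- (1 / t * 0))"
    by (intro tendsto_intros LIMSEQ_inverse_real_of_nat)
  moreover have "expinv (real (Suc n) * t) = exp (- (1 / t * inverse (real (Suc n))))" for n
    using mult_pos_pos[of t "real (Suc n)"] t by (simp add: expinv_def divide_inverse mult.commute not_le del: of_nat_Suc)
  ultimately show ?thesis by simp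
qed

lemma boxt_bounds: "\<bar>tens (boxt n a b) x\<bar> \<le> indicator (box a b) x"
proof (cases "x \<in> box a b")
  case True
  have "\<bar>tens (boxt n a b) x\<bar> = (\<Prod>i\<in>UNIV. \<bar>boxt n a b i (x $ i)\<bar>)"
    by (simp add: tens_def abs_prod)
  also have "\<dots> \<le> 1"
    by (intro prod_le_1) (auto simp: boxt_def abs_mult expinv_bounds intro!: mult_le_one)
  finally show ?thesis using True by simp
next
  case False
  then obtain i where "x $ i \<le> a $ i \<or> b $ i \<le> x $ i" by (auto simp: mem_box_cart not_less)
  then have "boxt n a b i (x $ i) = 0" by (auto simp: boxt_def expinv_def mult_nonneg_nonpos mult_le_0_iff)
  then have "tens (boxt n a b) x = 0" unfolding tens_def by (auto intro: prod_zero)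
  then show ?thesis by simp
qed

lemma boxt_tendsto: "(\<lambda>n. tens (boxt n a b) x) \<longlonglongrightarrow> indicator (box a b) x"
proof (cases "x \<in> box a b")
  case True
  have "(\<lambda>n. \<Prod>i\<in>UNIV. boxt n a b i (x $ i)) \<longlonglongrightarrow> (\<Prod>i\<in>(UNIV::'a set). 1 * 1)"
    unfolding boxt_def by (intro tendsto_prod tendsto_mult expinv_scale_tendsto)
      (use True in \<open>auto simp: mem_box_cart\<close>)
  then show ?thesis using True by (simp add: tens_def)
next
  case False
  then show ?thesis using boxt_bounds[of _ a b x] by simp
qed

text \<open>An identity of signed measures is written with all negative parts moved across, so that
  only finite positive measures occur. Boxes are stable under intersection and generate the Borel
  sets; the whole space is no box, and its mass enters the step for complements.\<close>

lemma finite_measures_box_eq: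
  fixes N1 N2 N3 N4 :: "(real^'n::finite) measure"
  assumes f: "finite_measure N1" "finite_measure N2" "finite_measure N3" "finite_measure N4"
    and s[simp]: "sets N1 = sets borel" "sets N2 = sets borel" "sets N3 = sets borel" "sets N4 = sets borel"
    and b: "\<And>a b. measure N1 (box a b) + measure N2 (box a b) = measure N3 (box a b) + measure N4 (box a b)"
    and u: "measure N1 UNIV + measure N2 UNIV = measure N3 UNIV + measure N4 UNIV"
    and A: "A \<in> sets borel"
  shows "measure N1 A + measure N2 A = measure N3 A + measure N4 A"
proof -
  let ?E = "range (\<lambda>(a, b). box a b :: (real^'n) set)"
  have sE: "sets (borel :: (real^'n) measure) = sigma_sets UNIV ?E" by (simp add: borel_eq_box)
  have E: "Int_stable ?E" "?E \<subseteq> Pow UNIV" "A \<in> sigma_sets UNIV ?E"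
    using A by (auto simp: Int_stable_def box_Int_box sE)
  have sp: "space N1 = UNIV" "space N2 = UNIV" "space N3 = UNIV" "space N4 = UNIV"
    using s[THEN sets_eq_imp_space_eq] by simp_all
  from E show ?thesis
  proof (induction rule: sigma_sets_induct_disjoint)
    case (compl A)
    then have "A \<in> sets borel" using sE by simp
    then show ?case
      using compl.IH u f[THEN finite_measure.finite_measure_compl, of A] by (simp add: sp)
  next
    case (union A)
    have "range A \<subseteq> sets borel" using union sE by simp
    then have "(\<lambda>i. measure N1 (A i) + measure N2 (A i)) sums (measure N1 (\<Union>i. A i) + measure N2 (\<Union>i. A i))"
      "(\<lambda>i. measure N3 (A i) + measure N4 (A i)) sums (measure N3 (\<Union>i. A i) + measure N4 (\<Union>i. A i))"
      using union.hyps(1) by (intro sums_add finite_measure.finite_measure_UNION f; simp)+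
    then show ?case using union.IH sums_unique2 by simp
  qed (use b in auto)
qed


lemma finite_measure_density_integrable:
  assumes "integrable M f" shows "finite_measure (density M (\<lambda>x. ennreal (f x)))"
proof (rule finite_measureI)
  have "f \<in> borel_measurable M" using assms by simp
  then have "emeasure (density M (\<lambda>x. ennreal (f x))) (space M) = (\<integral>\<^sup>+x. ennreal (f x) \<partial>M)"
    by (subst emeasure_density) (auto intro!: nn_integral_cong)
  also have "\<dots> \<le> (\<integral>\<^sup>+x. ennreal (norm (f x)) \<partial>M)" by (intro nn_integral_mono) (auto intro: ennreal_leI)
  also have "\<dots> < \<infinity>" using assms integrable_iff_bounded by blast
  finally show "emeasure (density M (\<lambda>x. ennreal (f x))) (space (density M (\<lambda>x. ennreal (f x)))) \<noteq> \<infinity>" by simp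
qed

lemma measure_density_set_integral:
  fixes f :: "real^'n::finite \<Rightarrow> real"
  assumes f: "integrable lborel f" and A[measurable]: "A \<in> sets borel"
  shows "measure (density lborel (\<lambda>x. ennreal (f x))) A - measure (density lborel (\<lambda>x. ennreal (- f x))) A
    = set_lebesgue_integral lborel A f"
proof -
  have [measurable]: "f \<in> borel_measurable borel" using f by (simp add: borel_measurable_integrable)
  have i: "integrable lborel (\<lambda>x. indicator A x * f x)"
    using integrable_mult_indicator[of A lborel f] f A by simp
  have e: "emeasure (density lborel (\<lambda>x. ennreal (c * f x))) A = (\<integral>\<^sup>+x. ennreal (c * (indicator A x * f x)) \<partial>lborel)" for c
    by (subst emeasure_density) (auto intro!: nn_integral_cong simp: indicator_def)
  show ?thesis
    using real_lebesgue_integral_def[OF i] e[of 1] e[of "-1"]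
    by (simp add: measure_def set_lebesgue_integral_def)
qed

lemma null_space_UNIV: "sets M = sets (borel :: (real^'n::finite) measure) \<Longrightarrow> space M = UNIV"
  using sets_eq_imp_space_eq[of M borel] by simp

text \<open>As \<open>p\<close> is only locally integrable, its positive and negative parts give
  finite measures only after restriction to a box. The values on boxes are reached as limits along
  the kernels \<open>boxt\<close>.\<close>

lemma tens_separation_local:
  fixes M1 M2 :: "(real^'n::finite) measure"
  assumes f: "finite_measure M1" "finite_measure M2"
    and s: "sets M1 = sets borel" "sets M2 = sets borel"
    and p: "loc_int p"
    and t: "\<And>hs. csms hs \<Longrightarrow> (\<integral>x. tens hs x \<partial>M1) - (\<integral>x. tens hs x \<partial>M2) = (\<integral>x. p x * tens hs x \<partial>lborel)"
    and A: "A \<in> sets borel"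
  shows "measure M1 (A \<inter> box l u) - measure M2 (A \<inter> box l u) = set_lebesgue_integral lborel (A \<inter> box l u) p"
proof -
  have [measurable]: "p \<in> borel_measurable borel" using p loc_int_def by auto
  note [measurable_cong] = s
  have box_int: "integrable lborel (\<lambda>x. indicator (box a b) x * p x)" for a b :: "real^'n"
  proof -
    have "set_integrable lborel (box a b) p"
      by (rule set_integrable_subset[of _ "cbox a b"]) (use p box_subset_cbox in \<open>auto simp: loc_int_def\<close>)
    then show ?thesis by (simp add: set_integrable_def)
  qed
  have boxM: "(\<lambda>n. \<integral>x. tens (boxt n a b) x \<partial>M) \<longlonglongrightarrow> measure M (box a b)"
    if "finite_measure M" and [measurable_cong]: "sets M = sets borel" for M :: "(real^'n) measure" and a b
  proof -
    interpret finite_measure M by fact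
    have "(\<lambda>n. \<integral>x. tens (boxt n a b) x \<partial>M) \<longlonglongrightarrow> (\<integral>x. indicator (box a b) x \<partial>M)"
    proof (rule integral_dominated_convergence[where w = "indicator (box a b)"])
      show "tens (boxt n a b) \<in> borel_measurable M" for n using tens_measurable[OF csms_boxt] by measurable
      show "indicator (box a b) \<in> borel_measurable M" by measurable
      show "integrable M (indicator (box a b) :: _ \<Rightarrow> real)"
        by (rule integrable_real_indicator) (simp_all add: that less_top[symmetric])
    qed (auto intro!: always_eventually boxt_bounds boxt_tendsto)
    then show ?thesis using null_space_UNIV[OF that(2)] by simp
  qed
  have base: "measure M1 (box a b) - measure M2 (box a b) = set_lebesgue_integral lborel (box a b) p" for a b
  proof -
    have "(\<lambda>n. \<integral>x. p x * tens (boxt n a b) x \<partial>lborel) \<longlonglongrightarrow> (\<integral>x. p x * indicator (box a b) x \<partial>lborel)"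
    proof (rule integral_dominated_convergence[where w = "\<lambda>x. \<bar>indicator (box a b) x * p x\<bar>"])
      show "(\<lambda>x. p x * tens (boxt n a b) x) \<in> borel_measurable lborel" for n
        using tens_measurable[OF csms_boxt] by measurable
      show "AE x in lborel. (\<lambda>n. p x * tens (boxt n a b) x) \<longlonglongrightarrow> p x * indicator (box a b) x"
        by (intro always_eventually allI tendsto_mult tendsto_const boxt_tendsto)
      show "AE x in lborel. norm (p x * tens (boxt n a b) x) \<le> \<bar>indicator (box a b) x * p x\<bar>" for n
        using mult_left_mono[OF boxt_bounds, of "\<bar>p x\<bar>" n a b x for x]
        by (intro always_eventually allI) (simp add: abs_mult mult.commute)
    qed (use box_int in auto)
    moreover have "(\<lambda>n. \<integral>x. p x * tens (boxt n a b) x \<partial>lborel) \<longlonglongrightarrow> measure M1 (box a b) - measure M2 (box a b)"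
      unfolding t[OF csms_boxt, symmetric] by (intro tendsto_diff boxM f s)
    ultimately show ?thesis using LIMSEQ_unique by (auto simp: set_lebesgue_integral_def mult.commute)
  qed
  let ?B = "box l u"
  let ?h = "\<lambda>x. indicator ?B x * p x"
  let ?R = "\<lambda>M. density M (indicator ?B :: _ \<Rightarrow> ennreal)"
  have R: "finite_measure (?R M)" "\<And>X. X \<in> sets borel \<Longrightarrow> measure (?R M) X = measure M (X \<inter> ?B)"
    if "finite_measure M" and [measurable_cong]: "sets M = sets borel" for M :: "(real^'n) measure"
  proof -
    have e: "emeasure (?R M) X = emeasure M (X \<inter> ?B)" if "X \<in> sets borel" for X
      using that \<open>sets M = _\<close> by (subst emeasure_density) (auto simp: indicator_inter_arith[symmetric] Int_commute)
    then show "\<And>X. X \<in> sets borel \<Longrightarrow> measure (?R M) X = measure M (X \<inter> ?B)" by (simp add: measure_def)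
    show "finite_measure (?R M)"
      by (rule finite_measureI)
        (use e[of UNIV] null_space_UNIV[OF that(2)] finite_measure.emeasure_finite[OF that(1)] in auto)
  qed
  let ?P = "density lborel (\<lambda>x. ennreal (?h x))" and ?Q = "density lborel (\<lambda>x. ennreal (- ?h x))"
  have PQ: "measure ?P X - measure ?Q X = set_lebesgue_integral lborel (X \<inter> ?B) p" if "X \<in> sets borel" for X
    using measure_density_set_integral[OF box_int that]
    by (simp add: set_lebesgue_integral_def indicator_inter_arith mult.assoc)
  \<comment> \<open>This is the identity M1 - M2 = p dx inside the box, rearranged for
    \<open>finite_measures_box_eq\<close>.\<close>
  have "measure (?R M1) A + measure ?Q A = measure (?R M2) A + measure ?P A"
  proof (rule finite_measures_box_eq[OF R(1)[OF f(1) s(1)] _ R(1)[OF f(2) s(2)] _ _ _ _ _ _ _ A])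
    show "finite_measure ?Q" using finite_measure_density_integrable[of lborel "\<lambda>x. - ?h x"] box_int by simp
    show "finite_measure ?P" using finite_measure_density_integrable box_int by blast
    show "measure (?R M1) (box a b) + measure ?Q (box a b) = measure (?R M2) (box a b) + measure ?P (box a b)" for a b
    proof -
      obtain a' b' where "box a b \<inter> ?B = box a' b'" by (rule that[OF box_Int_box])
      then show ?thesis
        using PQ[of "box a b"] R(2)[OF f(1) s(1), of "box a b"] R(2)[OF f(2) s(2), of "box a b"] base[of a' b']
        by simp
    qed
    show "measure (?R M1) UNIV + measure ?Q UNIV = measure (?R M2) UNIV + measure ?P UNIV"
      using PQ[of UNIV] R(2)[OF f(1) s(1), of UNIV] R(2)[OF f(2) s(2), of UNIV] base[of l u]
      by simp
  qed (use s in auto)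
  then show ?thesis using PQ[OF A] R(2)[OF f(1) s(1) A] R(2)[OF f(2) s(2) A] by simp
qed

text \<open>Integrability of \<open>p\<close> comes out of the argument: on the set where
  \<open>p\<close> has a given sign, the integral of its modulus over each box is at most the total
  mass of both measures. Growing boxes then exhaust the space in the local identity.\<close>

lemma tens_separation:
  fixes M1 M2 :: "(real^'n::finite) measure"
  assumes f: "finite_measure M1" "finite_measure M2"
    and s: "sets M1 = sets borel" "sets M2 = sets borel"
    and p: "loc_int p"
    and t: "\<And>hs. csms hs \<Longrightarrow> (\<integral>x. tens hs x \<partial>M1) - (\<integral>x. tens hs x \<partial>M2) = (\<integral>x. p x * tens hs x \<partial>lborel)"
  shows "is_density (M1, M2) p"
proof -
  have [measurable]: "p \<in> borel_measurable borel" using p loc_int_def by auto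
  define B where "B n = box (- (real n *\<^sub>R One)) (real n *\<^sub>R One :: real^'n)" for n :: nat
  have UB: "(\<Union>n. B n) = UNIV" unfolding B_def by (rule UN_box_eq_UNIV)
  have iB: "incseq B" unfolding B_def incseq_def
    by (intro allI impI subset_box_imp ballI) auto
  have mB[measurable]: "B n \<in> sets borel" for n unfolding B_def by simp
  have loc: "measure M1 (A \<inter> B n) - measure M2 (A \<inter> B n) = set_lebesgue_integral lborel (A \<inter> B n) p"
    if "A \<in> sets borel" for A n
    unfolding B_def by (rule tens_separation_local[OF f s p t that])
  have intB: "integrable lborel (\<lambda>x. indicator (B n) x * p x)" for n
  proof -
    have "set_integrable lborel (B n) p" unfolding B_def
      by (rule set_integrable_subset[of _ "cbox (- (real n *\<^sub>R One)) (real n *\<^sub>R One)"])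
        (use p box_subset_cbox in \<open>auto simp: loc_int_def\<close>)
    then show ?thesis by (simp add: set_integrable_def)
  qed
  \<comment> \<open>The values c = 1 and c = -1 treat the positive and the negative part of
    \<open>p\<close> together.\<close>
  have fin: "(\<integral>\<^sup>+x. ennreal (c * p x) \<partial>lborel) < \<infinity>" if c: "c = 1 \<or> c = -1" for c
  proof -
    let ?A = "{x. 0 < c * p x}"
    let ?T = "measure M1 UNIV + measure M2 UNIV"
    have A: "?A \<in> sets borel" by measurable
    have bound: "(\<integral>\<^sup>+x. ennreal (c * p x) * indicator (B n) x \<partial>lborel) \<le> ennreal ?T" for n
    proof -
      have i: "integrable lborel (\<lambda>x. indicator (?A \<inter> B n) x * (c * p x))"
      proof -
        have "integrable lborel (\<lambda>x. c * (indicator ?A x *\<^sub>R (indicator (B n) x * p x)))"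
          by (intro integrable_mult_right integrable_mult_indicator intB) (use A in auto)
        then show ?thesis by (simp add: indicator_inter_arith mult_ac)
      qed
      have "(\<integral>\<^sup>+x. ennreal (c * p x) * indicator (B n) x \<partial>lborel) = (\<integral>\<^sup>+x. ennreal (indicator (?A \<inter> B n) x * (c * p x)) \<partial>lborel)"
        by (intro nn_integral_cong) (auto simp: indicator_def not_less ennreal_neg)
      also have "\<dots> = ennreal (\<integral>x. indicator (?A \<inter> B n) x * (c * p x) \<partial>lborel)"
        by (intro nn_integral_eq_integral i) (auto simp: indicator_def)
      also have "(\<integral>x. indicator (?A \<inter> B n) x * (c * p x) \<partial>lborel) = c * (measure M1 (?A \<inter> B n) - measure M2 (?A \<inter> B n))"
        unfolding loc[OF A] set_lebesgue_integral_def by (simp add: mult.left_commute)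
      also have "\<dots> \<le> measure M1 (?A \<inter> B n) + measure M2 (?A \<inter> B n)"
        using c measure_nonneg[of M1 "?A \<inter> B n"] measure_nonneg[of M2 "?A \<inter> B n"] by auto
      also have "\<dots> \<le> ?T"
        using finite_measure.finite_measure_mono[OF f(1), of _ UNIV] finite_measure.finite_measure_mono[OF f(2), of _ UNIV] s
        by (intro add_mono) auto
      finally show ?thesis by (simp add: ennreal_leI)
    qed
    have "(\<integral>\<^sup>+x. ennreal (c * p x) \<partial>lborel) = (\<integral>\<^sup>+x. (SUP n. ennreal (c * p x) * indicator (B n) x) \<partial>lborel)"
    proof (intro nn_integral_cong)
      fix x
      obtain n where "x \<in> B n" using UB by blast
      then have "ennreal (c * p x) \<le> (SUP n. ennreal (c * p x) * indicator (B n) x)"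
        by (intro SUP_upper2[of n]) auto
      moreover have "(SUP n. ennreal (c * p x) * indicator (B n) x) \<le> ennreal (c * p x)"
        by (intro SUP_least) (auto simp: indicator_def)
      ultimately show "ennreal (c * p x) = (SUP n. ennreal (c * p x) * indicator (B n) x)" by (rule antisym)
    qed
    also have "\<dots> = (SUP n. \<integral>\<^sup>+x. ennreal (c * p x) * indicator (B n) x \<partial>lborel)"
      by (intro nn_integral_monotone_convergence_SUP)
        (use iB in \<open>auto simp: incseq_def le_fun_def indicator_def\<close>)
    also have "\<dots> \<le> ennreal ?T" by (intro SUP_least bound)
    finally show ?thesis by (simp add: order_le_less_trans)
  qed
  have ip: "integrable lborel p"
    using fin[of 1] fin[of "-1"] by (intro real_integrable_def[THEN iffD2]) auto
  have "measure M1 A - measure M2 A = set_lebesgue_integral lborel A p" if A[measurable]: "A \<in> sets borel" for A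
  proof -
    have "(\<lambda>n. measure M (A \<inter> B n)) \<longlonglongrightarrow> measure M A" if M: "finite_measure M" "sets M = sets borel" for M :: "(real^'n) measure"
    proof -
      have "(\<lambda>n. measure M (A \<inter> B n)) \<longlonglongrightarrow> measure M (\<Union>n. A \<inter> B n)"
        by (rule finite_measure.finite_Lim_measure_incseq[OF M(1)]) (use iB A M in \<open>auto simp: incseq_def\<close>)
      also have "(\<Union>n. A \<inter> B n) = A" using UB by blast
      finally show ?thesis .
    qed
    then have "(\<lambda>n. measure M1 (A \<inter> B n) - measure M2 (A \<inter> B n)) \<longlonglongrightarrow> measure M1 A - measure M2 A"
      using f s by (intro tendsto_diff) blast+
    moreover have "(\<lambda>n. set_lebesgue_integral lborel (A \<inter> B n) p) \<longlonglongrightarrow> set_lebesgue_integral lborel A p"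
      unfolding set_lebesgue_integral_def
    proof (rule integral_dominated_convergence[where w = "\<lambda>x. \<bar>p x\<bar>"])
      show "AE x in lborel. (\<lambda>n. indicator (A \<inter> B n) x *\<^sub>R p x) \<longlonglongrightarrow> indicator A x *\<^sub>R p x"
      proof (intro always_eventually allI)
        fix x
        obtain N where N: "x \<in> B N" using UB by blast
        have "eventually (\<lambda>n. indicator (A \<inter> B n) x *\<^sub>R p x = indicator A x *\<^sub>R p x) sequentially"
          using eventually_ge_at_top[of N]
          by eventually_elim (use N iB in \<open>auto simp: incseq_def indicator_def\<close>)
        then show "(\<lambda>n. indicator (A \<inter> B n) x *\<^sub>R p x) \<longlonglongrightarrow> indicator A x *\<^sub>R p x" by (rule tendsto_eventually)
      qed
    qed (use ip in \<open>auto simp: indicator_def\<close>)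
    ultimately show ?thesis unfolding loc[OF A] using LIMSEQ_unique by blast
  qed
  then show ?thesis using ip by (auto simp: is_density_def)
qed

section \<open>Uniqueness of densities and weak derivatives\<close>

lemma is_density_unique:
  assumes "is_density \<mu> p" "is_density \<mu> p'" shows "AE x in lborel. p x = p' x"
  using assms unfolding is_density_def by (intro density_unique_real) auto

lemma loc_int_diff: "loc_int f \<Longrightarrow> loc_int g \<Longrightarrow> loc_int (\<lambda>x. f x - g x)"
  unfolding loc_int_def by auto

text \<open>The difference of two weak derivatives integrates to zero against all tensor products,
  so it is a density of the zero measure, as is the zero function.\<close>

lemma weak_deriv_unique:
  fixes g :: "real^'n::finite \<Rightarrow> real"
  assumes g: "weak_deriv a f g" and h: "weak_deriv a f h"
  shows "AE x in lborel. g x = h x"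
proof -
  let ?N = "null_measure (borel :: (real^'n) measure)"
  have N: "finite_measure ?N" by (rule finite_measureI) simp
  have l: "loc_int g" "loc_int h" using assms weak_deriv_def by blast+
  have "is_density (?N, ?N) (\<lambda>x. g x - h x)"
  proof (rule tens_separation[OF N N _ _ loc_int_diff[OF l]])
    fix hs :: "'n \<Rightarrow> real \<Rightarrow> real" assume hs: "csms hs"
    have "(-1) ^ mi_abs a * (\<integral>x. g x * tens hs x \<partial>lborel) = (-1) ^ mi_abs a * (\<integral>x. h x * tens hs x \<partial>lborel)"
      using assms test_fun_tens[OF hs] unfolding weak_deriv_def by metis
    then have eq: "(\<integral>x. g x * tens hs x \<partial>lborel) = (\<integral>x. h x * tens hs x \<partial>lborel)" by simp
    obtain B where B: "\<And>x. \<bar>tens hs x\<bar> \<le> B" using tens_bounded[OF hs] by blast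
    obtain r where r: "\<And>x. r < norm x \<Longrightarrow> tens hs x = 0" using tens_support[OF hs] by blast
    have i: "integrable lborel (\<lambda>x. k x * tens hs x)" if "loc_int k" for k
      by (rule locint_integrable_mult[OF locint_loc_int[OF that] tens_measurable[OF hs] r B])
    show "(\<integral>x. tens hs x \<partial>?N) - (\<integral>x. tens hs x \<partial>?N) = (\<integral>x. (g x - h x) * tens hs x \<partial>lborel)"
      using i[OF l(1)] i[OF l(2)] eq by (simp add: left_diff_distrib)
  qed auto
  moreover have "is_density (?N, ?N) (\<lambda>x. 0)" by (auto simp: is_density_def set_lebesgue_integral_def)
  ultimately have "AE x in lborel. g x - h x = 0" by (rule is_density_unique)
  then show ?thesis by eventually_elim simp
qed

lemma weak_deriv_wd: "weak_deriv a f g \<Longrightarrow> weak_deriv a f (wd a f)"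
  unfolding wd_def by (rule someI[of "weak_deriv a f"])

lemma wd_AE: "weak_deriv a f g \<Longrightarrow> AE x in lborel. wd a f x = g x"
  by (rule weak_deriv_unique[OF weak_deriv_wd])

lemma loc_int_AE:
  fixes f g :: "real^'n::finite \<Rightarrow> real"
  assumes f: "loc_int f" and g: "g \<in> borel_measurable borel" and e: "AE x in lborel. f x = g x"
  shows "loc_int g"
  unfolding loc_int_def set_integrable_def
proof (intro conjI allI impI)
  have fm: "f \<in> borel_measurable borel" using f loc_int_def by auto
  show "g \<in> borel_measurable lborel" using g by simp
  fix K :: "(real^'n) set" assume K: "compact K"
  have [measurable]: "K \<in> sets borel" using K borel_compact by blast
  have "integrable lborel (\<lambda>x. indicator K x *\<^sub>R f x)" using f K by (auto simp: loc_int_def set_integrable_def)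
  then show "integrable lborel (\<lambda>x. indicator K x *\<^sub>R g x)"
    by (subst integrable_cong_AE[of _ _ "\<lambda>x. indicator K x *\<^sub>R f x"]) (use fm g e in auto)
qed

text \<open>The density chosen by \<open>pdens\<close> is determined only up to null sets, so weak
  differentiability has to pass to other versions of a function.\<close>

lemma weak_deriv_AE:
  assumes w: "weak_deriv a f g" and f': "f' \<in> borel_measurable borel" and e: "AE x in lborel. f x = f' x"
  shows "weak_deriv a f' g"
proof -
  have l: "loc_int f" "loc_int g" using w weak_deriv_def by blast+
  have l': "loc_int f'" by (rule loc_int_AE[OF l(1) f' e])
  have [measurable]: "f \<in> borel_measurable borel" "f' \<in> borel_measurable borel" using l l' loc_int_def by auto
  have "(\<integral>x. f' x * Dm a \<phi> x \<partial>lborel) = (\<integral>x. f x * Dm a \<phi> x \<partial>lborel)" if "test_fun \<phi>" for \<phi>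
  proof (rule integral_cong_AE)
    have "smooth (Dm a \<phi>)" using that smooth_pderivs unfolding Dm_def test_fun_def by blast
    note smooth_measurable[OF this, measurable]
    show "(\<lambda>x. f' x * Dm a \<phi> x) \<in> borel_measurable lborel" "(\<lambda>x. f x * Dm a \<phi> x) \<in> borel_measurable lborel" by auto
    show "AE x in lborel. f' x * Dm a \<phi> x = f x * Dm a \<phi> x" using e by eventually_elim simp
  qed
  then show ?thesis using w l l' unfolding weak_deriv_def by simp
qed

text \<open>The signed identity M1 - M2 = p dx is stated with nonnegative terms on both sides, which
  opens it to induction over nonnegative measurable functions and keeps it meaningful when integrals
  are infinite.\<close>

lemma sint_density_nn:
  fixes M1 M2 :: "(real^'n::finite) measure"
  assumes m: "(M1, M2) \<in> fsm" and d: "is_density (M1, M2) p" and u: "u \<in> borel_measurable borel"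
  shows "(\<integral>\<^sup>+x. u x \<partial>M1) + (\<integral>\<^sup>+x. u x \<partial>density lborel (\<lambda>x. ennreal (- p x)))
       = (\<integral>\<^sup>+x. u x \<partial>M2) + (\<integral>\<^sup>+x. u x \<partial>density lborel (\<lambda>x. ennreal (p x)))"
proof -
  let ?P = "density lborel (\<lambda>x. ennreal (p x))" and ?Q = "density lborel (\<lambda>x. ennreal (- p x))"
  have ip: "integrable lborel p" using d is_density_def by blast
  then have fin: "finite_measure ?P" "finite_measure ?Q"
    using finite_measure_density_integrable[of lborel p] finite_measure_density_integrable[of lborel "\<lambda>x. - p x"] by auto
  have fM: "finite_measure M1" "finite_measure M2" and s[simp]: "sets M1 = sets borel" "sets M2 = sets borel"
    using m by (auto simp: fsm_def)
  note [measurable_cong] = s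
  have eq: "emeasure M1 A + emeasure ?Q A = emeasure M2 A + emeasure ?P A" if "A \<in> sets borel" for A
  proof -
    have "measure M1 A + measure ?Q A = measure M2 A + measure ?P A"
    proof -
      have "measure M1 A - measure M2 A = set_lebesgue_integral lborel A p"
        using d that by (simp add: is_density_def)
      then show ?thesis using measure_density_set_integral[OF ip that] by linarith
    qed
    then show ?thesis
      using fM fin by (simp add: finite_measure.emeasure_eq_measure flip: ennreal_plus)
  qed
  from u show ?thesis
  proof (induction rule: borel_measurable_induct)
    case (cong f g) then show ?case by (simp add: fun_eq_iff)
  next
    case (set A) then show ?case using eq by simp
  next
    case (mult u c)
    then show ?case by (simp add: nn_integral_cmult distrib_left[symmetric])
  next
    case (add u v)
    let ?I = "\<lambda>M u. \<integral>\<^sup>+x. u x \<partial>M"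
    have "(?I M1 v + ?I M1 u) + (?I ?Q v + ?I ?Q u) = (?I M2 v + ?I M2 u) + (?I ?P v + ?I ?P u)"
      using add.IH by (metis (no_types, lifting) add.assoc add.left_commute)
    then show ?case using add.hyps by (simp add: nn_integral_add)
  next
    case (seq U)
    let ?I = "\<lambda>M u. \<integral>\<^sup>+x. u x \<partial>M"
    have sP: "sets ?P = sets borel" and sQ: "sets ?Q = sets borel" by simp_all
    have S: "?I M (SUP i. U i) = (SUP i. ?I M (U i))" "incseq (\<lambda>i. ?I M (U i))"
      if "sets M = sets borel" for M :: "(real^'n) measure"
    proof -
      have "?I M (SUP i. U i) = \<integral>\<^sup>+x. (SUP i. U i x) \<partial>M" by (simp add: image_comp)
      also have "\<dots> = (SUP i. ?I M (U i))"
        by (rule nn_integral_monotone_convergence_SUP[OF seq.hyps(3)]) (use seq.hyps that measurable_cong_sets in auto)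
      finally show "?I M (SUP i. U i) = (SUP i. ?I M (U i))" .
      show "incseq (\<lambda>i. ?I M (U i))" using seq.hyps(3) by (auto simp: incseq_def le_fun_def intro!: nn_integral_mono)
    qed
    have "?I M1 (SUP i. U i) + ?I ?Q (SUP i. U i) = (SUP i. ?I M1 (U i) + ?I ?Q (U i))"
      unfolding S(1)[OF s(1)] S(1)[OF sQ] by (rule ennreal_SUP_add[symmetric]) (intro S s sQ)+
    also have "\<dots> = (SUP i. ?I M2 (U i) + ?I ?P (U i))" using seq.IH by simp
    also have "\<dots> = ?I M2 (SUP i. U i) + ?I ?P (SUP i. U i)"
      unfolding S(1)[OF s(2)] S(1)[OF sP] by (rule ennreal_SUP_add) (intro S s sP)+
    finally show ?case .
  qed
qed

lemma finite_measure_integrable_bounded: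
  fixes u :: "real^'n::finite \<Rightarrow> real"
  assumes "finite_measure M" "sets M = sets borel" "u \<in> borel_measurable borel" "\<And>x. \<bar>u x\<bar> \<le> B"
  shows "integrable M u"
proof -
  interpret finite_measure M by fact
  show ?thesis
    by (rule integrable_const_bound[of _ B]) (use assms measurable_cong_sets in auto)
qed

lemma sint_density:
  fixes p u :: "real^'n::finite \<Rightarrow> real"
  assumes m: "\<mu> \<in> fsm" and d: "is_density \<mu> p"
    and um[measurable]: "u \<in> borel_measurable borel" and B: "\<And>x. \<bar>u x\<bar> \<le> B"
  shows "sint \<mu> u = (\<integral>x. p x * u x \<partial>lborel)"
proof -
  obtain M1 M2 where \<mu>: "\<mu> = (M1, M2)" by (cases \<mu>)
  let ?P = "density lborel (\<lambda>x. ennreal (p x))" and ?Q = "density lborel (\<lambda>x. ennreal (- p x))"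
  have ip: "integrable lborel p" using d is_density_def by blast
  then have [measurable]: "p \<in> borel_measurable borel" by (simp add: borel_measurable_integrable)
  have fin: "finite_measure ?P" "finite_measure ?Q"
    using finite_measure_density_integrable[of lborel p] finite_measure_density_integrable[of lborel "\<lambda>x. - p x"] ip by auto
  have fM: "finite_measure M1" "finite_measure M2" and s[simp]: "sets M1 = sets borel" "sets M2 = sets borel"
    using m \<mu> by (auto simp: fsm_def)
  have pos: "(\<integral>x. v x \<partial>M1) + (\<integral>x. v x \<partial>?Q) = (\<integral>x. v x \<partial>M2) + (\<integral>x. v x \<partial>?P)"
    if [measurable]: "v \<in> borel_measurable borel" and v: "\<And>x. 0 \<le> v x" "\<And>x. v x \<le> C" for v :: "real^'n \<Rightarrow> real" and C
  proof -
    have e: "(\<integral>\<^sup>+x. ennreal (v x) \<partial>M) = ennreal (\<integral>x. v x \<partial>M)" if "finite_measure M" "sets M = sets borel" for M :: "(real^'n) measure"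
      by (rule nn_integral_eq_integral)
        (use finite_measure_integrable_bounded[OF that, of v C] v in auto)
    have "(\<lambda>x. ennreal (v x)) \<in> borel_measurable borel" by measurable
    from sint_density_nn[OF m[unfolded \<mu>] d[unfolded \<mu>] this]
    show ?thesis unfolding e[OF fM(1) s(1)] e[OF fM(2) s(2)]
      by (subst (asm) (1 2) e) (use fin v in \<open>auto simp: integral_nonneg_AE simp flip: ennreal_plus\<close>)
  qed
  have B0: "0 \<le> B" using B[of undefined] by linarith
  \<comment> \<open>Shifting \<open>u\<close> by its bound makes it nonnegative; the contribution of
    the constant is removed by applying the same identity to \<open>B\<close> alone.\<close>
  have "(\<integral>x. u x + B \<partial>M1) + (\<integral>x. u x + B \<partial>?Q) = (\<integral>x. u x + B \<partial>M2) + (\<integral>x. u x + B \<partial>?P)"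
  proof (rule pos[of _ "2 * B"])
    show "0 \<le> u x + B" "u x + B \<le> 2 * B" for x using B[of x] by linarith+
  qed measurable
  moreover have "(\<integral>x. B \<partial>M1) + (\<integral>x. B \<partial>?Q) = (\<integral>x. B \<partial>M2) + (\<integral>x. B \<partial>?P)"
    by (intro pos[of _ B]) (use B0 in auto)
  moreover have "(\<integral>x. u x + B \<partial>M) = (\<integral>x. u x \<partial>M) + (\<integral>x. B \<partial>M)" if "finite_measure M" "sets M = sets borel" for M :: "(real^'n) measure"
    using finite_measure_integrable_bounded[OF that um B] finite_measure_integrable_bounded[OF that, of "\<lambda>_. B" B] B0
    by (intro Bochner_Integration.integral_add) auto
  ultimately have "(\<integral>x. u x \<partial>M1) - (\<integral>x. u x \<partial>M2) = (\<integral>x. u x \<partial>?P) - (\<integral>x. u x \<partial>?Q)"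
    using fin fM s by simp
  also have "\<dots> = (\<integral>x. max 0 (p x) * u x \<partial>lborel) - (\<integral>x. max 0 (- p x) * u x \<partial>lborel)"
  proof -
    have "?P = density lborel (\<lambda>x. ennreal (max 0 (p x)))" "?Q = density lborel (\<lambda>x. ennreal (max 0 (- p x)))"
      by (auto intro!: density_cong simp: max_def ennreal_neg)
    then show ?thesis by (simp add: integral_density)
  qed
  also have "\<dots> = (\<integral>x. max 0 (p x) * u x - max 0 (- p x) * u x \<partial>lborel)"
  proof (rule Bochner_Integration.integral_diff[symmetric])
    have i: "integrable lborel (\<lambda>x. max 0 (c * p x) * u x)" for c
    proof (rule Bochner_Integration.integrable_bound)
      show "integrable lborel (\<lambda>x. B * (c * p x))" using ip by simp
      show "AE x in lborel. norm (max 0 (c * p x) * u x) \<le> norm (B * (c * p x))"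
      proof (intro always_eventually allI)
        fix x
        have "\<bar>max 0 (c * p x)\<bar> * \<bar>u x\<bar> \<le> \<bar>c * p x\<bar> * B"
          using B[of x] by (intro mult_mono) (simp_all add: max_def)
        then show "norm (max 0 (c * p x) * u x) \<le> norm (B * (c * p x))"
          using B0 by (simp add: abs_mult mult_ac)
      qed
    qed simp
    from i[of 1] i[of "-1"]
    show "integrable lborel (\<lambda>x. max 0 (p x) * u x)" "integrable lborel (\<lambda>x. max 0 (- p x) * u x)" by auto
  qed
  also have "\<dots> = (\<integral>x. p x * u x \<partial>lborel)"
    by (intro Bochner_Integration.integral_cong) (auto simp: max_def)
  finally show ?thesis by (simp add: \<mu> sint_def)
qed

lemma fmeas_fsm: "integrable lborel f \<Longrightarrow> fmeas f \<in> fsm"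
  using finite_measure_density_integrable[of lborel f] finite_measure_density_integrable[of lborel "\<lambda>x. - f x"]
  by (simp add: fmeas_def fsm_def)

lemma fmeas_density: "integrable lborel f \<Longrightarrow> is_density (fmeas f) f"
  by (simp add: is_density_def fmeas_def measure_density_set_integral)

lemma is_density_pdens: "\<mu> \<in> Ma \<Longrightarrow> is_density \<mu> (pdens \<mu>)"
  unfolding Ma_def pdens_def by (auto intro: someI[of "is_density \<mu>"])

subsection \<open>Young functions and Orlicz norms\<close>

lemma classE_young: "e \<in> classE \<Longrightarrow> young e"
  by (simp add: classE_def)

lemma young_convex: assumes "young e" shows "convex_on UNIV e"
proof (rule convex_onI)
  fix t x y :: real assume t: "0 < t" "t < 1"
  show "e ((1 - t) *\<^sub>R x + t *\<^sub>R y) \<le> (1 - t) * e x + t * e y"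
  proof (cases "x = y")
    case True then show ?thesis by (simp add: algebra_simps)
  next
    case False
    then have "e (t * y + (1 - t) * x) < t * e y + (1 - t) * e x"
      using assms t unfolding young_def by (metis (no_types, lifting))
    then show ?thesis by (simp add: add.commute)
  qed
qed simp

context
  fixes e :: "real \<Rightarrow> real"
  assumes young: "young e"
begin

lemma young_nonneg: "0 \<le> e s" and young_0: "e 0 = 0" and young_minus: "e (- s) = e s"
  using young by (auto simp: young_def)

lemma young_abs: "e \<bar>s\<bar> = e s"
  by (simp add: abs_if young_minus)

lemma young_continuous: "continuous_on UNIV e"
  by (rule convex_on_continuous[OF open_UNIV young_convex[OF young]])

lemma young_measurable[measurable]: "e \<in> borel_measurable borel"
  by (rule borel_measurable_continuous_onI[OF young_continuous])

lemma young_scale: assumes "0 \<le> w" "w \<le> 1" shows "e (w * s) \<le> w * e s"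
proof -
  have "e ((1 - w) *\<^sub>R 0 + w *\<^sub>R s) \<le> (1 - w) * e 0 + w * e s"
    by (rule convex_onD[OF young_convex[OF young]]) (use assms in auto)
  then show ?thesis by (simp add: young_0)
qed

lemma young_le_slope: assumes "\<bar>s\<bar> \<le> t" "0 < t" shows "e s \<le> \<bar>s\<bar> / t * e t"
  using young_scale[of "\<bar>s\<bar> / t" t] assms by (simp add: young_abs)

lemma young_mono: assumes "\<bar>s\<bar> \<le> \<bar>t\<bar>" shows "e s \<le> e t"
proof (cases "t = 0")
  case False
  have "e s \<le> \<bar>s\<bar> / \<bar>t\<bar> * e \<bar>t\<bar>" using assms False by (intro young_le_slope) auto
  also have "\<dots> \<le> 1 * e \<bar>t\<bar>" using assms False young_nonneg by (intro mult_right_mono) auto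
  finally show ?thesis by (simp add: young_abs)
qed (use assms in auto)

lemma young_pos: assumes "s \<noteq> 0" shows "0 < e s"
proof -
  have "\<forall>x y t. x \<noteq> y \<and> 0 < t \<and> t < 1 \<longrightarrow> e (t * x + (1 - t) * y) < t * e x + (1 - t) * e y"
    using young unfolding young_def by blast
  from this[rule_format, of s "-s" "1/2"] have "e (1/2 * s + (1 - 1/2) * (-s)) < 1/2 * e s + (1 - 1/2) * e (-s)"
    using assms by simp
  then show ?thesis by (simp add: young_0 young_minus)
qed

text \<open>Convexity and e 0 = 0 force at least linear growth beyond 1. This bounds sublevel sets,
  series and local L^1 norms in terms of \<open>e\<close>.\<close>

lemma young_linear_bound: "\<bar>s\<bar> \<le> 1 + e s / e 1"
proof (cases "\<bar>s\<bar> \<le> 1")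
  case True
  then show ?thesis using young_nonneg[of s] young_nonneg[of 1] by (smt (verit) divide_nonneg_nonneg)
next
  case False
  have "e 1 \<le> \<bar>1\<bar> / \<bar>s\<bar> * e \<bar>s\<bar>" by (rule young_le_slope) (use False in auto)
  then have "\<bar>s\<bar> * e 1 \<le> e s" using False by (simp add: young_abs field_simps)
  then have "\<bar>s\<bar> \<le> e s / e 1" using young_pos[of 1] by (simp add: field_simps)
  then show ?thesis by simp
qed

text \<open>The sublevel set is closed and bounded, so the supremum defining \<open>einv\<close> is
  attained; a small positive number belongs to the set by \<open>young_scale\<close>, which gives
  positivity.\<close>

lemma einv_props:
  assumes "R > 0" shows "einv e R > 0" "e (einv e R) \<le> R"
proof -
  let ?S = "{c. e c \<le> R}"
  have "closed ?S" by (intro closed_Collect_le young_continuous continuous_on_const)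
  moreover have bdd: "bdd_above ?S"
  proof (rule bdd_aboveI)
    fix c assume "c \<in> ?S"
    then have "e c / e 1 \<le> R / e 1" using young_pos[of 1] by (intro divide_right_mono) auto
    then show "c \<le> 1 + R / e 1" using young_linear_bound[of c] by linarith
  qed
  ultimately have "Sup ?S \<in> ?S" by (intro closed_contains_Sup) (use assms young_0 in \<open>auto intro!: exI[of _ 0]\<close>)
  then show "e (einv e R) \<le> R" by (simp add: einv_def)
  let ?c = "min 1 (R / e 1)"
  have c: "?c > 0" using assms young_pos[of 1] by simp
  have "e (?c * 1) \<le> ?c * e 1" by (rule young_scale) (use c in auto)
  also have "\<dots> \<le> R / e 1 * e 1" using young_pos[of 1] by (intro mult_right_mono) auto
  finally have "?c \<in> ?S" using young_pos[of 1] by simp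
  then have "?c \<le> Sup ?S" by (rule cSup_upper[OF _ bdd])
  then show "einv e R > 0" using c by (simp add: einv_def)
qed

lemma beta_pos: "R > 0 \<Longrightarrow> beta e R > 0"
  by (simp add: beta_def einv_props)

text \<open>Since e 0 = 0, Jensen's inequality survives for weights of total mass below 1: the
  missing mass may be thought of as placed at 0.\<close>

lemma young_weighted_sum:
  assumes "\<And>n. n < N \<Longrightarrow> 0 \<le> w n" "(\<Sum>n<N. w n) \<le> 1"
  shows "e (\<Sum>n<(N::nat). w n * y n) \<le> (\<Sum>n<N. w n * e (y n))"
proof (cases "(\<Sum>n<N. w n) = 0")
  case True
  then have "\<forall>n<N. w n = 0" using assms(1) by (subst (asm) sum_nonneg_eq_0_iff) auto
  then show ?thesis by (simp add: young_0)
next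
  case False
  define V where "V = (\<Sum>n<N. w n)"
  have V: "0 < V" "V \<le> 1" using False assms sum_nonneg[of "{..<N}" w] by (auto simp: V_def order_le_less)
  have "(\<Sum>n<N. w n * y n) = V * (\<Sum>n<N. w n / V * y n)"
    using V by (simp add: sum_distrib_left)
  then have "e (\<Sum>n<N. w n * y n) \<le> V * e (\<Sum>n<N. w n / V * y n)"
    using V young_scale by simp
  also have "e (\<Sum>n<N. w n / V * y n) \<le> (\<Sum>n<N. w n / V * e (y n))"
  proof -
    have "e (\<Sum>n<N. (w n / V) *\<^sub>R y n) \<le> (\<Sum>n<N. w n / V * e (y n))"
      by (rule convex_on_sum[OF _ _ young_convex[OF young]])
        (use assms V False in \<open>auto simp: V_def sum_divide_distrib[symmetric]\<close>)
    then show ?thesis by simp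
  qed
  also have "V * (\<Sum>n<N. w n / V * e (y n)) = (\<Sum>n<N. w n * e (y n))"
    using V by (simp add: sum_distrib_left)
  finally show ?thesis using V by simp
qed

lemma young_support_line:
  assumes "0 \<le> s0"
  obtains \<kappa> where "\<And>s. e s0 + \<kappa> * (s - s0) \<le> e s"
  using convex_le_Inf_differential[OF young_convex[OF young], of s0] that by auto

section \<open>The Luxemburg norm\<close>

lemma orlicz_leI:
  "0 < c \<Longrightarrow> (\<integral>\<^sup>+x. ennreal (e (f x / c)) \<partial>lborel) \<le> 1 \<Longrightarrow> orlicz e f \<le> ennreal c"
  unfolding orlicz_def by (rule INF_lower) simp

text \<open>Monotonicity of \<open>e\<close> carries the bound over from a smaller admissible
  constant. Arguing with constants strictly above the norm avoids the question whether the infimum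
  is attained.\<close>

lemma orlicz_lessD:
  assumes "orlicz e f < ennreal c"
  shows "0 < c" "(\<integral>\<^sup>+x. ennreal (e (f x / c)) \<partial>lborel) \<le> 1"
proof -
  obtain c' where c': "0 < c'" "(\<integral>\<^sup>+x. ennreal (e (f x / c')) \<partial>lborel) \<le> 1" "ennreal c' < ennreal c"
    using assms unfolding orlicz_def INF_less_iff by auto
  then have "c' < c" by (simp add: ennreal_less_iff)
  then show "0 < c" using c' by simp
  have "e (f x / c) \<le> e (f x / c')" for x
    using c' \<open>c' < c\<close> by (intro young_mono) (auto simp: abs_divide intro!: divide_left_mono)
  then have "(\<integral>\<^sup>+x. ennreal (e (f x / c)) \<partial>lborel) \<le> (\<integral>\<^sup>+x. ennreal (e (f x / c')) \<partial>lborel)"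
    by (intro nn_integral_mono ennreal_leI)
  then show "(\<integral>\<^sup>+x. ennreal (e (f x / c)) \<partial>lborel) \<le> 1" using c' by simp
qed

lemma orlicz_mono:
  assumes "AE x in lborel. \<bar>f x\<bar> \<le> \<bar>g x\<bar>" shows "orlicz e f \<le> orlicz e g"
  unfolding orlicz_def
proof (rule INF_superset_mono)
  show "{c. 0 < c \<and> (\<integral>\<^sup>+x. ennreal (e (g x / c)) \<partial>lborel) \<le> 1} \<subseteq> {c. 0 < c \<and> (\<integral>\<^sup>+x. ennreal (e (f x / c)) \<partial>lborel) \<le> 1}"
  proof safe
    fix c :: real assume c: "0 < c" "(\<integral>\<^sup>+x. ennreal (e (g x / c)) \<partial>lborel) \<le> 1"
    have "(\<integral>\<^sup>+x. ennreal (e (f x / c)) \<partial>lborel) \<le> (\<integral>\<^sup>+x. ennreal (e (g x / c)) \<partial>lborel)"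
      using assms
      by (intro nn_integral_mono_AE) (auto elim!: eventually_mono intro!: ennreal_leI young_mono divide_right_mono simp: abs_divide)
    then show "(\<integral>\<^sup>+x. ennreal (e (f x / c)) \<partial>lborel) \<le> 1" using c by simp
  qed
qed simp

lemma orlicz_AE_cong: "AE x in lborel. f x = g x \<Longrightarrow> orlicz e f = orlicz e g"
  by (intro antisym orlicz_mono) (auto elim!: eventually_mono)

lemma orlicz_zero: "orlicz e (\<lambda>_. 0) = 0"
proof -
  have "orlicz e (\<lambda>_. 0) \<le> 0 + ennreal c" if "c > 0" for c
    using orlicz_leI[OF that, of "\<lambda>_. 0"] by (simp add: young_0)
  then have "orlicz e (\<lambda>_. 0) \<le> 0" by (rule ennreal_le_epsilon)
  then show ?thesis by simp
qed

lemma orlicz_cmult: "orlicz e (\<lambda>x. a * f x) \<le> ennreal \<bar>a\<bar> * orlicz e f"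
proof (cases "a = 0")
  case True then show ?thesis using orlicz_zero by simp
next
  case False
  \<comment> \<open>The factor is moved to the other side so that the claim can be checked on each
    admissible constant for \<open>f\<close>.\<close>
  have "ennreal (1 / \<bar>a\<bar>) * orlicz e (\<lambda>x. a * f x) \<le> orlicz e f"
    unfolding orlicz_def[of e f]
  proof (rule INF_greatest, clarify)
    fix c :: real assume c: "0 < c" "(\<integral>\<^sup>+x. ennreal (e (f x / c)) \<partial>lborel) \<le> 1"
    have "e (a * f x / (\<bar>a\<bar> * c)) = e (f x / c)" for x
      using False young_minus[of "f x / c"] by (cases "a > 0") auto
    then have "orlicz e (\<lambda>x. a * f x) \<le> ennreal (\<bar>a\<bar> * c)"
      using c False by (intro orlicz_leI) auto
    then have "ennreal (1 / \<bar>a\<bar>) * orlicz e (\<lambda>x. a * f x) \<le> ennreal (1 / \<bar>a\<bar>) * ennreal (\<bar>a\<bar> * c)"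
      by (rule mult_left_mono) simp
    also have "\<dots> = ennreal c" using False c by (simp flip: ennreal_mult)
    finally show "ennreal (1 / \<bar>a\<bar>) * orlicz e (\<lambda>x. a * f x) \<le> ennreal c" .
  qed
  then have "ennreal \<bar>a\<bar> * (ennreal (1 / \<bar>a\<bar>) * orlicz e (\<lambda>x. a * f x)) \<le> ennreal \<bar>a\<bar> * orlicz e f"
    by (rule mult_left_mono) simp
  moreover have "ennreal \<bar>a\<bar> * ennreal (1 / \<bar>a\<bar>) = 1" using False by (simp flip: ennreal_mult)
  ultimately show ?thesis by (simp flip: mult.assoc)
qed

text \<open>This is Jensen's inequality for the sum of the terms (c n / C) (g n / c n), where C is
  the sum of the c n. Partial sums are covered by the finite case, and continuity of
  \<open>e\<close> passes to the limit.\<close>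

lemma young_series_bound:
  fixes g c :: "nat \<Rightarrow> real"
  assumes c: "\<And>n. 0 < c n" "summable c" and fg: "ennreal \<bar>f\<bar> \<le> (\<Sum>n. ennreal \<bar>g n\<bar>)"
  shows "ennreal (e (f / suminf c)) \<le> (\<Sum>n. ennreal (c n / suminf c * e (g n / c n)))" (is "_ \<le> ?T")
proof (cases "?T = \<infinity>")
  case False
  define C where "C = suminf c"
  have C: "C > 0" unfolding C_def using c by (intro suminf_pos) auto
  let ?t = "\<lambda>n. c n / C * e (g n / c n)"
  have t0: "0 \<le> ?t n" for n using c C young_nonneg by (simp add: less_imp_le)
  have sum: "summable ?t"
    using False by (intro summable_suminf_not_top t0) (simp only: C_def infinity_ennreal_def not_False_eq_True)
  have T: "?T = ennreal (suminf ?t)"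
    unfolding C_def[symmetric] by (rule suminf_ennreal2[OF t0 sum])
  let ?S = "\<lambda>N. \<Sum>n<N. \<bar>g n\<bar>"
  have part: "e (?S N / C) \<le> suminf ?t" for N
  proof -
    have "?S N / C = (\<Sum>n<N. (c n / C) * (\<bar>g n\<bar> / c n))"
      unfolding sum_divide_distrib using c(1) by (intro sum.cong) (auto simp: less_imp_neq[symmetric])
    also have "e \<dots> \<le> (\<Sum>n<N. (c n / C) * e (\<bar>g n\<bar> / c n))"
    proof (rule young_weighted_sum)
      have "(\<Sum>n<N. c n) \<le> C" unfolding C_def by (rule sum_le_suminf) (use c in \<open>auto simp: less_imp_le\<close>)
      then show "(\<Sum>n<N. c n / C) \<le> 1" using C by (simp flip: sum_divide_distrib)
    qed (use c C in \<open>auto simp: less_imp_le\<close>)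
    also have "\<dots> = (\<Sum>n<N. ?t n)"
    proof (intro sum.cong refl)
      fix n
      have "\<bar>g n\<bar> / c n = \<bar>g n / c n\<bar>" using c(1)[of n] by simp
      then show "c n / C * e (\<bar>g n\<bar> / c n) = ?t n" by (simp only: young_abs)
    qed
    also have "\<dots> \<le> suminf ?t" by (rule sum_le_suminf[OF sum]) (use t0 in auto)
    finally show ?thesis .
  qed
  \<comment> \<open>The values of \<open>e\<close> on the partial sums are bounded, and linear
    growth turns this into a bound on the sums themselves.\<close>
  have summ: "summable (\<lambda>n. \<bar>g n\<bar>)"
  proof (rule bounded_imp_summable[where B = "C * (1 + suminf ?t / e 1)"])
    fix n
    have "?S (Suc n) / C \<le> 1 + e (?S (Suc n) / C) / e 1" using young_linear_bound[of "?S (Suc n) / C"] by linarith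
    also have "\<dots> \<le> 1 + suminf ?t / e 1"
      using part[of "Suc n"] young_pos[of 1] by (intro add_left_mono divide_right_mono) auto
    finally show "sum (\<lambda>n. \<bar>g n\<bar>) {..n} \<le> C * (1 + suminf ?t / e 1)"
      using C by (simp add: field_simps lessThan_Suc_atMost)
  qed simp
  have G: "(\<Sum>n. ennreal \<bar>g n\<bar>) = ennreal (\<Sum>n. \<bar>g n\<bar>)"
    by (rule suminf_ennreal2[OF _ summ]) simp
  have G0: "0 \<le> (\<Sum>n. \<bar>g n\<bar>)" by (rule suminf_nonneg[OF summ]) simp
  have "\<bar>f\<bar> \<le> (\<Sum>n. \<bar>g n\<bar>)"
    using fg unfolding G ennreal_le_iff[OF G0] .
  then have "e (f / C) \<le> e ((\<Sum>n. \<bar>g n\<bar>) / C)"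
    using C G0 by (intro young_mono) (auto simp: abs_divide intro!: divide_right_mono)
  also have "\<dots> \<le> suminf ?t"
  proof (rule LIMSEQ_le_const2)
    have "(\<lambda>N. ?S N / C) \<longlonglongrightarrow> (\<Sum>n. \<bar>g n\<bar>) / C"
      using summ by (intro tendsto_divide tendsto_const summable_LIMSEQ) (use C in auto)
    then show "(\<lambda>N. e (?S N / C)) \<longlonglongrightarrow> e ((\<Sum>n. \<bar>g n\<bar>) / C)"
      by (rule continuous_on_tendsto_compose[OF young_continuous]) auto
  qed (use part in auto)
  finally show ?thesis unfolding T by (simp add: C_def ennreal_leI)
qed simp

text \<open>The countable triangle inequality serves the telescoping series;
  \<open>orlicz_add\<close> follows from it by padding with zeros. Each norm is exceeded by a
  geometric slack of total \<epsilon>, and the resulting constants are the weights in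
  \<open>young_series_bound\<close>.\<close>

lemma orlicz_suminf:
  fixes g :: "nat \<Rightarrow> real^'n::finite \<Rightarrow> real"
  assumes g[measurable]: "\<And>n. g n \<in> borel_measurable borel"
    and fg: "AE x in lborel. ennreal \<bar>f x\<bar> \<le> (\<Sum>n. ennreal \<bar>g n x\<bar>)"
  shows "orlicz e f \<le> (\<Sum>n. orlicz e (g n))"
proof (cases "(\<Sum>n. orlicz e (g n)) = \<infinity>")
  case False
  show ?thesis
  proof (rule ennreal_le_epsilon)
    fix \<epsilon> :: real assume \<epsilon>: "0 < \<epsilon>"
    define r where "r n = enn2real (orlicz e (g n))" for n
    have fin: "orlicz e (g n) < \<infinity>" for n
      using False ennreal_suminf_lessD[of "\<lambda>n. orlicz e (g n)" \<infinity> n] by (simp add: less_top)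
    then have r: "orlicz e (g n) = ennreal (r n)" "0 \<le> r n" for n by (auto simp: r_def)
    have sr: "summable r" using False by (intro summable_suminf_not_top) (auto simp: r)
    define c where "c n = r n + \<epsilon> * (1/2) ^ Suc n" for n
    have c0: "c n > 0" for n using r(2)[of n] \<epsilon> by (simp add: c_def add_nonneg_pos)
    have geo: "(\<lambda>n. \<epsilon> * (1/2) ^ Suc n) sums (\<epsilon> * 1)"
      by (intro sums_mult power_half_series)
    have sc: "summable c" unfolding c_def using sr geo by (intro summable_add) (auto simp: sums_iff)
    have C: "suminf c = suminf r + \<epsilon>" unfolding c_def using suminf_add[OF sr] geo by (metis mult.right_neutral sums_iff)
    have int1: "(\<integral>\<^sup>+x. ennreal (e (g n x / c n)) \<partial>lborel) \<le> 1" for n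
    proof (rule orlicz_lessD(2))
      show "orlicz e (g n) < ennreal (c n)" unfolding r(1) using r(2)[of n] \<epsilon> by (simp add: c_def ennreal_less_iff)
    qed
    have Cpos: "suminf c > 0" using sc c0 by (intro suminf_pos)
    have "(\<integral>\<^sup>+x. ennreal (e (f x / suminf c)) \<partial>lborel)
      \<le> (\<integral>\<^sup>+x. (\<Sum>n. ennreal (c n / suminf c * e (g n x / c n))) \<partial>lborel)"
      by (rule nn_integral_mono_AE, rule eventually_mono[OF fg], rule young_series_bound[OF c0 sc])
    also have "\<dots> = (\<Sum>n. \<integral>\<^sup>+x. ennreal (c n / suminf c) * ennreal (e (g n x / c n)) \<partial>lborel)"
      using c0 Cpos young_nonneg
      by (subst nn_integral_suminf) (auto simp: less_imp_le ennreal_mult[symmetric])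
    also have "\<dots> = (\<Sum>n. ennreal (c n / suminf c) * (\<integral>\<^sup>+x. ennreal (e (g n x / c n)) \<partial>lborel))"
      by (subst nn_integral_cmult) auto
    also have "\<dots> \<le> (\<Sum>n. ennreal (c n / suminf c) * 1)"
      by (intro suminf_le mult_left_mono int1 summableI) auto
    also have "\<dots> = ennreal (\<Sum>n. c n / suminf c)"
      using c0 Cpos sc by (simp, intro suminf_ennreal2) (auto simp: less_imp_le intro: summable_divide)
    also have "(\<Sum>n. c n / suminf c) = 1" using suminf_divide[OF sc, of "suminf c"] Cpos by simp
    finally have "orlicz e f \<le> ennreal (suminf c)" by (intro orlicz_leI Cpos) simp
    also have "\<dots> = (\<Sum>n. orlicz e (g n)) + ennreal \<epsilon>"
      unfolding C r(1) using suminf_ennreal2[OF r(2) sr] \<epsilon> suminf_nonneg[OF sr r(2)] by (simp add: ennreal_plus)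
    finally show "orlicz e f \<le> (\<Sum>n. orlicz e (g n)) + ennreal \<epsilon>" .
  qed
qed simp

lemma orlicz_add:
  fixes f g h :: "real^'n::finite \<Rightarrow> real"
  assumes "g \<in> borel_measurable borel" "h \<in> borel_measurable borel"
    "AE x in lborel. \<bar>f x\<bar> \<le> \<bar>g x\<bar> + \<bar>h x\<bar>"
  shows "orlicz e f \<le> orlicz e g + orlicz e h"
proof -
  let ?G = "\<lambda>n::nat. if n = 0 then g else if n = 1 then h else (\<lambda>_. 0)"
  have s: "(\<Sum>n. F n) = F 0 + F 1" if "\<And>n. n \<notin> {0, 1} \<Longrightarrow> F n = 0" for F :: "nat \<Rightarrow> ennreal"
    using suminf_finite[of "{0, 1}" F] that by simp
  have "orlicz e f \<le> (\<Sum>n. orlicz e (?G n))"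
  proof (rule orlicz_suminf)
    show "AE x in lborel. ennreal \<bar>f x\<bar> \<le> (\<Sum>n. ennreal \<bar>?G n x\<bar>)"
      using assms(3)
    proof eventually_elim
      case (elim x)
      have sum: "(\<Sum>n. ennreal \<bar>?G n x\<bar>) = ennreal \<bar>g x\<bar> + ennreal \<bar>h x\<bar>" by (subst s) auto
      have "ennreal \<bar>f x\<bar> \<le> ennreal (\<bar>g x\<bar> + \<bar>h x\<bar>)" using elim by (rule ennreal_leI)
      then show ?case unfolding sum by (simp only: ennreal_plus abs_ge_zero)
    qed
    show "?G n \<in> borel_measurable borel" for n
      using assms(1,2) by (cases "n = 0"; cases "n = 1"; simp)
  qed
  also have "\<dots> = orlicz e g + orlicz e h"
    using s[of "\<lambda>n. orlicz e (?G n)"] by (simp add: orlicz_zero)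
  finally show ?thesis .
qed

lemma orlicz_sum:
  fixes f :: "real^'n::finite \<Rightarrow> real"
  assumes "finite I" "\<And>i. i \<in> I \<Longrightarrow> g i \<in> borel_measurable borel"
    "AE x in lborel. \<bar>f x\<bar> \<le> (\<Sum>i\<in>I. \<bar>g i x\<bar>)"
  shows "orlicz e f \<le> (\<Sum>i\<in>I. orlicz e (g i))"
  using assms
proof (induction I arbitrary: f rule: finite_induct)
  case empty
  then have "orlicz e f \<le> orlicz e (\<lambda>_::real^'n. 0)" by (intro orlicz_mono) auto
  then show ?case by (simp add: orlicz_zero)
next
  case (insert i I)
  let ?h = "\<lambda>x. \<Sum>j\<in>I. \<bar>g j x\<bar>"
  have "orlicz e f \<le> orlicz e (g i) + orlicz e ?h"
  proof (rule orlicz_add)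
    show "?h \<in> borel_measurable borel" using insert.prems(1) by auto
    show "AE x in lborel. \<bar>f x\<bar> \<le> \<bar>g i x\<bar> + \<bar>?h x\<bar>"
      using insert.prems(2) insert.hyps by (auto elim!: eventually_mono simp: sum_nonneg)
  qed (use insert.prems in auto)
  also have "orlicz e ?h \<le> (\<Sum>j\<in>I. orlicz e (g j))"
    using insert.prems by (intro insert.IH) (auto simp: sum_nonneg)
  finally show ?case using insert.hyps by simp
qed

text \<open>A bound B > 0 replaces the L^1 norm of the kernel, so that one may divide by it even for
  the zero kernel; the normalised kernel then has total mass at most 1.\<close>

lemma orlicz_convolution:
  fixes f :: "real^'n::finite \<Rightarrow> real"
  assumes f: "loc_int f" and hs: "csms hs" and B: "B > 0" "L1t hs \<le> B"
  shows "orlicz e (\<lambda>x. \<integral>y. \<bar>f y\<bar> * \<bar>tens hs (x - y)\<bar> \<partial>lborel) \<le> ennreal B * orlicz e f"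
proof -
  let ?G = "\<lambda>x. \<integral>y. \<bar>f y\<bar> * \<bar>tens hs (x - y)\<bar> \<partial>lborel"
  have [measurable]: "f \<in> borel_measurable borel" using f loc_int_def by auto
  note tm[measurable] = tens_measurable[OF hs]
  have i1: "integrable lborel (\<lambda>y. \<bar>f y\<bar> * \<bar>tens hs (x - y)\<bar>)" for x
    using integrable_abs[OF conv_integrable[OF locint_loc_int[OF f] hs]] by (simp add: abs_mult)
  have i2: "integrable lborel (\<lambda>y. \<bar>tens hs (x - y)\<bar>)" for x
    using integrable_abs[OF tens_integrable[OF csms_rf[OF hs]], of x] by (simp add: tens_rf)
  have L: "(\<integral>y. \<bar>tens hs (x - y)\<bar> \<partial>lborel) = L1t hs" for x
    unfolding L1t_def by (rule integral_lborel_reflect) simp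
  have Ln: "(\<integral>\<^sup>+x. ennreal \<bar>tens hs x\<bar> \<partial>lborel) = ennreal (L1t hs)"
    unfolding L1t_def by (rule nn_integral_eq_integral) (use integrable_abs[OF tens_integrable[OF hs]] in auto)
  \<comment> \<open>Jensen's inequality, in the form for weights of total mass at most one, which holds as \<open>e 0 = 0\<close>\<close>
  have key: "(\<integral>\<^sup>+x. ennreal (e (?G x / (B * c))) \<partial>lborel) \<le> 1"
    if c: "0 < c" "(\<integral>\<^sup>+x. ennreal (e (f x / c)) \<partial>lborel) \<le> 1" for c
  proof -
    have pw: "ennreal (e (?G x / (B * c))) \<le> (\<integral>\<^sup>+y. ennreal (e (f y / c)) * ennreal (\<bar>tens hs (x - y)\<bar> / B) \<partial>lborel)" (is "_ \<le> ?T")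
      for x
    proof (cases "?T = \<infinity>")
      case False
      let ?w = "\<lambda>y. \<bar>tens hs (x - y)\<bar> / B"
      have iT: "integrable lborel (\<lambda>y. e (f y / c) * ?w y)"
        using False B young_nonneg
        by (subst integrable_iff_bounded) (auto simp: less_top ennreal_mult[symmetric] abs_mult)
      have T: "?T = ennreal (\<integral>y. e (f y / c) * ?w y \<partial>lborel)"
        using B young_nonneg
        by (subst nn_integral_eq_integral[symmetric, OF iT]) (auto simp: ennreal_mult[symmetric] intro!: nn_integral_cong)
      define s0 where "s0 = (\<integral>y. \<bar>f y\<bar> / c * ?w y \<partial>lborel)"
      have iF: "integrable lborel (\<lambda>y. \<bar>f y\<bar> / c * ?w y)"
        using integrable_divide[OF i1[of x], of "c * B"] by (simp add: divide_simps)
      have s0: "s0 = ?G x / (B * c)"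
        unfolding s0_def by (subst integral_divide_zero[symmetric]) (auto intro!: Bochner_Integration.integral_cong simp: divide_simps)
      have s0n: "0 \<le> s0" unfolding s0_def using c B by (intro integral_nonneg_AE always_eventually) auto
      obtain \<kappa> where \<kappa>: "\<And>s. e s0 + \<kappa> * (s - s0) \<le> e s" using young_support_line[OF s0n] by blast
      have W: "(\<integral>y. ?w y \<partial>lborel) = L1t hs / B" by (simp add: L)
      have iw: "integrable lborel ?w" by (rule integrable_divide) (use i2 in auto)
      have "(\<integral>y. (e s0 - \<kappa> * s0) * ?w y + \<kappa> * (\<bar>f y\<bar> / c * ?w y) \<partial>lborel)
          = (\<integral>y. (e s0 - \<kappa> * s0) * ?w y \<partial>lborel) + (\<integral>y. \<kappa> * (\<bar>f y\<bar> / c * ?w y) \<partial>lborel)"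
        by (rule Bochner_Integration.integral_add[OF integrable_mult_right[OF iw] integrable_mult_right[OF iF]])
      also have "\<dots> = (e s0 - \<kappa> * s0) * (\<integral>y. ?w y \<partial>lborel) + \<kappa> * s0"
        by (simp only: integral_mult_right_zero s0_def)
      finally have "(e s0 - \<kappa> * s0) * (\<integral>y. ?w y \<partial>lborel) + \<kappa> * s0
          = (\<integral>y. (e s0 - \<kappa> * s0) * ?w y + \<kappa> * (\<bar>f y\<bar> / c * ?w y) \<partial>lborel)" by simp
      also have "\<dots> \<le> (\<integral>y. e (f y / c) * ?w y \<partial>lborel)"
      proof (intro integral_mono iT)
        show "integrable lborel (\<lambda>y. (e s0 - \<kappa> * s0) * ?w y + \<kappa> * (\<bar>f y\<bar> / c * ?w y))"
          by (rule Bochner_Integration.integrable_add[OF integrable_mult_right[OF iw] integrable_mult_right[OF iF]])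
        fix y
        have "(e s0 + \<kappa> * (\<bar>f y\<bar> / c - s0)) * ?w y \<le> e (\<bar>f y\<bar> / c) * ?w y"
          using B by (intro mult_right_mono \<kappa>) auto
        moreover have "e (\<bar>f y\<bar> / c) = e (f y / c)" using young_abs[of "f y / c"] c by (simp add: abs_divide)
        moreover have "(e s0 - \<kappa> * s0) * w + \<kappa> * (F * w) = (e s0 + \<kappa> * (F - s0)) * w" for F w
          by (simp add: algebra_simps)
        ultimately show "(e s0 - \<kappa> * s0) * ?w y + \<kappa> * (\<bar>f y\<bar> / c * ?w y) \<le> e (f y / c) * ?w y"
          by (simp only:)
      qed
      finally have 1: "(e s0 - \<kappa> * s0) * (L1t hs / B) + \<kappa> * s0 \<le> (\<integral>y. e (f y / c) * ?w y \<partial>lborel)" unfolding W .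
      \<comment> \<open>The supporting line lies below \<open>e\<close> at 0, so its intercept is at
        most 0; replacing the mass L1t hs / B by 1 can therefore only lower the left side.\<close>
      have "e s0 - \<kappa> * s0 \<le> 0" using \<kappa>[of 0] young_0 by simp
      moreover have "0 \<le> L1t hs / B" "L1t hs / B \<le> 1" using B L1t_nonneg[of hs] by auto
      ultimately have "(e s0 - \<kappa> * s0) * 1 \<le> (e s0 - \<kappa> * s0) * (L1t hs / B)"
        by (intro mult_left_mono_neg) auto
      then have "e s0 \<le> (\<integral>y. e (f y / c) * ?w y \<partial>lborel)" using 1 by simp
      then show ?thesis unfolding T s0[symmetric] by (rule ennreal_leI)
    qed simp
    have "(\<integral>\<^sup>+x. ennreal (e (?G x / (B * c))) \<partial>lborel)
      \<le> (\<integral>\<^sup>+x. (\<integral>\<^sup>+y. ennreal (e (f y / c)) * ennreal (\<bar>tens hs (x - y)\<bar> / B) \<partial>lborel) \<partial>lborel)"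
      by (intro nn_integral_mono pw)
    also have "\<dots> = (\<integral>\<^sup>+y. (\<integral>\<^sup>+x. ennreal (e (f y / c)) * ennreal (\<bar>tens hs (x - y)\<bar> / B) \<partial>lborel) \<partial>lborel)"
      by (rule lborel_pair.Fubini') measurable
    also have "\<dots> = (\<integral>\<^sup>+y. ennreal (e (f y / c)) * ennreal (L1t hs / B) \<partial>lborel)"
    proof (intro nn_integral_cong)
      fix y
      have "(\<integral>\<^sup>+x. ennreal (\<bar>tens hs (x - y)\<bar> / B) \<partial>lborel) = (\<integral>\<^sup>+x. ennreal (\<bar>tens hs x\<bar> / B) \<partial>lborel)"
        using nn_integral_lborel_translate[of "\<lambda>x. ennreal (\<bar>tens hs x\<bar> / B)" "- y"] by simp
      also have "\<dots> = ennreal (L1t hs / B)"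
        using B by (simp add: divide_ennreal[symmetric] Ln L1t_nonneg nn_integral_divide)
      finally show "(\<integral>\<^sup>+x. ennreal (e (f y / c)) * ennreal (\<bar>tens hs (x - y)\<bar> / B) \<partial>lborel)
        = ennreal (e (f y / c)) * ennreal (L1t hs / B)"
        by (subst nn_integral_cmult) auto
    qed
    also have "\<dots> = (\<integral>\<^sup>+y. ennreal (e (f y / c)) \<partial>lborel) * ennreal (L1t hs / B)"
      by (rule nn_integral_multc) auto
    also have "\<dots> \<le> 1 * 1" using c B by (intro mult_mono) auto
    finally show ?thesis by simp
  qed
  have "ennreal (1 / B) * orlicz e ?G \<le> orlicz e f"
    unfolding orlicz_def[of e f]
  proof (rule INF_greatest, clarify)
    fix c :: real assume c: "0 < c" "(\<integral>\<^sup>+x. ennreal (e (f x / c)) \<partial>lborel) \<le> 1"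
    have "orlicz e ?G \<le> ennreal (B * c)" using key[OF c] c B by (intro orlicz_leI) auto
    then have "ennreal (1 / B) * orlicz e ?G \<le> ennreal (1 / B) * ennreal (B * c)" by (rule mult_left_mono) simp
    also have "\<dots> = ennreal c" using B c by (simp flip: ennreal_mult)
    finally show "ennreal (1 / B) * orlicz e ?G \<le> ennreal c" .
  qed
  then have "ennreal B * (ennreal (1 / B) * orlicz e ?G) \<le> ennreal B * orlicz e f" by (rule mult_left_mono) simp
  moreover have "ennreal B * ennreal (1 / B) = 1" using B by (simp flip: ennreal_mult)
  ultimately show ?thesis by (simp flip: mult.assoc)
qed

text \<open>With c = A \<beta>(R) the values of |f| / c stay below \<open>einv e R\<close>, and up
  to there convexity keeps \<open>e\<close> below the line of slope R / \<open>einv e R\<close> =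
  \<beta>(R) through the origin. Hence e(f / c) \<le> |f| / A, whose integral is at most 1.\<close>

lemma orlicz_L1_Linf:
  fixes f :: "real^'n::finite \<Rightarrow> real"
  assumes f[measurable]: "f \<in> borel_measurable borel" and A: "0 \<le> A" and R: "0 < R"
    and L1: "(\<integral>\<^sup>+x. ennreal \<bar>f x\<bar> \<partial>lborel) \<le> ennreal A" and Linf: "\<And>x. \<bar>f x\<bar> \<le> A * R"
  shows "orlicz e f \<le> ennreal (A * beta e R)"
proof (cases "A = 0")
  case True
  then have "f = (\<lambda>_. 0)" using Linf by (auto simp: fun_eq_iff)
  then show ?thesis by (simp add: orlicz_zero)
next
  case False
  then have A: "A > 0" using A by simp
  let ?c = "A * beta e R"
  have E: "einv e R > 0" "e (einv e R) \<le> R" using einv_props[OF R] by auto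
  have c: "?c > 0" using A beta_pos[OF R] by simp
  have ARc: "A * R / ?c = einv e R" using A R E by (simp add: beta_def)
  show ?thesis
  proof (rule orlicz_leI[OF c])
    have "e (f x / ?c) \<le> \<bar>f x\<bar> / A" for x
    proof -
      have "\<bar>f x / ?c\<bar> \<le> einv e R"
        unfolding ARc[symmetric] abs_divide abs_of_pos[OF c] by (rule divide_right_mono[OF Linf less_imp_le[OF c]])
      then have "e (f x / ?c) \<le> \<bar>f x / ?c\<bar> / einv e R * e (einv e R)" by (rule young_le_slope[OF _ E(1)])
      also have "\<dots> \<le> \<bar>f x / ?c\<bar> / einv e R * R" using E by (intro mult_left_mono) auto
      also have "\<dots> = \<bar>f x\<bar> / A" unfolding abs_divide abs_of_pos[OF c] using A R E by (simp add: beta_def field_simps)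
      finally show ?thesis .
    qed
    then have "(\<integral>\<^sup>+x. ennreal (e (f x / ?c)) \<partial>lborel) \<le> (\<integral>\<^sup>+x. ennreal (\<bar>f x\<bar> / A) \<partial>lborel)"
      by (intro nn_integral_mono ennreal_leI)
    also have "\<dots> = (\<integral>\<^sup>+x. ennreal \<bar>f x\<bar> \<partial>lborel) / ennreal A"
      using A by (simp add: divide_ennreal[symmetric] nn_integral_divide)
    also have "\<dots> \<le> ennreal A / ennreal A" by (intro divide_right_mono_ennreal L1)
    also have "\<dots> = 1" using A by (simp add: divide_ennreal)
    finally show "(\<integral>\<^sup>+x. ennreal (e (f x / ?c)) \<partial>lborel) \<le> 1" .
  qed
qed

text \<open>The linear bound for f / c is integrated against \<open>w\<close>. The weight is the
  indicator of a ball in \<open>orlicz_telescope_limit\<close> and a negative power of 1 + |x| in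
  \<open>wsob_integrable\<close>.\<close>

lemma weighted_L1_le_orlicz:
  fixes f w :: "real^'n::finite \<Rightarrow> real"
  assumes [measurable]: "f \<in> borel_measurable borel" "w \<in> borel_measurable borel"
    and w: "\<And>x. 0 \<le> w x" "\<And>x. w x \<le> 1" "(\<integral>\<^sup>+x. ennreal (w x) \<partial>lborel) < \<infinity>"
  shows "(\<integral>\<^sup>+x. ennreal (w x * \<bar>f x\<bar>) \<partial>lborel) \<le> ((\<integral>\<^sup>+x. ennreal (w x) \<partial>lborel) + ennreal (1 / e 1)) * orlicz e f"
    (is "?L \<le> ?K * _")
proof (cases "orlicz e f = \<infinity>")
  case True
  \<comment> \<open>The term 1 / e 1 keeps the constant positive, so that its product with an
    infinite norm is infinite in \<open>ennreal\<close>.\<close>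
  have "?K \<noteq> 0" using young_pos[of 1] by simp
  then have "?K * orlicz e f = top"
    using True by (simp only: ennreal_mult_top infinity_ennreal_def if_False)
  then show ?thesis by (simp only: top_greatest)
next
  case False
  have "?K < \<infinity>" using w(3) by simp
  then obtain k where k: "?K = ennreal k" "0 \<le> k" by (cases ?K) auto
  obtain r where r: "orlicz e f = ennreal r" "0 \<le> r" using False by (cases "orlicz e f") auto
  have le: "?L \<le> ennreal c * ?K" if c: "r < c" for c
  proof -
    have c0: "c > 0" using c r by simp
    have "orlicz e f < ennreal c" using c r by (simp add: ennreal_less_iff)
    then have int: "(\<integral>\<^sup>+x. ennreal (e (f x / c)) \<partial>lborel) \<le> 1" by (rule orlicz_lessD)
    have "w x * \<bar>f x\<bar> \<le> c * (w x + 1 / e 1 * e (f x / c))" for x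
    proof -
      have "\<bar>f x / c\<bar> \<le> 1 + e (f x / c) / e 1" by (rule young_linear_bound)
      then have "w x * \<bar>f x / c\<bar> \<le> w x * (1 + e (f x / c) / e 1)" by (intro mult_left_mono w)
      also have "\<dots> \<le> w x + 1 * (e (f x / c) / e 1)"
        using mult_right_mono[OF w(2)[of x], of "e (f x / c) / e 1"] young_nonneg by (simp add: distrib_left)
      finally show ?thesis using c0 by (simp add: abs_divide field_simps)
    qed
    then have "?L \<le> (\<integral>\<^sup>+x. ennreal c * (ennreal (w x) + ennreal (1 / e 1) * ennreal (e (f x / c))) \<partial>lborel)"
      using c0 w young_nonneg
      by (intro nn_integral_mono) (auto simp: ennreal_mult[symmetric] ennreal_plus[symmetric] simp del: ennreal_plus intro!: ennreal_leI)
    also have "\<dots> = ennreal c * ((\<integral>\<^sup>+x. ennreal (w x) \<partial>lborel) + ennreal (1 / e 1) * (\<integral>\<^sup>+x. ennreal (e (f x / c)) \<partial>lborel))"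
      by (simp add: nn_integral_cmult nn_integral_add)
    also have "\<dots> \<le> ennreal c * ((\<integral>\<^sup>+x. ennreal (w x) \<partial>lborel) + ennreal (1 / e 1) * 1)"
      by (intro mult_left_mono add_left_mono int) auto
    finally show ?thesis by simp
  qed
  \<comment> \<open>The choice c = r + \<epsilon> / (k + 1) lets c approach the norm; the summand 1
    keeps the quotient defined when only k \<ge> 0 is at hand.\<close>
  have "?L \<le> ennreal (r * k) + ennreal \<epsilon>" if \<epsilon>: "\<epsilon> > 0" for \<epsilon>
  proof -
    have "?L \<le> ennreal (r + \<epsilon> / (k + 1)) * ennreal k"
      using le[of "r + \<epsilon> / (k + 1)"] k \<epsilon> by simp
    also have "\<dots> = ennreal ((r + \<epsilon> / (k + 1)) * k)" using r k \<epsilon> by (simp add: ennreal_mult')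
    also have "\<dots> \<le> ennreal (r * k + \<epsilon>)"
      using k \<epsilon> by (intro ennreal_leI) (simp add: field_simps)
    finally show ?thesis using r k \<epsilon> by simp
  qed
  then have "?L \<le> ennreal (r * k)" by (rule ennreal_le_epsilon)
  then show ?thesis using k r by (simp add: ennreal_mult' mult.commute)
qed

end

subsection \<open>Regularisation and the distances\<close>

lemma derivs_diff:
  assumes "csm f" "csm g"
  shows "(deriv ^^ n) (\<lambda>t. f t - g t) = (\<lambda>t. (deriv ^^ n) f t - (deriv ^^ n) g t)"
proof (induction n)
  case (Suc n)
  then show ?case
    by (auto intro!: DERIV_imp_deriv DERIV_diff csm_has_deriv csm_derivs assms)
qed simp

lemma derivs_cmult:
  assumes "csm f"
  shows "(deriv ^^ n) (\<lambda>t. c * f t) = (\<lambda>t. c * (deriv ^^ n) f t)"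
proof (induction n)
  case (Suc n)
  then show ?case
    by (auto intro!: DERIV_imp_deriv DERIV_cmult csm_has_deriv csm_derivs assms)
qed simp

text \<open>The pair \<open>\<Gamma> j\<close>, \<open>dir j\<close> describes one term of a
  telescoping sum: a kernel and the coordinate in which the N derivatives are concentrated. The
  multi-index \<open>a\<close> is left free so that the identity also serves derivatives of
  regularised objects.\<close>

definition kernel_system :: "nat \<Rightarrow> (real \<Rightarrow> real) \<Rightarrow> (nat \<Rightarrow> 'n::finite \<Rightarrow> real \<Rightarrow> real) \<Rightarrow> (nat \<Rightarrow> 'n) \<Rightarrow> bool" where
  "kernel_system N H \<Gamma> dir \<longleftrightarrow> csm H \<and> (\<integral>t. H t \<partial>lborel) = 1 \<and> (\<forall>j. csms (\<Gamma> j)) \<and>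
    (\<forall>\<delta>>0. \<forall>a x. tens (dv a (scs (\<delta>/2) (\<lambda>_. H))) x - tens (dv a (scs \<delta> (\<lambda>_. H))) x
       = \<delta> ^ N * (\<Sum>j<CARD('n). tens (dv (\<lambda>i. a i + (if i = dir j then N else 0)) (scs \<delta> (\<Gamma> j))) x))"

lemma kernel_systemD:
  fixes \<Gamma> :: "nat \<Rightarrow> 'n::finite \<Rightarrow> real \<Rightarrow> real"
  assumes "kernel_system N H \<Gamma> dir"
  shows "csm H" "(\<integral>t. H t \<partial>lborel) = 1" "csms (\<Gamma> j)"
    "\<delta> > 0 \<Longrightarrow> tens (dv a (scs (\<delta>/2) (\<lambda>_. H))) x - tens (dv a (scs \<delta> (\<lambda>_. H))) x
       = \<delta> ^ N * (\<Sum>j<CARD('n). tens (dv (\<lambda>i. a i + (if i = dir j then N else 0)) (scs \<delta> (\<Gamma> j))) x)"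
  using assms unfolding kernel_system_def by blast+

text \<open>The factors of the tensor product are moved from scale \<delta> to \<delta>/2 one
  coordinate at a time. Consecutive products differ in a single factor, whose increment is
  \<delta>^N times an N-th derivative by \<open>csm_kernel\<close>.\<close>

lemma kernel_exists:
  "\<exists>H \<Gamma> dir. kernel_system N H (\<Gamma> :: nat \<Rightarrow> 'n::finite \<Rightarrow> real \<Rightarrow> real) dir"
proof -
  obtain H G where H: "csm H" "(\<integral>t. H t \<partial>lborel) = 1" and G: "csm G" "(deriv ^^ N) G = (\<lambda>t. sc (1/2) H t - H t)"
    using csm_kernel by blast
  obtain idx :: "'n \<Rightarrow> nat" where idx: "bij_betw idx UNIV {..<CARD('n)}"
    using ex_bij_betw_finite_nat[of "UNIV :: 'n set"] by (auto simp: atLeast0LessThan)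
  define dir where "dir = inv_into UNIV idx"
  have dir: "idx (dir j) = j" if "j < CARD('n)" for j
    using idx that unfolding dir_def by (auto simp: bij_betw_def intro!: f_inv_into_f)
  have dir_iff: "idx i = j \<longleftrightarrow> i = dir j" if "j < CARD('n)" for i j
    using dir[OF that] idx by (auto simp: bij_betw_def inj_on_def)
  \<comment> \<open>In the j-th term the coordinates enumerated before j are already at half the
    scale, the later ones still at the full scale.\<close>
  define \<Gamma> where "\<Gamma> j i = (if i = dir j then G else if idx i < j then sc (1/2) H else H)" for j and i :: 'n
  have \<Gamma>: "csms (\<Gamma> j)" for j using H G by (auto simp: \<Gamma>_def csm_sc)
  have "tens (dv a (scs (\<delta>/2) (\<lambda>_. H))) x - tens (dv a (scs \<delta> (\<lambda>_. H))) x
       = \<delta> ^ N * (\<Sum>j<CARD('n). tens (dv (\<lambda>i. a i + (if i = dir j then N else 0)) (scs \<delta> (\<Gamma> j))) x)"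
    if \<delta>: "\<delta> > 0" for \<delta> and a :: "'n \<Rightarrow> nat" and x
  proof -
    define A where "A i = (deriv ^^ a i) (sc (\<delta>/2) H) (x $ i)" for i
    define B where "B i = (deriv ^^ a i) (sc \<delta> H) (x $ i)" for i
    define C where "C i = (deriv ^^ (a i + N)) (sc \<delta> G) (x $ i)" for i
    \<comment> \<open>The difference of the one-dimensional kernels is the rescaled N-th derivative
      of \<open>G\<close>; differentiating a rescaled function produces \<delta>^(-N), which the
      factor \<delta>^N undoes.\<close>
    have AB: "A i - B i = \<delta> ^ N * C i" for i
    proof -
      have "(\<lambda>t. sc (\<delta>/2) H t - sc \<delta> H t) = (\<lambda>t. \<delta> ^ N * (deriv ^^ N) (sc \<delta> G) t)"
      proof
        fix t
        have "(deriv ^^ N) (sc \<delta> G) t = (sc (1/2) H (t / \<delta>) - H (t / \<delta>)) / \<delta> / \<delta> ^ N"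
          by (simp add: derivs_sc[OF G(1) \<delta>] G(2)) (simp add: sc_def)
        moreover have "sc (\<delta>/2) H t = sc (1/2) H (t / \<delta>) / \<delta>" by (simp add: sc_def)
        moreover have "sc \<delta> H t = H (t / \<delta>) / \<delta>" by (simp add: sc_def)
        ultimately show "sc (\<delta>/2) H t - sc \<delta> H t = \<delta> ^ N * (deriv ^^ N) (sc \<delta> G) t"
          using \<delta> by (simp add: diff_divide_distrib right_diff_distrib)
      qed
      moreover have "A i - B i = (deriv ^^ a i) (\<lambda>t. sc (\<delta>/2) H t - sc \<delta> H t) (x $ i)"
        unfolding A_def B_def using \<delta> H by (subst derivs_diff) (auto simp: csm_sc)
      ultimately show ?thesis
        using \<delta> G by (simp add: derivs_cmult csm_derivs csm_sc C_def funpow_add)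
    qed
    \<comment> \<open>\<open>T j\<close> interpolates between the kernel at scale \<delta>, for j =
      0, and the one at scale \<delta>/2, for j equal to the dimension.\<close>
    define T where "T j = (\<Prod>i\<in>UNIV. if idx i < j then A i else B i)" for j
    have "T (Suc j) - T j = \<delta> ^ N * tens (dv (\<lambda>i. a i + (if i = dir j then N else 0)) (scs \<delta> (\<Gamma> j))) x"
      if j: "j < CARD('n)" for j
    proof -
      let ?P = "\<Prod>i\<in>UNIV - {dir j}. if idx i < j then A i else B i"
      have 1: "T j = B (dir j) * ?P" unfolding T_def using dir[OF j] by (subst prod.remove[of _ "dir j"]) auto
      have "(\<Prod>i\<in>UNIV - {dir j}. if idx i < Suc j then A i else B i) = ?P"
        using dir_iff[OF j] by (intro prod.cong) (auto simp: less_Suc_eq)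
      then have 2: "T (Suc j) = A (dir j) * ?P"
        unfolding T_def using dir[OF j] by (subst prod.remove[of _ "dir j"]) auto
      have "tens (dv (\<lambda>i. a i + (if i = dir j then N else 0)) (scs \<delta> (\<Gamma> j))) x = C (dir j) * ?P"
      proof -
        have "dv (\<lambda>i. a i + (if i = dir j then N else 0)) (scs \<delta> (\<Gamma> j)) i (x $ i)
          = (if i = dir j then C i else if idx i < j then A i else B i)" for i
          by (cases "i = dir j"; cases "idx i < j")
            (simp_all add: dv_def scs_def \<Gamma>_def C_def A_def B_def sc_sc)
        then show ?thesis unfolding tens_def
          by (simp only:, subst prod.remove[of _ "dir j"]) (auto intro!: prod.cong)
      qed
      then show ?thesis unfolding 1 2 using AB[of "dir j"]
        by (simp add: left_diff_distrib[symmetric] mult.assoc)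
    qed
    then have "(\<Sum>j<CARD('n). T (Suc j) - T j)
      = (\<Sum>j<CARD('n). \<delta> ^ N * tens (dv (\<lambda>i. a i + (if i = dir j then N else 0)) (scs \<delta> (\<Gamma> j))) x)"
      by (intro sum.cong) auto
    also have "(\<Sum>j<CARD('n). T (Suc j) - T j) = T (CARD('n)) - T 0" by (rule sum_lessThan_telescope)
    also have "T (CARD('n)) = tens (dv a (scs (\<delta>/2) (\<lambda>_. H))) x"
      using idx by (auto simp: T_def A_def tens_def dv_def scs_def bij_betw_def intro!: prod.cong)
    also have "T 0 = tens (dv a (scs \<delta> (\<lambda>_. H))) x"
      by (simp add: T_def B_def tens_def dv_def scs_def)
    finally show ?thesis by (simp add: sum_distrib_left)
  qed
  then have "kernel_system N H \<Gamma> dir" unfolding kernel_system_def using H \<Gamma> by blast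
  then show ?thesis by blast
qed

section \<open>Multi-indices and scaled test functions\<close>

lemma finite_mi_upto: "finite (mi_upto k :: ('n::finite \<Rightarrow> nat) set)"
proof (rule finite_subset)
  show "(mi_upto k :: ('n \<Rightarrow> nat) set) \<subseteq> {f. \<forall>i. f i \<in> {..k}}"
  proof safe
    fix a :: "'n \<Rightarrow> nat" and i assume "a \<in> mi_upto k"
    moreover have "a i \<le> mi_abs a" unfolding mi_abs_def by (rule member_le_sum) auto
    ultimately show "a i \<le> k" by (auto simp: mi_upto_def)
  qed
  have "finite (PiE (UNIV :: 'n set) (\<lambda>_. {..k}))" by (intro finite_PiE) auto
  then show "finite {f :: 'n \<Rightarrow> nat. \<forall>i. f i \<in> {..k}}"
    by (simp add: PiE_def Pi_def extensional_def)
qed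

lemma mi_abs_add: "mi_abs (\<lambda>i. a i + b i) = mi_abs a + mi_abs b"
  by (simp add: mi_abs_def sum.distrib)

lemma mi_abs_single: "mi_abs (\<lambda>i. if i = j then N else 0) = N"
  by (simp add: mi_abs_def)

lemma mi_upto_0: "(\<lambda>_. 0) \<in> mi_upto k"
  by (simp add: mi_upto_def mi_abs_def)

lemma smooth_cmult_pderivs: "smooth u \<Longrightarrow> pderivs is (\<lambda>x. c * u x) = (\<lambda>x. c * pderivs is u x)"
proof (induction "is")
  case (Cons i js)
  have P: "partial i (\<lambda>x. c * pderivs js u x) y = c * partial i (pderivs js u) y" for y
    using partial_eqI[OF has_derivative_mult_right[OF smooth_has_derivative[OF smooth_pderivs[OF Cons.prems, of js]], of c], of i y]
      partial_eqI[OF smooth_has_derivative[OF smooth_pderivs[OF Cons.prems, of js]], of i y] by simp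
  have eq: "pderivs js (\<lambda>x. c * u x) = (\<lambda>x. c * pderivs js u x)" using Cons by simp
  show ?case unfolding pderivs.simps eq by (rule ext) (rule P)
qed simp

lemma smooth_cmult: "smooth u \<Longrightarrow> smooth (\<lambda>x. c * u x)"
  unfolding smooth_def
proof (intro allI)
  fix "is" x assume "\<forall>is x. pderivs is u differentiable at x"
  then have "smooth u" and "pderivs is u differentiable at x" by (auto simp: smooth_def)
  then show "pderivs is (\<lambda>x. c * u x) differentiable at x"
    by (simp add: smooth_cmult_pderivs)
qed

text \<open>Division by C brings the test function into the unit ball of \<open>cnorm k\<close>;
  separate bounds \<open>c b\<close> are summed because \<open>cnorm\<close> is a sum over
  multi-indices.\<close>

lemma dk_test_bound:
  fixes \<Phi> :: "real^'n::finite \<Rightarrow> real"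
  assumes s: "smooth \<Phi>" and b: "\<And>b x. b \<in> mi_upto k \<Longrightarrow> \<bar>Dm b \<Phi> x\<bar> \<le> c b"
    and C: "(\<Sum>b\<in>mi_upto k. c b) \<le> C" "0 < C"
  shows "ennreal \<bar>sint \<mu> \<Phi> - sint \<nu> \<Phi>\<bar> \<le> ennreal C * dk k \<mu> \<nu>"
proof -
  let ?\<Psi> = "\<lambda>x. (1 / C) * \<Phi> x"
  have c0: "b \<in> mi_upto k \<Longrightarrow> 0 \<le> c b" for b using b[of b undefined] by linarith
  have "cnorm k ?\<Psi> \<le> (\<Sum>b\<in>mi_upto k. ennreal (c b / C))"
    unfolding cnorm_def
  proof (intro sum_mono SUP_least ennreal_leI)
    fix b :: "'n \<Rightarrow> nat" and x assume "b \<in> mi_upto k"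
    then show "\<bar>Dm b ?\<Psi> x\<bar> \<le> c b / C"
      using b[of b x] C unfolding Dm_def smooth_cmult_pderivs[OF s] by (simp add: abs_mult divide_right_mono)
  qed
  also have "\<dots> = ennreal (\<Sum>b\<in>mi_upto k. c b / C)" using c0 C by (intro sum_ennreal) auto
  also have "\<dots> \<le> 1" using C by (simp add: sum_divide_distrib[symmetric])
  finally have cn: "cnorm k ?\<Psi> \<le> 1" .
  have le: "ennreal \<bar>sint \<mu> ?\<Psi> - sint \<nu> ?\<Psi>\<bar> \<le> dk k \<mu> \<nu>"
    unfolding dk_def by (rule SUP_upper) (intro CollectI conjI smooth_cmult[OF s] cn)
  have "sint \<mu> ?\<Psi> - sint \<nu> ?\<Psi> = (1 / C) * (sint \<mu> \<Phi> - sint \<nu> \<Phi>)"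
    unfolding sint_def integral_mult_right_zero by (simp add: algebra_simps)
  then have "\<bar>sint \<mu> \<Phi> - sint \<nu> \<Phi>\<bar> = C * \<bar>sint \<mu> ?\<Psi> - sint \<nu> ?\<Psi>\<bar>" using C by (simp add: abs_mult)
  then have "ennreal \<bar>sint \<mu> \<Phi> - sint \<nu> \<Phi>\<bar> = ennreal C * ennreal \<bar>sint \<mu> ?\<Psi> - sint \<nu> ?\<Psi>\<bar>"
    using C by (simp add: ennreal_mult)
  also have "\<dots> \<le> ennreal C * dk k \<mu> \<nu>" by (intro mult_left_mono le) simp
  finally show ?thesis .
qed

text \<open>Fubini moves the regularisation onto the test function, with the reflected kernel
  \<open>rf 0 hs\<close>; absolute integrability comes from the bound B L1t(hs) |f|. A general M
  covers both the parts of a signed measure and \<open>lborel\<close>.\<close>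

lemma conv_fubini:
  fixes \<psi> f :: "real^'n::finite \<Rightarrow> real"
  assumes M: "sigma_finite_measure M" "sets M = sets borel" and f: "integrable M f" and hs: "csms hs"
    and \<psi>[measurable]: "\<psi> \<in> borel_measurable borel" and B: "\<And>x. \<bar>\<psi> x\<bar> \<le> B"
  shows "(\<integral>x. \<psi> x * conv M f (tens hs) x \<partial>lborel) = (\<integral>y. f y * conv lborel \<psi> (tens (rf 0 hs)) y \<partial>M)"
    and "integrable lborel (\<lambda>x. \<psi> x * conv M f (tens hs) x)"
    and "integrable M (\<lambda>y. f y * conv lborel \<psi> (tens (rf 0 hs)) y)"
proof -
  interpret M: sigma_finite_measure M by fact
  interpret P: pair_sigma_finite lborel M ..
  interpret Q: pair_sigma_finite M lborel ..
  note [measurable_cong] = M(2)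
  have [measurable]: "f \<in> borel_measurable M" using f by simp
  note tm[measurable] = tens_measurable[OF hs]
  have B0: "0 \<le> B" using B[of undefined] by linarith
  let ?F = "\<lambda>x y. \<psi> x * (f y * tens hs (x - y))"
  have lp: "locint lborel \<psi>" by (intro locint_loc_int loc_int_bounded[OF \<psi> B])
  have iy: "integrable lborel (\<lambda>x. \<psi> x * tens hs (x - y))" for y
    using conv_integrable[OF lp csms_rf[OF hs, of 0], of y] by (simp add: tens_rf)
  have ia: "integrable lborel (\<lambda>x. tens hs (x - y))" for y
    using conv_integrable[OF locint_loc_int[OF loc_int_bounded[of "\<lambda>_. 1" 1]] csms_rf[OF hs, of 0], of y] by (simp add: tens_rf)
  have L: "(\<integral>x. \<bar>tens hs (x - y)\<bar> \<partial>lborel) = L1t hs" for y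
    unfolding L1t_def using integral_lborel_translate[of "\<lambda>x. \<bar>tens hs x\<bar>" "- y"] by simp
  have intQ: "integrable (M \<Otimes>\<^sub>M lborel) (\<lambda>(y, x). ?F x y)"
  proof (rule Q.Fubini_integrable)
    show "AE y in M. integrable lborel (\<lambda>x. case (y, x) of (y, x) \<Rightarrow> ?F x y)"
    proof (intro always_eventually allI)
      fix y
      show "integrable lborel (\<lambda>x. case (y, x) of (y, x) \<Rightarrow> ?F x y)"
        using integrable_mult_right[OF iy[of y], where c = "f y"] by (simp add: mult_ac)
    qed
    show "integrable M (\<lambda>y. \<integral>x. norm (case (y, x) of (y, x) \<Rightarrow> ?F x y) \<partial>lborel)"
    proof (rule Bochner_Integration.integrable_bound)
      show "integrable M (\<lambda>y. B * L1t hs * \<bar>f y\<bar>)" using f by simp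
      show "AE y in M. norm (\<integral>x. norm (case (y, x) of (y, x) \<Rightarrow> ?F x y) \<partial>lborel) \<le> norm (B * L1t hs * \<bar>f y\<bar>)"
      proof (intro always_eventually allI)
        fix y
        have "(\<integral>x. \<bar>?F x y\<bar> \<partial>lborel) \<le> (\<integral>x. B * \<bar>f y\<bar> * \<bar>tens hs (x - y)\<bar> \<partial>lborel)"
        proof (rule integral_mono)
          show "integrable lborel (\<lambda>x. \<bar>?F x y\<bar>)"
            using integrable_abs[OF integrable_mult_right[OF iy[of y], where c = "f y"]] by (simp add: mult_ac)
          show "integrable lborel (\<lambda>x. B * \<bar>f y\<bar> * \<bar>tens hs (x - y)\<bar>)"
            using ia by (intro integrable_mult_right integrable_abs)
          fix x
          show "\<bar>?F x y\<bar> \<le> B * \<bar>f y\<bar> * \<bar>tens hs (x - y)\<bar>"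
            unfolding abs_mult mult.assoc using B by (intro mult_right_mono) auto
        qed
        also have "\<dots> = B * L1t hs * \<bar>f y\<bar>" by (simp add: L)
        finally show "norm (\<integral>x. norm (case (y, x) of (y, x) \<Rightarrow> ?F x y) \<partial>lborel) \<le> norm (B * L1t hs * \<bar>f y\<bar>)"
          using B0 by (simp add: integral_nonneg_AE L1t_nonneg)
      qed
    qed measurable
  qed measurable
  have int: "integrable (lborel \<Otimes>\<^sub>M M) (\<lambda>(x, y). ?F x y)"
    using Q.integrable_product_swap[OF intQ] by simp
  have in1: "(\<integral>y. ?F x y \<partial>M) = \<psi> x * conv M f (tens hs) x" for x
    unfolding conv_def by simp
  have in2: "(\<integral>x. ?F x y \<partial>lborel) = f y * conv lborel \<psi> (tens (rf 0 hs)) y" for y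
  proof -
    have "(\<integral>x. ?F x y \<partial>lborel) = (\<integral>x. f y * (\<psi> x * tens hs (x - y)) \<partial>lborel)"
      by (intro Bochner_Integration.integral_cong) auto
    then show ?thesis by (simp add: conv_def tens_rf)
  qed
  show "(\<integral>x. \<psi> x * conv M f (tens hs) x \<partial>lborel) = (\<integral>y. f y * conv lborel \<psi> (tens (rf 0 hs)) y \<partial>M)"
    using P.Fubini_integral[OF int] by (simp add: in1 in2 del: integral_mult_right_zero)
  show "integrable lborel (\<lambda>x. \<psi> x * conv M f (tens hs) x)"
    using P.integrable_fst'[OF int] by (simp add: in1 del: integral_mult_right_zero)
  show "integrable M (\<lambda>y. f y * conv lborel \<psi> (tens (rf 0 hs)) y)"
    using P.integrable_snd[OF int] by (simp add: in2 del: integral_mult_right_zero)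
qed

lemma conv_bounded:
  fixes \<psi> :: "real^'n::finite \<Rightarrow> real"
  assumes \<psi>: "\<psi> \<in> borel_measurable borel" "\<And>x. \<bar>\<psi> x\<bar> \<le> B" and hs: "csms hs"
  shows "\<bar>conv lborel \<psi> (tens hs) y\<bar> \<le> B * L1t hs"
proof -
  have i: "integrable lborel (\<lambda>x. \<bar>tens hs (y - x)\<bar>)"
    using integrable_abs[OF tens_integrable[OF csms_rf[OF hs, of y]]] by (simp add: tens_rf)
  have "\<bar>conv lborel \<psi> (tens hs) y\<bar> \<le> (\<integral>x. \<bar>\<psi> x * tens hs (y - x)\<bar> \<partial>lborel)"
    unfolding conv_def by (rule integral_abs_bound)
  also have "\<dots> \<le> (\<integral>x. B * \<bar>tens hs (y - x)\<bar> \<partial>lborel)"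
  proof (rule integral_mono)
    show "integrable lborel (\<lambda>x. \<bar>\<psi> x * tens hs (y - x)\<bar>)"
      by (intro integrable_abs conv_integrable locint_loc_int loc_int_bounded[OF \<psi>] hs)
    show "\<bar>\<psi> x * tens hs (y - x)\<bar> \<le> B * \<bar>tens hs (y - x)\<bar>" for x
      unfolding abs_mult by (intro mult_right_mono \<psi>) auto
  qed (use i in simp)
  also have "\<dots> = B * L1t hs"
    using tens_measurable[OF hs] integral_lborel_reflect[of "\<lambda>x. \<bar>tens hs x\<bar>" y] by (simp add: L1t_def)
  finally show ?thesis .
qed

lemma L1t_rf: "csms hs \<Longrightarrow> L1t (dv b (rf x hs)) = L1t (dv b hs)"
  using integral_lborel_reflect[of "\<lambda>y. \<bar>tens (dv b hs) y\<bar>" x] tens_measurable[OF csms_dv[of hs b]]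
  by (simp add: L1t_def tens_dv_rf abs_mult power_abs)

lemma L1t_dv_scs:
  assumes "csms hs" "d > 0" shows "L1t (dv a (scs d hs)) = L1t (dv a hs) / d ^ mi_abs a"
proof -
  have "L1t (dv a (scs d hs)) = (\<integral>x. \<bar>tens (scs d (dv a hs)) x\<bar> / d ^ mi_abs a \<partial>lborel)"
    unfolding L1t_def using assms by (simp add: tens_dv_scs abs_divide power_abs)
  also have "\<dots> = L1t (scs d (dv a hs)) / d ^ mi_abs a" by (simp add: L1t_def)
  finally show ?thesis using L1t_scs[OF csms_dv[OF assms(1)] assms(2)] by simp
qed

section \<open>Mollified signed measures\<close>

definition Linft :: "('n::finite \<Rightarrow> real \<Rightarrow> real) \<Rightarrow> real" where
  "Linft hs = (SUP x. \<bar>tens hs x\<bar>)"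

lemma Linft: "csms hs \<Longrightarrow> \<bar>tens hs x\<bar> \<le> Linft hs"
  unfolding Linft_def by (rule cSUP_upper) (auto intro!: bdd_aboveI2 elim: tens_bounded[THEN exE] simp: bdd_above_def dest: tens_bounded)

lemma Linft_nonneg: "csms hs \<Longrightarrow> 0 \<le> Linft hs"
  using order_trans[OF abs_ge_zero Linft[of hs undefined]] .

text \<open>This is the convolution of \<mu> with the kernel, a function even when \<mu> has no
  density.\<close>

definition sv :: "(real^'n::finite) smeas \<Rightarrow> ('n \<Rightarrow> real \<Rightarrow> real) \<Rightarrow> real^'n \<Rightarrow> real" where
  "sv \<mu> hs x = sint \<mu> (\<lambda>y. tens hs (x - y))"

lemma sv_conv: "sv \<mu> hs x = conv (fst \<mu>) (\<lambda>_. 1) (tens hs) x - conv (snd \<mu>) (\<lambda>_. 1) (tens hs) x"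
  by (simp add: sv_def sint_def conv_def)

lemma fsmD:
  assumes "\<mu> \<in> fsm"
  shows "finite_measure (fst \<mu>)" "finite_measure (snd \<mu>)" "sets (fst \<mu>) = sets borel" "sets (snd \<mu>) = sets borel"
  using assms by (simp_all add: fsm_def case_prod_beta)

lemma sv_locint: "\<mu> \<in> fsm \<Longrightarrow> locint (fst \<mu>) (\<lambda>_. 1)" "\<mu> \<in> fsm \<Longrightarrow> locint (snd \<mu>) (\<lambda>_. 1)"
  using locint_finite fsmD by blast+

lemma sv_continuous: "\<mu> \<in> fsm \<Longrightarrow> csms hs \<Longrightarrow> continuous_on UNIV (sv \<mu> hs)"
  unfolding sv_conv[abs_def] by (intro continuous_intros smooth_continuous smooth_conv sv_locint)

lemma sv_measurable: "\<mu> \<in> fsm \<Longrightarrow> csms hs \<Longrightarrow> sv \<mu> hs \<in> borel_measurable borel"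
  by (rule borel_measurable_continuous_onI[OF sv_continuous])

lemma sv_fubini:
  assumes \<mu>: "\<mu> \<in> fsm" and hs: "csms hs" and \<psi>: "\<psi> \<in> borel_measurable borel" "\<And>x. \<bar>\<psi> x\<bar> \<le> B"
  shows "integrable lborel (\<lambda>x. \<psi> x * sv \<mu> hs x)"
    and "(\<integral>x. \<psi> x * sv \<mu> hs x \<partial>lborel) = sint \<mu> (conv lborel \<psi> (tens (rf 0 hs)))"
proof -
  have fin: "sigma_finite_measure (fst \<mu>)" "sigma_finite_measure (snd \<mu>)"
    "integrable (fst \<mu>) (\<lambda>_. 1::real)" "integrable (snd \<mu>) (\<lambda>_. 1::real)"
    using fsmD[OF \<mu>] finite_measure.axioms(1) finite_measure.integrable_const by blast+
  note 1 = conv_fubini[OF fin(1) fsmD(3)[OF \<mu>] fin(3) hs \<psi>] and 2 = conv_fubini[OF fin(2) fsmD(4)[OF \<mu>] fin(4) hs \<psi>]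
  show "integrable lborel (\<lambda>x. \<psi> x * sv \<mu> hs x)"
    unfolding sv_conv right_diff_distrib using 1(2) 2(2) by simp
  show "(\<integral>x. \<psi> x * sv \<mu> hs x \<partial>lborel) = sint \<mu> (conv lborel \<psi> (tens (rf 0 hs)))"
    unfolding sv_conv right_diff_distrib using 1 2 by (simp add: sint_def)
qed

text \<open>At most k derivatives come from the test norm and q from \<open>a\<close>, whence
  d^-(k+q) for d \<le> 1. The sup norm is tested by the kernel itself and carries a further d^(-n),
  with n the dimension; the L^1 norm does not. The quotient of the two bounds is the R of
  \<open>orlicz_L1_Linf\<close>.\<close>

lemma orlicz_sv_diff:
  fixes \<mu> \<nu> :: "(real^'n::finite) smeas"
  assumes e: "young e" and \<mu>: "\<mu> \<in> fsm" and \<nu>: "\<nu> \<in> fsm" and hs: "csms hs" and d: "0 < d" "d \<le> 1"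
    and a: "mi_abs a \<le> q"
    and C: "0 < C" "(\<Sum>b\<in>mi_upto k. L1t (dv (\<lambda>i. b i + a i) hs)) \<le> C"
      "(\<Sum>b\<in>mi_upto k. Linft (dv (\<lambda>i. b i + a i) hs)) \<le> C"
  shows "orlicz e (\<lambda>x. sv \<mu> (dv a (scs d hs)) x - sv \<nu> (dv a (scs d hs)) x)
     \<le> ennreal (C * (1 / d ^ (k + q)) * beta e (1 / d ^ CARD('n))) * dk k \<mu> \<nu>"
proof (cases "dk k \<mu> \<nu> = \<infinity>")
  case True
  let ?X = "C * (1 / d ^ (k + q)) * beta e (1 / d ^ CARD('n))"
  have "0 < ?X" using C d by (intro mult_pos_pos beta_pos[OF e]) auto
  then have "ennreal ?X \<noteq> 0" by (metis ennreal_eq_0_iff not_le)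
  then have "ennreal ?X * dk k \<mu> \<nu> = top"
    by (simp only: True infinity_ennreal_def ennreal_mult_top if_False)
  then show ?thesis by (simp only: top_greatest)
next
  case False
  let ?hs = "dv a (scs d hs)"
  have hs': "csms ?hs" by (intro csms_dv csms_scs d hs)
  let ?u = "\<lambda>x. sv \<mu> ?hs x - sv \<nu> ?hs x"
  obtain D where D: "dk k \<mu> \<nu> = ennreal D" "0 \<le> D" using False by (cases "dk k \<mu> \<nu>") auto
  let ?C = "C * (1 / d ^ (k + q))"
  have C': "?C > 0" using C d by simp
  have um: "?u \<in> borel_measurable borel" by (intro borel_measurable_diff sv_measurable \<mu> \<nu> hs')
  have dpow: "1 / d ^ mi_abs (\<lambda>i. b i + a i) \<le> 1 / d ^ (k + q)" if "b \<in> mi_upto k" for b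
  proof -
    have "d ^ (k + q) \<le> d ^ mi_abs (\<lambda>i. b i + a i)"
      using that a d by (intro power_decreasing) (auto simp: mi_abs_add mi_upto_def)
    then show ?thesis using d by (intro divide_left_mono) auto
  qed
  have dvb: "dv b ?hs = dv (\<lambda>i. b i + a i) (scs d hs)" for b by (rule dv_dv)
  have sup: "\<bar>?u x\<bar> \<le> ?C * D * (1 / d ^ CARD('n))" for x
  proof -
    \<comment> \<open>The value at x is the pairing with the reflected kernel centred at x, which is
      itself a test function.\<close>
    have "ennreal \<bar>sint \<mu> (tens (rf x ?hs)) - sint \<nu> (tens (rf x ?hs))\<bar> \<le> ennreal (?C * (1 / d ^ CARD('n))) * dk k \<mu> \<nu>"
    proof (rule dk_test_bound[where c = "\<lambda>b. Linft (dv (\<lambda>i. b i + a i) hs) * (1 / d ^ (k + q)) * (1 / d ^ CARD('n))"])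
      show "smooth (tens (rf x ?hs))" by (intro smooth_tens csms_rf hs')
      fix b :: "'n \<Rightarrow> nat" and y assume b: "b \<in> mi_upto k"
      have "\<bar>Dm b (tens (rf x ?hs)) y\<bar> = \<bar>tens (dv (\<lambda>i. b i + a i) (scs d hs)) (x - y)\<bar>"
        by (simp add: Dm_tens csms_rf hs' tens_dv_rf dvb abs_mult power_abs)
      also have "\<dots> = \<bar>tens (dv (\<lambda>i. b i + a i) hs) (inverse d *\<^sub>R (x - y))\<bar> * (1 / d ^ mi_abs (\<lambda>i. b i + a i)) * (1 / d ^ CARD('n))"
        using d by (simp add: tens_dv_scs hs tens_scs abs_divide power_abs)
      also have "\<dots> \<le> Linft (dv (\<lambda>i. b i + a i) hs) * (1 / d ^ (k + q)) * (1 / d ^ CARD('n))"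
        using d by (intro mult_right_mono mult_mono Linft dpow[OF b] csms_dv hs Linft_nonneg) auto
      finally show "\<bar>Dm b (tens (rf x ?hs)) y\<bar> \<le> Linft (dv (\<lambda>i. b i + a i) hs) * (1 / d ^ (k + q)) * (1 / d ^ CARD('n))" .
    next
      show "(\<Sum>b\<in>mi_upto k. Linft (dv (\<lambda>i. b i + a i) hs) * (1 / d ^ (k + q)) * (1 / d ^ CARD('n))) \<le> ?C * (1 / d ^ CARD('n))"
        unfolding sum_distrib_right[symmetric] using C d by (intro mult_right_mono) auto
      show "0 < ?C * (1 / d ^ CARD('n))" using d by (intro mult_pos_pos[OF C']) simp
    qed
    moreover have P: "0 < ?C * (1 / d ^ CARD('n))" using d by (intro mult_pos_pos[OF C']) simp
    moreover have "ennreal (?C * (1 / d ^ CARD('n))) * dk k \<mu> \<nu> = ennreal (?C * (1 / d ^ CARD('n)) * D)"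
      unfolding D(1) by (rule ennreal_mult[symmetric, OF less_imp_le[OF P] D(2)])
    ultimately have "ennreal \<bar>sint \<mu> (tens (rf x ?hs)) - sint \<nu> (tens (rf x ?hs))\<bar> \<le> ennreal (?C * (1 / d ^ CARD('n)) * D)"
      by (simp only:)
    moreover have "0 \<le> ?C * (1 / d ^ CARD('n)) * D" by (rule mult_nonneg_nonneg[OF less_imp_le[OF P] D(2)])
    ultimately have "\<bar>sint \<mu> (tens (rf x ?hs)) - sint \<nu> (tens (rf x ?hs))\<bar> \<le> ?C * (1 / d ^ CARD('n)) * D"
      by (simp only: ennreal_le_iff)
    then show ?thesis by (simp add: sv_def tens_rf[abs_def] mult_ac)
  qed
  have L1: "(\<integral>\<^sup>+x. ennreal \<bar>?u x\<bar> \<partial>lborel) \<le> ennreal (?C * D)"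
  proof -
    let ?\<psi> = "\<lambda>x. sgn (?u x)" \<comment> \<open>the \<open>L\<^sup>1\<close> norm by duality: \<open>\<integral>\<bar>u\<bar> = \<integral>\<psi>u\<close>, and \<open>\<psi>\<close> convolved with the kernel is a test function for \<open>dk\<close>\<close>
    have p: "?\<psi> \<in> borel_measurable borel" "\<bar>?\<psi> x\<bar> \<le> 1" for x
      using measurable_compose[OF um borel_measurable_sgn] by (simp_all add: abs_sgn_eq)
    note f1 = sv_fubini[OF \<mu> hs' p] and f2 = sv_fubini[OF \<nu> hs' p]
    let ?\<Phi> = "conv lborel ?\<psi> (tens (rf 0 ?hs))"
    have lp: "locint lborel ?\<psi>" by (intro locint_loc_int loc_int_bounded[OF p])
    have abs: "\<bar>?u x\<bar> = ?\<psi> x * sv \<mu> ?hs x - ?\<psi> x * sv \<nu> ?hs x" for x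
      by (simp add: abs_sgn algebra_simps)
    have iu: "integrable lborel (\<lambda>x. \<bar>?u x\<bar>)"
      unfolding abs by (rule Bochner_Integration.integrable_diff[OF f1(1) f2(1)])
    have "(\<integral>\<^sup>+x. ennreal \<bar>?u x\<bar> \<partial>lborel) = ennreal (\<integral>x. \<bar>?u x\<bar> \<partial>lborel)"
      by (rule nn_integral_eq_integral[OF iu]) simp
    also have "(\<integral>x. \<bar>?u x\<bar> \<partial>lborel) = sint \<mu> ?\<Phi> - sint \<nu> ?\<Phi>"
      unfolding abs Bochner_Integration.integral_diff[OF f1(1) f2(1)] f1(2) f2(2) ..
    also have "ennreal \<dots> \<le> ennreal \<bar>\<dots>\<bar>" by (intro ennreal_leI) simp
    also have "\<dots> \<le> ennreal ?C * dk k \<mu> \<nu>"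
    proof (rule dk_test_bound[where c = "\<lambda>b. L1t (dv (\<lambda>i. b i + a i) hs) * (1 / d ^ (k + q))"])
      show "smooth ?\<Phi>" by (intro smooth_conv lp csms_rf hs')
      fix b :: "'n \<Rightarrow> nat" and y assume b: "b \<in> mi_upto k"
      have "\<bar>Dm b ?\<Phi> y\<bar> \<le> 1 * L1t (dv b (rf 0 ?hs))"
        unfolding Dm_conv[OF lp csms_rf[OF hs']] by (intro conv_bounded p csms_dv csms_rf hs')
      also have "\<dots> = L1t (dv (\<lambda>i. b i + a i) hs) * (1 / d ^ mi_abs (\<lambda>i. b i + a i))"
        by (simp add: L1t_rf hs' dvb L1t_dv_scs hs d)
      also have "\<dots> \<le> L1t (dv (\<lambda>i. b i + a i) hs) * (1 / d ^ (k + q))"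
        by (intro mult_left_mono dpow[OF b] L1t_nonneg)
      finally show "\<bar>Dm b ?\<Phi> y\<bar> \<le> L1t (dv (\<lambda>i. b i + a i) hs) * (1 / d ^ (k + q))" .
    next
      show "(\<Sum>b\<in>mi_upto k. L1t (dv (\<lambda>i. b i + a i) hs) * (1 / d ^ (k + q))) \<le> ?C"
        unfolding sum_distrib_right[symmetric] using C d by (intro mult_right_mono) auto
    qed (use C' in auto)
    finally show ?thesis unfolding D(1) ennreal_mult[OF less_imp_le[OF C'] D(2), symmetric] .
  qed
  have "orlicz e ?u \<le> ennreal (?C * D * beta e (1 / d ^ CARD('n)))"
    by (rule orlicz_L1_Linf[OF e um mult_nonneg_nonneg[OF less_imp_le[OF C'] D(2)] _ L1 sup]) (use d in simp)
  also have "\<dots> = ennreal (?C * beta e (1 / d ^ CARD('n))) * dk k \<mu> \<nu>"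
  proof -
    have P: "0 \<le> ?C * beta e (1 / d ^ CARD('n))"
      using beta_pos[OF e, of "1 / d ^ CARD('n)"] d by (intro mult_nonneg_nonneg less_imp_le[OF C']) simp
    show ?thesis unfolding D(1) ennreal_mult[OF P D(2), symmetric] by (simp only: mult_ac)
  qed
  finally show ?thesis .
qed

text \<open>After a substitution the scale sits in the argument of \<psi> and the kernel is fixed,
  so B times its modulus dominates; the limit is \<psi> y because the kernel has integral 1.\<close>

lemma conv_approx_identity:
  fixes \<psi> :: "real^'n::finite \<Rightarrow> real"
  assumes c: "continuous_on UNIV \<psi>" and B: "\<And>x. \<bar>\<psi> x\<bar> \<le> B" and H: "csm H" "(\<integral>t. H t \<partial>lborel) = 1"
    and d: "\<And>n. d n > 0" "d \<longlonglongrightarrow> 0"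
  shows "(\<lambda>n. conv lborel \<psi> (tens (rf 0 (scs (d n) (\<lambda>_. H)))) y) \<longlonglongrightarrow> \<psi> y"
proof -
  let ?H = "\<lambda>_::'n. H"
  have hs: "csms ?H" using H by simp
  have \<psi>m[measurable]: "\<psi> \<in> borel_measurable borel" by (rule borel_measurable_continuous_onI[OF c])
  note tm[measurable] = tens_measurable[OF hs]
  have eq: "conv lborel \<psi> (tens (rf 0 (scs (d n) ?H))) y = (\<integral>w. \<psi> (y + d n *\<^sub>R w) * tens ?H w \<partial>lborel)" for n
  proof -
    have "conv lborel \<psi> (tens (rf 0 (scs (d n) ?H))) y = (\<integral>x. \<psi> x * tens (scs (d n) ?H) (x - y) \<partial>lborel)"
      by (simp add: conv_def tens_rf)
    also have "\<dots> = (\<integral>z. \<psi> (y + z) * tens (scs (d n) ?H) z \<partial>lborel)"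
      using integral_lborel_translate[of "\<lambda>x. \<psi> x * tens (scs (d n) ?H) (x - y)" y]
        tens_measurable[OF csms_scs[OF d(1)[of n] hs]] by simp
    also have "\<dots> = (\<integral>z. (\<lambda>w. \<psi> (y + d n *\<^sub>R w) * tens ?H w) (inverse (d n) *\<^sub>R z) / d n ^ CARD('n) \<partial>lborel)"
      using d(1)[of n] by (simp add: tens_scs)
    also have "\<dots> = (\<integral>w. \<psi> (y + d n *\<^sub>R w) * tens ?H w \<partial>lborel)"
      by (rule integral_scale[OF d(1)]) measurable
    finally show ?thesis .
  qed
  have "(\<lambda>n. \<integral>w. \<psi> (y + d n *\<^sub>R w) * tens ?H w \<partial>lborel) \<longlonglongrightarrow> (\<integral>w. \<psi> y * tens ?H w \<partial>lborel)"
  proof (rule integral_dominated_convergence[where w = "\<lambda>w. B * \<bar>tens ?H w\<bar>"])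
    show "integrable lborel (\<lambda>w. B * \<bar>tens ?H w\<bar>)" by (intro integrable_mult_right integrable_abs tens_integrable hs)
    show "AE w in lborel. (\<lambda>n. \<psi> (y + d n *\<^sub>R w) * tens ?H w) \<longlonglongrightarrow> \<psi> y * tens ?H w"
    proof (intro always_eventually allI tendsto_mult tendsto_const)
      fix w
      have "(\<lambda>n. y + d n *\<^sub>R w) \<longlonglongrightarrow> y + 0 *\<^sub>R w" by (intro tendsto_intros d)
      then show "(\<lambda>n. \<psi> (y + d n *\<^sub>R w)) \<longlonglongrightarrow> \<psi> y"
        by (intro continuous_on_tendsto_compose[OF c]) auto
    qed
    show "AE w in lborel. norm (\<psi> (y + d n *\<^sub>R w) * tens ?H w) \<le> B * \<bar>tens ?H w\<bar>" for n
      by (intro always_eventually allI) (simp add: abs_mult B mult_right_mono)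
  qed measurable
  moreover have "(\<integral>w. \<psi> y * tens ?H w \<partial>lborel) = \<psi> y"
    unfolding integral_mult_right_zero integral_tens[OF hs] by (simp add: H)
  ultimately show ?thesis by (simp only: eq)
qed

text \<open>The series of absolute increments is locally integrable because the Orlicz norm controls
  L^1 on balls. Hence it is finite almost everywhere and dominates all \<open>u n\<close> at once,
  so limits pass through integrals against bounded functions of bounded support. Weak derivatives
  and densities are both tested by such functions.\<close>

lemma orlicz_telescope_limit:
  fixes u :: "nat \<Rightarrow> real^'n::finite \<Rightarrow> real"
  assumes e: "young e" and um[measurable]: "\<And>n. u n \<in> borel_measurable borel"
    and u0: "orlicz e (u 0) < \<infinity>" and sm: "(\<Sum>n. orlicz e (\<lambda>x. u (Suc n) x - u n x)) < \<infinity>"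
  shows "\<exists>g. loc_int g \<and> orlicz e g < \<infinity> \<and>
    (\<forall>\<eta> r B. \<eta> \<in> borel_measurable borel \<longrightarrow> (\<forall>x. r < norm x \<longrightarrow> \<eta> x = 0) \<longrightarrow> (\<forall>x. \<bar>\<eta> x\<bar> \<le> B) \<longrightarrow>
        (\<lambda>n. \<integral>x. u n x * \<eta> x \<partial>lborel) \<longlonglongrightarrow> (\<integral>x. g x * \<eta> x \<partial>lborel))"
proof -
  \<comment> \<open>The zeroth increment is \<open>u 0\<close> itself, so that the first n + 1
    increments sum to \<open>u n\<close>.\<close>
  define v where "v n x = (if n = 0 then u 0 x else u n x - u (n - 1) x)" for n x
  have vm[measurable]: "v n \<in> borel_measurable borel" for n unfolding v_def[abs_def] by (cases n) simp_all
  have tel: "(\<Sum>i<Suc n. v i x) = u n x" for n x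
    by (induction n) (simp_all add: v_def)
  define S where "S x = (\<Sum>n. ennreal \<bar>v n x\<bar>)" for x
  have Sm[measurable]: "S \<in> borel_measurable borel" unfolding S_def[abs_def] by measurable
  have "(\<Sum>n. orlicz e (v n)) = orlicz e (v 0) + (\<Sum>n. orlicz e (v (Suc n)))"
    using sums_Suc[OF summable_sums[OF summableI], of "\<lambda>n. orlicz e (v n)"] by (simp add: sums_iff add.commute)
  also have "v 0 = u 0" by (simp add: v_def fun_eq_iff)
  also have "(\<lambda>n. v (Suc n)) = (\<lambda>n x. u (Suc n) x - u n x)" by (simp add: v_def fun_eq_iff)
  finally have fin: "(\<Sum>n. orlicz e (v n)) < \<infinity>" using u0 sm by (simp add: fun_eq_iff)
  have loc: "(\<integral>\<^sup>+x. indicator (cball 0 r) x * S x \<partial>lborel) < \<infinity>" for r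
  proof -
    let ?w = "indicator (cball 0 r) :: real^'n \<Rightarrow> real"
    let ?K = "(\<integral>\<^sup>+x. ennreal (?w x) \<partial>lborel) + ennreal (1 / e 1)"
    have wf: "(\<integral>\<^sup>+x. ennreal (?w x) \<partial>lborel) < \<infinity>"
      using emeasure_bounded_finite[of "cball 0 r"] by (simp add: ennreal_indicator)
    have "(\<integral>\<^sup>+x. indicator (cball 0 r) x * S x \<partial>lborel) = (\<integral>\<^sup>+x. (\<Sum>n. ennreal (?w x * \<bar>v n x\<bar>)) \<partial>lborel)"
    proof (intro nn_integral_cong)
      fix x show "indicator (cball 0 r) x * S x = (\<Sum>n. ennreal (?w x * \<bar>v n x\<bar>))"
        by (cases "x \<in> cball 0 r") (simp_all add: S_def)
    qed
    also have "\<dots> = (\<Sum>n. \<integral>\<^sup>+x. ennreal (?w x * \<bar>v n x\<bar>) \<partial>lborel)"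
    proof (rule nn_integral_suminf)
      fix n
      have "(\<lambda>x. ennreal (?w x * \<bar>v n x\<bar>)) \<in> borel_measurable borel"
        by (intro measurable_compose[OF _ measurable_ennreal] borel_measurable_times borel_measurable_indicator borel_measurable_abs vm) auto
      then show "(\<lambda>x. ennreal (?w x * \<bar>v n x\<bar>)) \<in> borel_measurable lborel" by simp
    qed
    also have "\<dots> \<le> (\<Sum>n. ?K * orlicz e (v n))"
      by (intro suminf_le summableI weighted_L1_le_orlicz[OF e] wf) (auto simp: indicator_def)
    also have "\<dots> = ?K * (\<Sum>n. orlicz e (v n))" by (rule ennreal_suminf_cmult)
    also have "\<dots> < \<infinity>" using fin wf by (simp add: ennreal_mult_less_top)
    finally show ?thesis .
  qed
  have Sfin: "AE x in lborel. S x < \<infinity>"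
  proof -
    have [measurable]: "(\<lambda>x. indicator (cball 0 r) x * S x) \<in> borel_measurable borel" for r
      by (intro borel_measurable_times_ennreal Sm borel_measurable_indicator) auto
    have "AE x in lborel. \<forall>n::nat. indicator (cball 0 (real n)) x * S x \<noteq> \<infinity>"
      unfolding AE_all_countable using loc by (intro allI nn_integral_noteq_infinite) (auto simp: less_top)
    then show ?thesis
    proof eventually_elim
      case (elim x)
      obtain n :: nat where "norm x \<le> real n" using real_arch_simple by blast
      then show ?case using elim[rule_format, of n] by (simp add: less_top)
    qed
  qed
  define s where "s x = enn2real (S x)" for x
  \<comment> \<open>Where the series diverges \<open>suminf\<close> has some arbitrary value, but by
    \<open>Sfin\<close> this happens only on a null set.\<close>
  define g where "g x = (\<Sum>n. v n x)" for x
  have gm[measurable]: "g \<in> borel_measurable borel" unfolding g_def[abs_def] by measurable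
  have s_meas[measurable]: "s \<in> borel_measurable borel" unfolding s_def[abs_def] by measurable
  have pw: "AE x in lborel. (\<lambda>n. u n x) \<longlonglongrightarrow> g x \<and> \<bar>g x\<bar> \<le> s x \<and> (\<forall>n. \<bar>u n x\<bar> \<le> s x) \<and> ennreal \<bar>g x\<bar> \<le> S x"
    using Sfin
  proof eventually_elim
    case (elim x)
    have sum: "summable (\<lambda>n. \<bar>v n x\<bar>)"
      using elim unfolding S_def by (intro summable_suminf_not_top) (auto simp: less_top)
    have Sx: "S x = ennreal (\<Sum>n. \<bar>v n x\<bar>)" unfolding S_def by (rule suminf_ennreal2[OF _ sum]) simp
    have sx: "s x = (\<Sum>n. \<bar>v n x\<bar>)" unfolding s_def Sx by (simp add: suminf_nonneg[OF sum])
    have "summable (\<lambda>n. v n x)" by (rule summable_rabs_cancel[OF sum])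
    then have "(\<lambda>n. \<Sum>i<n. v i x) \<longlonglongrightarrow> g x" unfolding g_def by (rule summable_LIMSEQ)
    then have 1: "(\<lambda>n. u n x) \<longlonglongrightarrow> g x" unfolding tel[symmetric] by (rule LIMSEQ_Suc)
    have 2: "\<bar>g x\<bar> \<le> s x" unfolding sx g_def by (rule summable_rabs[OF sum])
    have "\<bar>u n x\<bar> \<le> s x" for n
    proof -
      have "\<bar>u n x\<bar> \<le> (\<Sum>i<Suc n. \<bar>v i x\<bar>)" unfolding tel[symmetric] by (rule sum_abs)
      also have "\<dots> \<le> s x" unfolding sx by (rule sum_le_suminf[OF sum]) auto
      finally show ?thesis .
    qed
    then show ?case using 1 2 by (simp add: Sx sx[symmetric] ennreal_leI)
  qed
  have s_loc: "integrable lborel (\<lambda>x. indicator (cball 0 r) x * s x)" for r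
  proof (subst integrable_iff_bounded, intro conjI)
    have "(\<integral>\<^sup>+x. ennreal (norm (indicator (cball 0 r) x * s x)) \<partial>lborel) \<le> (\<integral>\<^sup>+x. indicator (cball 0 r) x * S x \<partial>lborel)"
    proof (intro nn_integral_mono)
      fix x
      have "ennreal (s x) \<le> S x" by (simp add: s_def ennreal_enn2real_if)
      moreover have "0 \<le> s x" by (simp add: s_def)
      ultimately show "ennreal (norm (indicator (cball 0 r) x * s x)) \<le> indicator (cball 0 r) x * S x"
        by (cases "x \<in> cball 0 r") simp_all
    qed
    then show "(\<integral>\<^sup>+x. ennreal (norm (indicator (cball 0 r) x * s x)) \<partial>lborel) < \<infinity>" using loc order_le_less_trans by blast
    have "(\<lambda>x. indicator (cball 0 r) x * s x) \<in> borel_measurable borel"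
      by (intro borel_measurable_times borel_measurable_indicator s_meas) auto
    then show "(\<lambda>x. indicator (cball 0 r) x * s x) \<in> borel_measurable lborel" by simp
  qed
  have "loc_int g"
    unfolding loc_int_def set_integrable_def
  proof (intro conjI allI impI)
    show "g \<in> borel_measurable lborel" by simp
    fix K :: "(real^'n) set" assume K: "compact K"
    then have [measurable]: "K \<in> sets borel" using borel_compact by blast
    obtain r where "\<And>x. x \<in> K \<Longrightarrow> norm x \<le> r" using compact_imp_bounded[OF K] by (auto simp: bounded_iff)
    then have r: "K \<subseteq> cball 0 r" by auto
    show "integrable lborel (\<lambda>x. indicator K x *\<^sub>R g x)"
    proof (rule Bochner_Integration.integrable_bound[OF s_loc[of r]])
      show "AE x in lborel. norm (indicator K x *\<^sub>R g x) \<le> norm (indicator (cball 0 r) x * s x)"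
        using pw by eventually_elim (use r in \<open>auto simp: indicator_def\<close>)
    qed measurable
  qed
  moreover have "orlicz e g < \<infinity>"
  proof -
    have "orlicz e g \<le> (\<Sum>n. orlicz e (v n))"
      by (rule orlicz_suminf[OF e vm]) (use pw in \<open>auto simp: S_def elim!: eventually_mono\<close>)
    then show ?thesis using fin by (rule order_le_less_trans)
  qed
  moreover have "(\<lambda>n. \<integral>x. u n x * \<eta> x \<partial>lborel) \<longlonglongrightarrow> (\<integral>x. g x * \<eta> x \<partial>lborel)"
    if [measurable]: "\<eta> \<in> borel_measurable borel" and r: "\<And>x. r < norm x \<Longrightarrow> \<eta> x = 0" and B: "\<And>x. \<bar>\<eta> x\<bar> \<le> B" for \<eta> r B
  proof (rule integral_dominated_convergence[where w = "\<lambda>x. B * (indicator (cball 0 r) x * s x)"])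
    show "integrable lborel (\<lambda>x. B * (indicator (cball 0 r) x * s x))" using s_loc by (rule integrable_mult_right)
    show "AE x in lborel. (\<lambda>n. u n x * \<eta> x) \<longlonglongrightarrow> g x * \<eta> x"
      using pw by eventually_elim (auto intro: tendsto_mult)
    show "AE x in lborel. norm (u n x * \<eta> x) \<le> B * (indicator (cball 0 r) x * s x)" for n
      using pw
    proof eventually_elim
      case (elim x)
      show ?case
      proof (cases "norm x \<le> r")
        case True
        have "\<bar>u n x\<bar> * \<bar>\<eta> x\<bar> \<le> s x * B" using elim B[of x] by (intro mult_mono) auto
        then show ?thesis using True by (simp add: abs_mult mult.commute)
      qed (use r in auto)
    qed
  qed measurable
  ultimately show ?thesis by (intro exI[of _ g]) blast
qed

subsection \<open>Densities of the measures in the interpolation space\<close>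

lemma xpow_0: "xpow (\<lambda>_. 0) x = 1"
  by (simp add: xpow_def)

lemma wsobD:
  assumes "wsob K l e f < \<infinity>" "a \<in> mi_upto K"
  shows "weak_deriv a f (wd a f)" "orlicz e (wd a f) \<le> wsob K l e f"
proof -
  have ex: "\<forall>a \<in> mi_upto K. \<exists>g. weak_deriv a f g"
    using assms(1) unfolding wsob_def by (auto split: if_splits)
  then show "weak_deriv a f (wd a f)" using assms(2) weak_deriv_wd by blast
  let ?F = "\<lambda>g a. orlicz e (\<lambda>x. xpow g x * wd a f x)"
  have "orlicz e (wd a f) = ?F (\<lambda>_. 0) a" by (simp add: xpow_0)
  also have "\<dots> \<le> (\<Sum>a\<in>mi_upto K. ?F (\<lambda>_. 0) a)"
    by (rule member_le_sum[OF assms(2)]) (auto simp: finite_mi_upto)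
  also have "\<dots> \<le> (\<Sum>g\<in>mi_upto l. \<Sum>a\<in>mi_upto K. ?F g a)"
    by (rule member_le_sum[OF mi_upto_0]) (auto simp: finite_mi_upto)
  also have "\<dots> = wsob K l e f" using ex by (simp add: wsob_def)
  finally show "orlicz e (wd a f) \<le> wsob K l e f" .
qed

lemma conv_continuous: "locint M f \<Longrightarrow> csms hs \<Longrightarrow> continuous_on UNIV (conv M f (tens hs))"
  by (intro smooth_continuous smooth_conv)

lemma conv_measurable: "locint M f \<Longrightarrow> csms hs \<Longrightarrow> conv M f (tens hs) \<in> borel_measurable borel"
  by (intro borel_measurable_continuous_onI conv_continuous)

lemma orlicz_conv:
  assumes "young e" "loc_int f" "csms hs" "B > 0" "L1t hs \<le> B"
  shows "orlicz e (conv lborel f (tens hs)) \<le> ennreal B * orlicz e f"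
proof -
  have "orlicz e (conv lborel f (tens hs)) \<le> orlicz e (\<lambda>x. \<integral>y. \<bar>f y\<bar> * \<bar>tens hs (x - y)\<bar> \<partial>lborel)"
  proof (rule orlicz_mono[OF assms(1)], intro always_eventually allI)
    fix x
    have "\<bar>conv lborel f (tens hs) x\<bar> \<le> (\<integral>y. \<bar>f y * tens hs (x - y)\<bar> \<partial>lborel)"
      unfolding conv_def by (rule integral_abs_bound)
    then show "\<bar>conv lborel f (tens hs) x\<bar> \<le> \<bar>\<integral>y. \<bar>f y\<bar> * \<bar>tens hs (x - y)\<bar> \<partial>lborel\<bar>"
      by (simp add: abs_mult)
  qed
  also have "\<dots> \<le> ennreal B * orlicz e f" by (rule orlicz_convolution) fact+
  finally show ?thesis .
qed

lemma sv_density: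
  assumes "\<nu> \<in> Ma" "csms hs"
  shows "sv \<nu> hs x = conv lborel (pdens \<nu>) (tens hs) x"
proof -
  obtain B where B: "\<And>y. \<bar>tens hs y\<bar> \<le> B" using tens_bounded[OF assms(2)] by blast
  have fsm: "\<nu> \<in> fsm" using assms(1) by (simp add: Ma_def)
  have m: "(\<lambda>y. tens hs (x - y)) \<in> borel_measurable borel"
    using tens_measurable[OF csms_rf[OF assms(2), of x]] by (simp add: tens_rf[abs_def])
  show ?thesis
    unfolding sv_def conv_def by (rule sint_density[OF fsm is_density_pdens[OF assms(1)] m B])
qed

lemma pdens_loc_int: "\<nu> \<in> Ma \<Longrightarrow> loc_int (pdens \<nu>)"
  using is_density_pdens is_density_def loc_int_integrable by blast

lemma conv_kernel_diff:
  fixes \<Gamma> :: "nat \<Rightarrow> 'n::finite \<Rightarrow> real \<Rightarrow> real" and p :: "real^'n \<Rightarrow> real"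
  assumes ks: "kernel_system N H \<Gamma> dir"
    and d: "\<delta> > 0" and p: "loc_int p"
  shows "conv lborel p (tens (dv a (scs (\<delta>/2) (\<lambda>_. H)))) x - conv lborel p (tens (dv a (scs \<delta> (\<lambda>_. H)))) x
     = \<delta> ^ N * (\<Sum>j<CARD('n). conv lborel p (tens (dv (\<lambda>i. a i + (if i = dir j then N else 0)) (scs \<delta> (\<Gamma> j)))) x)"
proof -
  have lp: "locint lborel p" by (rule locint_loc_int[OF p])
  note H = kernel_systemD(1)[OF ks] and \<Gamma> = kernel_systemD(3)[OF ks] and tel = kernel_systemD(4)[OF ks]
  have c: "csms (dv a (scs (\<delta>/2) (\<lambda>_::'n. H)))" "csms (dv a (scs \<delta> (\<lambda>_::'n. H)))"
    "\<And>b j. csms (dv b (scs \<delta> (\<Gamma> j)))"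
    using H \<Gamma> d by (auto intro!: csms_dv[rule_format] csms_scs[rule_format])
  note i = conv_integrable[OF lp c(1)] conv_integrable[OF lp c(2)] conv_integrable[OF lp c(3)]
  have "conv lborel p (tens (dv a (scs (\<delta>/2) (\<lambda>_. H)))) x - conv lborel p (tens (dv a (scs \<delta> (\<lambda>_. H)))) x
    = (\<integral>y. p y * (tens (dv a (scs (\<delta>/2) (\<lambda>_. H))) (x - y) - tens (dv a (scs \<delta> (\<lambda>_. H))) (x - y)) \<partial>lborel)"
    unfolding conv_def right_diff_distrib by (rule Bochner_Integration.integral_diff[symmetric, OF i(1,2)])
  also have "\<dots> = (\<integral>y. (\<Sum>j<CARD('n). \<delta> ^ N * (p y * tens (dv (\<lambda>i. a i + (if i = dir j then N else 0)) (scs \<delta> (\<Gamma> j))) (x - y))) \<partial>lborel)"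
    unfolding tel[OF d] by (intro Bochner_Integration.integral_cong) (auto simp: sum_distrib_left mult_ac)
  also have "\<dots> = (\<Sum>j<CARD('n). \<integral>y. \<delta> ^ N * (p y * tens (dv (\<lambda>i. a i + (if i = dir j then N else 0)) (scs \<delta> (\<Gamma> j))) (x - y)) \<partial>lborel)"
    by (rule Bochner_Integration.integral_sum) (rule integrable_mult_right[OF i(3)])
  finally show ?thesis by (simp add: conv_def sum_distrib_left)
qed

text \<open>The constant is built from the kernels, q and k, and is independent of the measures and
  of \<delta>. This uniformity permits summation over all scales with a different \<nu> at
  each.\<close>

lemma regularisation_step:
  fixes \<Gamma> :: "nat \<Rightarrow> 'n::finite \<Rightarrow> real \<Rightarrow> real"
  assumes e: "young e" and ks: "kernel_system N H \<Gamma> dir"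
  obtains C where "C > 0"
    "\<And>(\<mu> :: (real^'n) smeas) \<nu> \<delta> a. \<mu> \<in> fsm \<Longrightarrow> \<nu> \<in> Ma \<Longrightarrow> 0 < \<delta> \<Longrightarrow> \<delta> \<le> 1 \<Longrightarrow> a \<in> mi_upto q \<Longrightarrow>
      orlicz e (\<lambda>x. sv \<mu> (dv a (scs (\<delta>/2) (\<lambda>_. H))) x - sv \<mu> (dv a (scs \<delta> (\<lambda>_. H))) x)
      \<le> ennreal C * (ennreal (1 / \<delta> ^ (k + q) * beta e (1 / \<delta> ^ CARD('n))) * dk k \<mu> \<nu>
          + ennreal (\<delta> ^ N) * wsob (N + q) l e (pdens \<nu>))"
proof -
  note H = kernel_systemD(1)[OF ks] and \<Gamma> = kernel_systemD(3)[OF ks]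
  \<comment> \<open>\<open>K hs\<close> collects the norms of all kernels that arise from at most q
    and k derivatives; the initial 1 makes it positive.\<close>
  define K where "K hs = 1 + (\<Sum>a\<in>mi_upto q. \<Sum>b\<in>mi_upto k. L1t (dv (\<lambda>i. b i + a i) hs) + Linft (dv (\<lambda>i. b i + a i) hs))"
    for hs :: "'n \<Rightarrow> real \<Rightarrow> real"
  \<comment> \<open>The kernel \<open>H\<close> at scale \<delta>/2 is \<open>h1\<close> at scale
    \<delta>, so both regularisations are estimated at the same scale.\<close>
  define h0 h1 where "h0 = (\<lambda>_::'n. H)" and "h1 = (\<lambda>_::'n. sc (1/2) H)"
  have h01: "csms h0" "csms h1" using H by (auto simp: h0_def h1_def csm_sc)
  have K: "K hs > 0" "a \<in> mi_upto q \<Longrightarrow> (\<Sum>b\<in>mi_upto k. L1t (dv (\<lambda>i. b i + a i) hs)) \<le> K hs"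
      "a \<in> mi_upto q \<Longrightarrow> (\<Sum>b\<in>mi_upto k. Linft (dv (\<lambda>i. b i + a i) hs)) \<le> K hs" if hs: "csms hs" for hs a
  proof -
    have nn: "0 \<le> L1t (dv (\<lambda>i. b i + a i) hs)" "0 \<le> Linft (dv (\<lambda>i. b i + a i) hs)" for a b
      using L1t_nonneg Linft_nonneg[OF csms_dv[OF hs]] by blast+
    have "0 \<le> (\<Sum>a\<in>mi_upto q. \<Sum>b\<in>mi_upto k. L1t (dv (\<lambda>i. b i + a i) hs) + Linft (dv (\<lambda>i. b i + a i) hs))"
      by (intro sum_nonneg add_nonneg_nonneg nn)
    then show "K hs > 0" unfolding K_def by linarith
    assume a: "a \<in> mi_upto q"
    have "(\<Sum>b\<in>mi_upto k. L1t (dv (\<lambda>i. b i + a i) hs) + Linft (dv (\<lambda>i. b i + a i) hs)) \<le> K hs - 1"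
      unfolding K_def add_diff_cancel_left'
      by (rule member_le_sum[OF a]) (auto simp: finite_mi_upto intro!: sum_nonneg add_nonneg_nonneg nn)
    moreover have "0 \<le> (\<Sum>b\<in>mi_upto k. L1t (dv (\<lambda>i. b i + a i) hs))" "0 \<le> (\<Sum>b\<in>mi_upto k. Linft (dv (\<lambda>i. b i + a i) hs))"
      by (intro sum_nonneg nn)+
    ultimately show "(\<Sum>b\<in>mi_upto k. L1t (dv (\<lambda>i. b i + a i) hs)) \<le> K hs" "(\<Sum>b\<in>mi_upto k. Linft (dv (\<lambda>i. b i + a i) hs)) \<le> K hs"
      by (simp_all add: sum.distrib)
  qed
  \<comment> \<open>The summands 1 make G positive; in \<open>ennreal\<close> a zero constant would
    annihilate an infinite Sobolev norm.\<close>
  define G where "G = (\<Sum>j<CARD('n). L1t (\<Gamma> j) + 1)"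
  have G: "G \<ge> 0" unfolding G_def by (intro sum_nonneg add_nonneg_nonneg L1t_nonneg) auto
  define C where "C = K h1 + K h0 + G"
  have C: "C > 0" using K(1)[OF h01(1)] K(1)[OF h01(2)] G by (simp add: C_def)
  have "orlicz e (\<lambda>x. sv \<mu> (dv a (scs (\<delta>/2) (\<lambda>_. H))) x - sv \<mu> (dv a (scs \<delta> (\<lambda>_. H))) x)
      \<le> ennreal C * (ennreal (1 / \<delta> ^ (k + q) * beta e (1 / \<delta> ^ CARD('n))) * dk k \<mu> \<nu>
          + ennreal (\<delta> ^ N) * wsob (N + q) l e (pdens \<nu>))"
    if \<mu>: "\<mu> \<in> fsm" and \<nu>: "\<nu> \<in> Ma" and d: "0 < \<delta>" "\<delta> \<le> 1" and a: "a \<in> mi_upto q" for \<mu> \<nu> :: "(real^'n) smeas" and \<delta> a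
  proof -
    let ?b = "1 / \<delta> ^ (k + q) * beta e (1 / \<delta> ^ CARD('n))"
    let ?D = "ennreal ?b * dk k \<mu> \<nu>" and ?W = "ennreal (\<delta> ^ N) * wsob (N + q) l e (pdens \<nu>)"
    have b0: "0 < ?b" using d by (intro mult_pos_pos beta_pos[OF e]) auto
    have half: "scs (\<delta>/2) h0 = scs \<delta> h1" by (simp add: scs_def[abs_def] h0_def h1_def sc_sc)
    let ?h1 = "dv a (scs \<delta> h1)" and ?h0 = "dv a (scs \<delta> h0)"
    have hs: "csms ?h1" "csms ?h0" by (intro csms_dv csms_scs d h01)+
    have \<nu>f: "\<nu> \<in> fsm" using \<nu> by (simp add: Ma_def)
    have aq: "mi_abs a \<le> q" using a by (simp add: mi_upto_def)
    note meas = sv_measurable[OF \<mu> hs(1)] sv_measurable[OF \<mu> hs(2)] sv_measurable[OF \<nu>f hs(1)] sv_measurable[OF \<nu>f hs(2)]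
    let ?A = "\<lambda>h x. sv \<mu> h x - sv \<nu> h x"
    have A: "orlicz e (?A (dv a (scs \<delta> h))) \<le> ennreal (K h) * ?D" if "csms h" for h
    proof -
      have "orlicz e (?A (dv a (scs \<delta> h))) \<le> ennreal (K h * (1 / \<delta> ^ (k + q)) * beta e (1 / \<delta> ^ CARD('n))) * dk k \<mu> \<nu>"
        by (rule orlicz_sv_diff[OF e \<mu> \<nu>f that d aq K(1)[OF that] K(2)[OF that a] K(3)[OF that a]])
      also have "ennreal (K h * (1 / \<delta> ^ (k + q)) * beta e (1 / \<delta> ^ CARD('n))) = ennreal (K h) * ennreal ?b"
        using K(1)[OF that] b0 by (simp add: ennreal_mult[symmetric] mult.assoc)
      finally show ?thesis by (simp add: mult.assoc)
    qed
    let ?B = "\<lambda>x. sv \<nu> ?h1 x - sv \<nu> ?h0 x"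
    have B: "orlicz e ?B \<le> ennreal G * ?W"
    proof (cases "wsob (N + q) l e (pdens \<nu>) < \<infinity>")
      case False
      show ?thesis
      proof -
        have "G > 0" unfolding G_def
          by (intro sum_pos add_nonneg_pos L1t_nonneg) (auto simp: lessThan_empty_iff)
        then have "ennreal G \<noteq> 0" "ennreal (\<delta> ^ N) \<noteq> 0" using d by auto
        moreover have "wsob (N + q) l e (pdens \<nu>) = top" using False by (simp add: less_top[symmetric])
        ultimately have "ennreal G * ?W = top" by (simp only: ennreal_mult_top if_False)
        then show ?thesis by (simp only: top_greatest)
      qed
    next
      case True
      let ?p = "pdens \<nu>"
      \<comment> \<open>N further derivatives in the direction \<open>dir j\<close> raise the order
        to at most N + q; by \<open>conv_weak_deriv\<close> all of them can be carried by the
        density.\<close>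
      define aj where "aj j = (\<lambda>i. a i + (if i = dir j then N else 0))" for j
      have aj: "aj j \<in> mi_upto (N + q)" for j
        using aq by (simp add: mi_upto_def aj_def mi_abs_add mi_abs_single)
      let ?g = "\<lambda>j x. \<delta> ^ N * conv lborel (wd (aj j) ?p) (tens (scs \<delta> (\<Gamma> j))) x"
      have wdj: "weak_deriv (aj j) ?p (wd (aj j) ?p)" for j by (rule wsobD(1)[OF True aj])
      have wl: "loc_int (wd (aj j) ?p)" for j using wdj weak_deriv_def by blast
      have \<Gamma>': "csms (scs \<delta> (\<Gamma> j))" for j by (intro csms_scs \<Gamma> d)
      have Beq: "?B x = (\<Sum>j<CARD('n). ?g j x)" for x
      proof -
        have "?B x = conv lborel ?p (tens (dv a (scs (\<delta>/2) h0))) x - conv lborel ?p (tens (dv a (scs \<delta> h0))) x"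
          using hs by (simp add: sv_density[OF \<nu>] half)
        also have "\<dots> = \<delta> ^ N * (\<Sum>j<CARD('n). conv lborel ?p (tens (dv (aj j) (scs \<delta> (\<Gamma> j)))) x)"
          unfolding h0_def aj_def by (rule conv_kernel_diff[OF ks d(1) pdens_loc_int[OF \<nu>]])
        also have "\<dots> = (\<Sum>j<CARD('n). ?g j x)"
          unfolding conv_weak_deriv[OF wdj \<Gamma>'] by (rule sum_distrib_left)
        finally show ?thesis .
      qed
      have "orlicz e ?B \<le> (\<Sum>j<CARD('n). orlicz e (?g j))"
      proof (rule orlicz_sum[OF e])
        show "?g j \<in> borel_measurable borel" for j
          by (intro borel_measurable_times borel_measurable_const conv_measurable locint_loc_int wl \<Gamma>')
        show "AE x in lborel. \<bar>?B x\<bar> \<le> (\<Sum>j<CARD('n). \<bar>?g j x\<bar>)"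
          unfolding Beq by (intro always_eventually allI sum_abs)
      qed simp
      also have "\<dots> \<le> (\<Sum>j<CARD('n). ennreal (L1t (\<Gamma> j) + 1) * ?W)"
      proof (rule sum_mono)
        fix j
        have "orlicz e (?g j) \<le> ennreal \<bar>\<delta> ^ N\<bar> * orlicz e (conv lborel (wd (aj j) ?p) (tens (scs \<delta> (\<Gamma> j))))"
          by (rule orlicz_cmult[OF e])
        also have "\<dots> \<le> ennreal \<bar>\<delta> ^ N\<bar> * (ennreal (L1t (\<Gamma> j) + 1) * orlicz e (wd (aj j) ?p))"
        proof (rule mult_left_mono[OF orlicz_conv[OF e wl \<Gamma>']])
          show "0 < L1t (\<Gamma> j) + 1" using L1t_nonneg[of "\<Gamma> j"] by simp
          show "L1t (scs \<delta> (\<Gamma> j)) \<le> L1t (\<Gamma> j) + 1" by (simp add: L1t_scs \<Gamma> d)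
        qed simp
        also have "\<dots> \<le> ennreal \<bar>\<delta> ^ N\<bar> * (ennreal (L1t (\<Gamma> j) + 1) * wsob (N + q) l e ?p)"
          by (intro mult_left_mono wsobD(2)[OF True aj]) auto
        also have "\<dots> = ennreal (L1t (\<Gamma> j) + 1) * ?W" using d by (simp add: mult_ac)
        finally show "orlicz e (?g j) \<le> ennreal (L1t (\<Gamma> j) + 1) * ?W" .
      qed
      also have "\<dots> = ennreal G * ?W"
        unfolding sum_distrib_right[symmetric] G_def using L1t_nonneg
        by (subst sum_ennreal) (auto intro!: add_nonneg_nonneg L1t_nonneg)
      finally show ?thesis .
    qed
    have "orlicz e (\<lambda>x. sv \<mu> ?h1 x - sv \<mu> ?h0 x) \<le> orlicz e (?A ?h1) + orlicz e (\<lambda>x. \<bar>?A ?h0 x\<bar> + \<bar>?B x\<bar>)"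
      by (rule orlicz_add[OF e]) (use meas in \<open>auto intro!: always_eventually\<close>)
    also have "\<dots> \<le> orlicz e (?A ?h1) + (orlicz e (?A ?h0) + orlicz e ?B)"
      by (rule add_left_mono, rule orlicz_add[OF e]) (use meas in \<open>auto intro!: always_eventually\<close>)
    also have "orlicz e (?A ?h1) + (orlicz e (?A ?h0) + orlicz e ?B) \<le> ennreal (K h1) * ?D + (ennreal (K h0) * ?D + ennreal G * ?W)"
      by (intro add_mono A h01 B)
    also have "\<dots> \<le> ennreal (K h1) * (?D + ?W) + (ennreal (K h0) * (?D + ?W) + ennreal G * (?D + ?W))"
      by (intro add_mono mult_left_mono) auto
    also have "\<dots> = ennreal C * (?D + ?W)"
      unfolding C_def using K(1)[OF h01(1)] K(1)[OF h01(2)] G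
      by (simp add: distrib_right[symmetric] add.assoc)
    finally show ?thesis unfolding half[unfolded h0_def] h0_def .
  qed
  then show ?thesis using that[OF C] by blast
qed

lemma cnorm_bound:
  assumes "cnorm k \<phi> \<le> 1" "a \<in> mi_upto k" shows "\<bar>Dm a \<phi> x\<bar> \<le> 1"
proof -
  have "ennreal \<bar>Dm a \<phi> x\<bar> \<le> (SUP x. ennreal \<bar>Dm a \<phi> x\<bar>)" by (rule SUP_upper) simp
  also have "\<dots> \<le> cnorm k \<phi>" unfolding cnorm_def
    by (rule member_le_sum[OF assms(2)]) (auto simp: finite_mi_upto)
  also have "\<dots> \<le> ennreal 1" using assms by simp
  finally show ?thesis by (simp only: ennreal_le_iff zero_le_one)
qed

lemma Dm_0: "Dm (\<lambda>_. 0) \<phi> = \<phi>"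
  by (simp add: Dm_def mi_list_0)

lemma finite_measure_integral_bound:
  fixes u :: "real^'n::finite \<Rightarrow> real"
  assumes M: "finite_measure M" "sets M = sets borel" and u: "u \<in> borel_measurable borel" "\<And>x. \<bar>u x\<bar> \<le> 1"
  shows "\<bar>\<integral>x. u x \<partial>M\<bar> \<le> measure M UNIV"
proof -
  interpret finite_measure M by fact
  have sp: "space M = UNIV" by (rule null_space_UNIV[OF M(2)])
  have "\<bar>\<integral>x. u x \<partial>M\<bar> \<le> (\<integral>x. \<bar>u x\<bar> \<partial>M)" by (rule integral_abs_bound)
  also have "\<dots> \<le> (\<integral>x. 1 \<partial>M)"
    by (intro integral_mono integrable_abs finite_measure_integrable_bounded[OF M u]) (use u in auto)
  finally show ?thesis by (simp add: sp)
qed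

text \<open>Comparison with the zero measure bounds the first regularisation through the total mass
  of \<mu>, which supplies a finite starting term for the telescoping series.\<close>

lemma dk_null_finite:
  fixes \<mu> :: "(real^'n::finite) smeas"
  assumes \<mu>: "\<mu> \<in> fsm"
  shows "(null_measure borel, null_measure borel) \<in> (fsm :: (real^'n) smeas set)"
    and "dk k \<mu> (null_measure borel, null_measure borel) < \<infinity>"
proof -
  show "(null_measure borel, null_measure borel) \<in> (fsm :: (real^'n) smeas set)"
    by (auto simp: fsm_def intro!: finite_measureI)
  let ?K = "measure (fst \<mu>) UNIV + measure (snd \<mu>) UNIV"
  have "dk k \<mu> (null_measure borel, null_measure borel) \<le> ennreal ?K"
    unfolding dk_def
  proof (rule SUP_least, clarify)
    fix \<phi> :: "real^'n \<Rightarrow> real" assume s: "smooth \<phi>" and c: "cnorm k \<phi> \<le> 1"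
    have b: "\<bar>\<phi> x\<bar> \<le> 1" for x using cnorm_bound[OF c mi_upto_0] by (simp add: Dm_0)
    have "\<bar>sint \<mu> \<phi>\<bar> \<le> ?K"
      using finite_measure_integral_bound[OF fsmD(1,3)[OF \<mu>] smooth_measurable[OF s] b]
        finite_measure_integral_bound[OF fsmD(2,4)[OF \<mu>] smooth_measurable[OF s] b]
      unfolding sint_def by linarith
    then show "ennreal \<bar>sint \<mu> \<phi> - sint (null_measure borel, null_measure borel) \<phi>\<bar> \<le> ennreal ?K"
      by (intro ennreal_leI) (simp add: sint_def)
  qed
  then show "dk k \<mu> (null_measure borel, null_measure borel) < \<infinity>" by (simp add: order_le_less_trans)
qed

text \<open>One limit is formed for each order a. The limit for a = 0 is the density, since the
  regularised measures converge to \<mu> against tensor products; the others are its weak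
  derivatives, since integration by parts holds at each scale and passes to the limit.\<close>

lemma Sspace_density:
  fixes \<mu> :: "(real^'n::finite) smeas"
  assumes e: "young e" and S: "\<mu> \<in> Sspace q k m e"
  shows "\<exists>p. is_density \<mu> p \<and> p \<in> W q e"
proof -
  have \<mu>: "\<mu> \<in> fsm" using S by (simp add: Sspace_def)
  obtain \<mu>s where \<mu>s: "\<And>n. \<mu>s n \<in> Ma" "piF q k m e \<mu> \<mu>s < \<infinity>"
    using S unfolding Sspace_def rho_def INF_less_iff by auto
  obtain H and \<Gamma> :: "nat \<Rightarrow> 'n \<Rightarrow> real \<Rightarrow> real" and dir where ks: "kernel_system (2 * m) H \<Gamma> dir"
    using kernel_exists by blast
  note H = kernel_systemD(1,2)[OF ks]
  obtain C where C: "C > 0" and step: "\<And>(\<mu> :: (real^'n) smeas) \<nu> \<delta> a. \<mu> \<in> fsm \<Longrightarrow> \<nu> \<in> Ma \<Longrightarrow> 0 < \<delta> \<Longrightarrow> \<delta> \<le> 1 \<Longrightarrow> a \<in> mi_upto q \<Longrightarrow>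
      orlicz e (\<lambda>x. sv \<mu> (dv a (scs (\<delta>/2) (\<lambda>_. H))) x - sv \<mu> (dv a (scs \<delta> (\<lambda>_. H))) x)
      \<le> ennreal C * (ennreal (1 / \<delta> ^ (k + q) * beta e (1 / \<delta> ^ CARD('n))) * dk k \<mu> \<nu>
          + ennreal (\<delta> ^ (2*m)) * wsob (2*m + q) (2*m) e (pdens \<nu>))"
    by (rule regularisation_step[OF e ks]) blast+
  \<comment> \<open>At the scale 2^(-n) the coefficients in \<open>step\<close> are exactly those of
    the n-th terms of \<open>piF\<close>.\<close>
  define d where "d n = (1/2::real) ^ n" for n
  have d: "d n > 0" "d n \<le> 1" "d (Suc n) = d n / 2" for n by (auto simp: d_def power_le_one)
  have d0: "d \<longlonglongrightarrow> 0" unfolding d_def by (rule LIMSEQ_power_zero) simp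
  let ?H = "\<lambda>_::'n. H"
  have hs: "csms (dv a (scs (d n) ?H))" for a n using H d by (intro csms_dv csms_scs) auto
  define u where "u a n = sv \<mu> (dv a (scs (d n) ?H))" for a n
  have um: "u a n \<in> borel_measurable borel" for a n unfolding u_def by (rule sv_measurable[OF \<mu> hs])
  have fin0: "orlicz e (u a 0) < \<infinity>" for a
  proof -
    let ?n = "(null_measure borel, null_measure borel) :: (real^'n) smeas"
    let ?C = "1 + (\<Sum>b\<in>mi_upto k. L1t (dv (\<lambda>i. b i + a i) ?H)) + (\<Sum>b\<in>mi_upto k. Linft (dv (\<lambda>i. b i + a i) ?H))"
    have hH: "csms ?H" using H by simp
    have nn: "0 \<le> (\<Sum>b\<in>mi_upto k. L1t (dv (\<lambda>i. b i + a i) ?H))" "0 \<le> (\<Sum>b\<in>mi_upto k. Linft (dv (\<lambda>i. b i + a i) ?H))"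
      by (intro sum_nonneg L1t_nonneg Linft_nonneg csms_dv hH)+
    have "orlicz e (\<lambda>x. sv \<mu> (dv a (scs 1 ?H)) x - sv ?n (dv a (scs 1 ?H)) x)
      \<le> ennreal (?C * (1 / 1 ^ (k + mi_abs a)) * beta e (1 / 1 ^ CARD('n))) * dk k \<mu> ?n"
      by (rule orlicz_sv_diff[OF e \<mu> dk_null_finite(1)[OF \<mu>] hH]) (use nn in auto)
    moreover have "sv ?n h x = 0" for h x by (simp add: sv_def sint_def)
    ultimately have "orlicz e (u a 0) \<le> ennreal (?C * (1 / 1 ^ (k + mi_abs a)) * beta e (1 / 1 ^ CARD('n))) * dk k \<mu> ?n"
      by (simp add: u_def d_def)
    also have "\<dots> < \<infinity>" using dk_null_finite(2)[OF \<mu>] by (simp only: infinity_ennreal_def ennreal_mult_less_top ennreal_less_top) simp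
    finally show ?thesis .
  qed
  have sumfin: "(\<Sum>n. orlicz e (\<lambda>x. u a (Suc n) x - u a n x)) < \<infinity>" if a: "a \<in> mi_upto q" for a
  proof -
    let ?A = "\<lambda>n. ennreal (2 ^ (n * (q + k)) * beta e (2 ^ (n * CARD('n)))) * dk k \<mu> (\<mu>s n)"
    let ?B = "\<lambda>n. ennreal (inverse (2 ^ (2 * n * m))) * wsob (2 * m + q) (2 * m) e (pdens (\<mu>s n))"
    have le: "orlicz e (\<lambda>x. u a (Suc n) x - u a n x) \<le> ennreal C * (?A n + ?B n)" for n
    proof -
      have "1 / d n ^ j = 2 ^ (n * j)" for j
        by (simp add: d_def power_mult[symmetric] power_one_over)
      moreover have "d n ^ (2*m) = inverse (2 ^ (2 * n * m))"
        by (simp add: d_def power_mult[symmetric] power_one_over inverse_eq_divide mult_ac)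
      ultimately show ?thesis
        using step[OF \<mu> \<mu>s(1)[of n] d(1)[of n] d(2)[of n] a] unfolding u_def d(3) by (simp add: add.commute)
    qed
    have "(\<Sum>n. orlicz e (\<lambda>x. u a (Suc n) x - u a n x)) \<le> (\<Sum>n. ennreal C * (?A n + ?B n))"
      by (intro suminf_le summableI le)
    also have "\<dots> = ennreal C * ((\<Sum>n. ?A n) + (\<Sum>n. ?B n))"
      by (simp only: ennreal_suminf_cmult suminf_add[OF summableI summableI])
    also have "\<dots> = ennreal C * piF q k m e \<mu> \<mu>s" unfolding piF_def ..
    also have "\<dots> < \<infinity>" using \<mu>s(2) by (simp only: infinity_ennreal_def ennreal_mult_less_top ennreal_less_top) simp
    finally show ?thesis .
  qed
  have ex: "\<forall>a\<in>mi_upto q. \<exists>g. loc_int g \<and> orlicz e g < \<infinity> \<and> (\<forall>\<eta> r B. \<eta> \<in> borel_measurable borel \<longrightarrow> (\<forall>x. r < norm x \<longrightarrow> \<eta> x = 0) \<longrightarrow> (\<forall>x. \<bar>\<eta> x\<bar> \<le> B) \<longrightarrow>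
        (\<lambda>n. \<integral>x. u a n x * \<eta> x \<partial>lborel) \<longlonglongrightarrow> (\<integral>x. g x * \<eta> x \<partial>lborel))"
    by (intro ballI orlicz_telescope_limit[OF e um fin0 sumfin])
  obtain g where gg: "\<forall>a\<in>mi_upto q. loc_int (g a) \<and> orlicz e (g a) < \<infinity> \<and> (\<forall>\<eta> r B. \<eta> \<in> borel_measurable borel \<longrightarrow> (\<forall>x. r < norm x \<longrightarrow> \<eta> x = 0) \<longrightarrow> (\<forall>x. \<bar>\<eta> x\<bar> \<le> B) \<longrightarrow>
        (\<lambda>n. \<integral>x. u a n x * \<eta> x \<partial>lborel) \<longlonglongrightarrow> (\<integral>x. g a x * \<eta> x \<partial>lborel))"
    using bchoice[OF ex] by blast
  have g: "loc_int (g a)" "orlicz e (g a) < \<infinity>" if "a \<in> mi_upto q" for a using gg that by blast+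
  have lim: "(\<lambda>n. \<integral>x. u a n x * \<eta> x \<partial>lborel) \<longlonglongrightarrow> (\<integral>x. g a x * \<eta> x \<partial>lborel)"
    if "a \<in> mi_upto q" "\<eta> \<in> borel_measurable borel" "\<forall>x. r < norm x \<longrightarrow> \<eta> x = 0" "\<forall>x. \<bar>\<eta> x\<bar> \<le> B" for a \<eta> r B
    using gg that by blast
  let ?p = "g (\<lambda>_. 0)"
  have wg: "weak_deriv a ?p (g a)" if a: "a \<in> mi_upto q" for a
    unfolding weak_deriv_def
  proof (intro conjI allI impI g a mi_upto_0)
    fix \<phi> :: "real^'n \<Rightarrow> real" assume \<phi>: "test_fun \<phi>"
    obtain r where r: "\<And>x. r < norm x \<Longrightarrow> \<phi> x = 0" using test_fun_support[OF \<phi>] by blast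
    have s: "smooth \<phi>" "smooth (Dm a \<phi>)" using \<phi> smooth_pderivs unfolding Dm_def test_fun_def by blast+
    have r': "r < norm x \<Longrightarrow> Dm a \<phi> x = 0" for x unfolding Dm_def by (rule pderivs_support[OF r])
    obtain B where "B > 0" and B: "\<And>x. \<bar>\<phi> x\<bar> \<le> B" by (rule continuous_support_bounded[OF smooth_continuous[OF s(1)] r]) blast+
    obtain B' where "B' > 0" and B': "\<And>x. \<bar>Dm a \<phi> x\<bar> \<le> B'" by (rule continuous_support_bounded[OF smooth_continuous[OF s(2)] r']) blast+
    have l0: "(\<lambda>n. \<integral>x. u (\<lambda>_. 0) n x * Dm a \<phi> x \<partial>lborel) \<longlonglongrightarrow> (\<integral>x. ?p x * Dm a \<phi> x \<partial>lborel)"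
      by (rule lim[OF mi_upto_0 smooth_measurable[OF s(2)]]) (use r' B' in auto)
    \<comment> \<open>Weak differentiation is available for convolutions with positive measures, so
      the identity is split over the two parts of \<mu>.\<close>
    have E: "(\<integral>x. u (\<lambda>_. 0) n x * Dm a \<phi> x \<partial>lborel) = (-1) ^ mi_abs a * (\<integral>x. u a n x * \<phi> x \<partial>lborel)" for n
    proof -
      let ?c = "\<lambda>M h. conv M (\<lambda>_. 1) (tens h)"
      have h0: "csms (scs (d n) ?H)" using H d by (intro csms_scs) auto
      have sub: "(\<integral>x. sv \<mu> h x * \<eta> x \<partial>lborel) = (\<integral>x. ?c (fst \<mu>) h x * \<eta> x \<partial>lborel) - (\<integral>x. ?c (snd \<mu>) h x * \<eta> x \<partial>lborel)"
        if "csms h" "smooth \<eta>" "\<And>x. r < norm x \<Longrightarrow> \<eta> x = 0" for h \<eta>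
      proof -
        have i: "integrable lborel (\<lambda>x. ?c M h x * \<eta> x)" if l: "locint M (\<lambda>_. 1)" for M :: "(real^'n) measure"
          by (rule integrable_continuous_support[where r = r,
                OF continuous_on_mult[OF conv_continuous[OF l \<open>csms h\<close>] smooth_continuous[OF \<open>smooth \<eta>\<close>]]])
             (simp add: \<open>\<And>x. r < norm x \<Longrightarrow> \<eta> x = 0\<close>)
        show ?thesis unfolding sv_conv left_diff_distrib
          by (rule Bochner_Integration.integral_diff[OF i[OF sv_locint(1)[OF \<mu>]] i[OF sv_locint(2)[OF \<mu>]]])
      qed
      have w: "(\<integral>x. ?c M (scs (d n) ?H) x * Dm a \<phi> x \<partial>lborel) = (-1) ^ mi_abs a * (\<integral>x. ?c M (dv a (scs (d n) ?H)) x * \<phi> x \<partial>lborel)"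
        if "locint M (\<lambda>_. 1)" for M :: "(real^'n) measure"
        using weak_deriv_smooth_conv[OF that h0, of a] \<phi> unfolding weak_deriv_def by blast
      have s0: "(\<integral>x. sv \<mu> (scs (d n) ?H) x * Dm a \<phi> x \<partial>lborel)
        = (\<integral>x. ?c (fst \<mu>) (scs (d n) ?H) x * Dm a \<phi> x \<partial>lborel) - (\<integral>x. ?c (snd \<mu>) (scs (d n) ?H) x * Dm a \<phi> x \<partial>lborel)"
        by (rule sub[OF h0 s(2)]) (rule r')
      have s1: "(\<integral>x. sv \<mu> (dv a (scs (d n) ?H)) x * \<phi> x \<partial>lborel)
        = (\<integral>x. ?c (fst \<mu>) (dv a (scs (d n) ?H)) x * \<phi> x \<partial>lborel) - (\<integral>x. ?c (snd \<mu>) (dv a (scs (d n) ?H)) x * \<phi> x \<partial>lborel)"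
        by (rule sub[OF hs s(1)]) (rule r)
      show ?thesis
        unfolding u_def dv_0 s0 s1 w[OF sv_locint(1)[OF \<mu>]] w[OF sv_locint(2)[OF \<mu>]]
        by (simp add: right_diff_distrib)
    qed
    have "(\<lambda>n. (-1) ^ mi_abs a * (\<integral>x. u a n x * \<phi> x \<partial>lborel)) \<longlonglongrightarrow> (-1) ^ mi_abs a * (\<integral>x. g a x * \<phi> x \<partial>lborel)"
      by (intro tendsto_mult tendsto_const lim[OF a smooth_measurable[OF s(1)]]) (use r B in auto)
    with l0[unfolded E] show "(\<integral>x. ?p x * Dm a \<phi> x \<partial>lborel) = (-1) ^ mi_abs a * (\<integral>x. g a x * \<phi> x \<partial>lborel)"
      by (rule LIMSEQ_unique)
  qed
  have "is_density (fst \<mu>, snd \<mu>) ?p"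
  proof (rule tens_separation[OF fsmD(1,2)[OF \<mu>] fsmD(3,4)[OF \<mu>] g(1)[OF mi_upto_0]])
    fix h :: "'n \<Rightarrow> real \<Rightarrow> real" assume h: "csms h"
    obtain r where r: "\<And>x. r < norm x \<Longrightarrow> tens h x = 0" using tens_support[OF h] by blast
    obtain B where B: "\<And>x. \<bar>tens h x\<bar> \<le> B" using tens_bounded[OF h] by blast
    have lt: "locint lborel (tens h)" by (intro locint_loc_int loc_int_integrable tens_integrable h)
    have h0: "csms (scs (d n) ?H)" for n using H d by (intro csms_scs) auto
    let ?\<Phi> = "\<lambda>n. conv lborel (tens h) (tens (rf 0 (scs (d n) ?H)))"
    have 1: "(\<lambda>n. \<integral>x. u (\<lambda>_. 0) n x * tens h x \<partial>lborel) \<longlonglongrightarrow> (\<integral>x. ?p x * tens h x \<partial>lborel)"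
      by (rule lim[OF mi_upto_0 tens_measurable[OF h]]) (use r B in auto)
    have eq: "(\<integral>x. u (\<lambda>_. 0) n x * tens h x \<partial>lborel) = sint \<mu> (?\<Phi> n)" for n
      using sv_fubini(2)[OF \<mu> h0 tens_measurable[OF h] B, of n] by (simp add: u_def dv_0 mult.commute)
    \<comment> \<open>Once moved to the test function, the kernel acts as an approximate identity;
      the bound B L1t(H) holds at every scale and is integrable for a finite measure.\<close>
    have conv: "(\<lambda>n. \<integral>y. ?\<Phi> n y \<partial>M) \<longlonglongrightarrow> (\<integral>y. tens h y \<partial>M)"
      if M: "finite_measure M" "sets M = sets borel" for M :: "(real^'n) measure"
    proof (rule integral_dominated_convergence[where w = "\<lambda>_. B * L1t ?H"])
      interpret finite_measure M by fact
      show "integrable M (\<lambda>_. B * L1t ?H)" by simp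
      show "tens h \<in> borel_measurable M"
        using tens_measurable[OF h] measurable_cong_sets[OF M(2) refl, of borel] by blast
      show "?\<Phi> n \<in> borel_measurable M" for n
        using conv_measurable[OF lt csms_rf[OF h0[of n]]] measurable_cong_sets[OF M(2) refl, of borel] by blast
      show "AE y in M. (\<lambda>n. ?\<Phi> n y) \<longlonglongrightarrow> tens h y"
        by (intro always_eventually allI conv_approx_identity[OF tens_continuous[OF h] B H d(1) d0])
      show "AE y in M. norm (?\<Phi> n y) \<le> B * L1t ?H" for n
      proof (intro always_eventually allI)
        fix y
        have "\<bar>?\<Phi> n y\<bar> \<le> B * L1t (rf 0 (scs (d n) ?H))"
          by (rule conv_bounded[OF tens_measurable[OF h] B csms_rf[OF h0]])
        also have "L1t (rf 0 (scs (d n) ?H)) = L1t ?H"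
          using L1t_rf[OF h0[of n], of "\<lambda>_. 0" 0] L1t_scs[of ?H "d n"] H d(1)[of n] by (simp add: dv_0)
        finally show "norm (?\<Phi> n y) \<le> B * L1t ?H" by simp
      qed
    qed
    have "(\<lambda>n. sint \<mu> (?\<Phi> n)) \<longlonglongrightarrow> (\<integral>x. tens h x \<partial>fst \<mu>) - (\<integral>x. tens h x \<partial>snd \<mu>)"
      unfolding sint_def by (intro tendsto_diff conv fsmD[OF \<mu>])
    then show "(\<integral>x. tens h x \<partial>fst \<mu>) - (\<integral>x. tens h x \<partial>snd \<mu>) = (\<integral>x. ?p x * tens h x \<partial>lborel)"
      using 1 LIMSEQ_unique unfolding eq by blast
  qed
  moreover have "?p \<in> W q e"
  proof -
    have "orlicz e (wd a ?p) < \<infinity>" if "a \<in> mi_upto q" for a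
      using orlicz_AE_cong[OF e wd_AE[OF wg[OF that]]] g(2)[OF that] by simp
    then have "(\<Sum>a\<in>mi_upto q. orlicz e (wd a ?p)) < \<infinity>" by (simp add: finite_mi_upto)
    moreover have "\<forall>a\<in>mi_upto q. \<exists>g. weak_deriv a ?p g" using wg by blast
    ultimately have "sob q e ?p < \<infinity>" by (simp add: sob_def)
    then show ?thesis by (simp add: W_def)
  qed
  ultimately show ?thesis by auto
qed

subsection \<open>The balance space\<close>

text \<open>The initial terms are only required to be finite, because a bound on a limit superior
  says nothing about small radii.\<close>

lemma suminf_ennreal_finite_tail:
  fixes f :: "nat \<Rightarrow> ennreal" and t :: "nat \<Rightarrow> real"
  assumes "\<And>n. n < N \<Longrightarrow> f n < \<infinity>" "\<And>n. N \<le> n \<Longrightarrow> f n \<le> ennreal (t n)" "\<And>n. 0 \<le> t n" "summable t"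
  shows "(\<Sum>n. f n) < \<infinity>"
proof -
  define b where "b n = (if n < N then enn2real (f n) else t n)" for n
  have b0: "0 \<le> b n" for n using assms(3) by (simp add: b_def)
  have sb: "summable b"
  proof (subst summable_cong)
    show "eventually (\<lambda>n. b n = t n) sequentially"
      using eventually_ge_at_top[of N] by eventually_elim (simp add: b_def)
  qed fact
  have "f n \<le> ennreal (b n)" for n
    using assms(1,2)[of n] by (cases "n < N") (auto simp: b_def ennreal_enn2real_if)
  then have "(\<Sum>n. f n) \<le> (\<Sum>n. ennreal (b n))" by (intro suminf_le summableI)
  also have "\<dots> = ennreal (suminf b)" by (rule suminf_ennreal2[OF b0 sb])
  finally show ?thesis by (simp add: order_le_less_trans)
qed

text \<open>\<open>La a\<close> is continuous with value 0 at 1, so the intermediate value theorem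
  provides the radius. From y = R (ln R)^a \<le> R^(1+a) follows the lower bound for ln R, which for
  y = 2^(2mn) is linear in n.\<close>

lemma La_surj:
  assumes a: "1 < a" and y: "1 \<le> y"
  obtains R where "1 < R" "La a R = y" "ln y \<le> (1 + a) * ln R"
proof -
  \<comment> \<open>From exp 1 on the logarithmic factor is at least 1, so \<open>La a ?X\<close> is
    at least y.\<close>
  let ?X = "max y (exp 1)"
  have X1: "1 \<le> ?X" using y by simp
  have "\<exists>R\<ge>1. R \<le> ?X \<and> La a R = y"
  proof (rule IVT')
    show "La a 1 \<le> y" using y by (simp add: La_def)
    have "1 \<le> ln ?X" by (subst ln_ge_iff) (use y in auto)
    then have "1 powr a \<le> ln ?X powr a" using a by (intro powr_mono2) auto
    then have "?X * 1 \<le> ?X * ln ?X powr a" using X1 by (intro mult_left_mono) auto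
    then show "y \<le> La a ?X" unfolding La_def by linarith
    show "continuous_on {1..?X} (La a)"
      unfolding La_def by (intro continuous_intros continuous_on_powr') (use a in auto)
  qed (rule X1)
  then obtain R where R: "1 \<le> R" "La a R = y" by blast
  have R1: "1 < R"
  proof (rule ccontr)
    assume "\<not> 1 < R" then have "R = 1" using R by simp
    then show False using R y by (simp add: La_def)
  qed
  have "ln R \<le> R" using R1 ln_le_minus_one[of R] by simp
  then have "ln R powr a \<le> R powr a" using a R1 by (intro powr_mono2) auto
  then have "y \<le> R * R powr a" unfolding R(2)[symmetric] La_def using R1 by (intro mult_left_mono) auto
  then have "ln y \<le> ln (R * R powr a)" using y R1 by (subst ln_le_cancel_iff) auto
  also have "\<dots> = (1 + a) * ln R" using R1 by (simp add: ln_mult ln_powr distrib_right)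
  finally show ?thesis using that R1 R by blast
qed

lemma Limsup_finite_bound:
  fixes F :: "real \<Rightarrow> ennreal"
  assumes "Limsup at_top F < \<infinity>"
  obtains C R0 where "0 \<le> C" "\<And>R. R0 \<le> R \<Longrightarrow> F R \<le> ennreal C"
proof -
  obtain c where c: "Limsup at_top F = ennreal c" "0 \<le> c" using assms by (cases "Limsup at_top F") auto
  then have "Limsup at_top F < ennreal (c + 1)" by (simp add: ennreal_less_iff)
  then have "eventually (\<lambda>R. F R < ennreal (c + 1)) at_top" by (rule Limsup_lessD)
  then obtain R0 where "\<And>R. R0 \<le> R \<Longrightarrow> F R < ennreal (c + 1)" unfolding eventually_at_top_linorder by blast
  then show ?thesis using that[of "c + 1" R0] c by (simp add: less_imp_le)
qed

lemma pow2_powr: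
  fixes x :: real
  assumes "real j * x = real i" shows "((2::real) ^ j) powr x = 2 ^ i"
proof -
  have "((2::real) ^ j) powr x = (2 powr real j) powr x" by (simp add: powr_realpow)
  also have "\<dots> = 2 powr real i" unfolding powr_powr assms ..
  finally show ?thesis by (simp add: powr_realpow)
qed

text \<open>When \<open>La a R\<close> = 2^(2nm), the coefficient in \<open>Bq\<close> is that of
  \<open>piF\<close> times (ln R)^a, while 2^(-2nm) R = (ln R)^(-a). Up to a geometric slack both
  terms of \<open>piF\<close> are therefore at most of order (ln R)^(-a), and ln R grows at least
  linearly in n.\<close>

lemma Bq_step:
  fixes \<mu> :: "(real^'n::finite) smeas"
  assumes e: "young e" and m: "m \<ge> 1" and a: "a > 1" and C: "C \<ge> 0"
    and bound: "\<And>R. R0 \<le> R \<Longrightarrow> ennreal (La a R powr (1 + real (k + q) / (2 * real m))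
                 * beta e (La a R powr (real CARD('n) / (2 * real m))) / R) * dk_set k \<mu> (Mball m q e R) \<le> ennreal C"
    and n: "1 \<le> n" and n0: "R0 \<le> 2 * real m * ln 2 / (1 + a) * real n"
  shows "\<exists>\<nu>\<in>Ma. ennreal (2 ^ (n * (q + k)) * beta e (2 ^ (n * CARD('n)))) * dk k \<mu> \<nu>
             \<le> ennreal (C * (2 * real m * ln 2 / (1 + a) * real n) powr (- a) + (1/2) ^ n)
           \<and> ennreal (inverse (2 ^ (2 * n * m))) * wsob (2 * m + q) (2 * m) e (pdens \<nu>)
             \<le> ennreal ((2 * real m * ln 2 / (1 + a) * real n) powr (- a))"
proof -
  let ?\<kappa> = "2 * real m * ln 2 / (1 + a) * real n"
  let ?P = "2 ^ (n * (q + k)) * beta e (2 ^ (n * CARD('n)))"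
  let ?Y = "2 ^ (2 * n * m) :: real"
  have \<kappa>: "?\<kappa> > 0" using m a n by simp
  have P: "?P > 0" using beta_pos[OF e] by simp
  have Y: "1 \<le> ?Y" by simp
  obtain R where R: "1 < R" "La a R = ?Y" "ln ?Y \<le> (1 + a) * ln R" using La_surj[OF a Y] by blast
  have lnY: "ln ?Y = 2 * real m * ln 2 * real n" by (simp add: ln_realpow)
  have \<kappa>R: "?\<kappa> \<le> ln R" using R(3) a unfolding lnY by (simp add: field_simps)
  let ?s = "?\<kappa> powr (- a)"
  have lnR: "0 < ln R" using R by simp
  have s: "ln R powr (- a) \<le> ?s" using \<kappa> \<kappa>R a by (intro powr_mono2') auto
  have RY: "R / ?Y = ln R powr (- a)"
    unfolding R(2)[symmetric] La_def using R lnR by (simp add: powr_minus field_simps)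
  have RR0: "R0 \<le> R" using n0 \<kappa>R ln_le_minus_one[of R] R(1) by linarith
  let ?D = "dk_set k \<mu> (Mball m q e R)"
  have coef: "La a R powr (1 + real (k + q) / (2 * real m)) * beta e (La a R powr (real CARD('n) / (2 * real m))) / R
     = ?P * ln R powr a"
  proof -
    have 1: "?Y powr (1 + real (k + q) / (2 * real m)) = 2 ^ (2 * n * m + n * (q + k))"
      by (rule pow2_powr) (use m in \<open>simp add: field_simps\<close>)
    have 2: "?Y powr (real CARD('n) / (2 * real m)) = 2 ^ (n * CARD('n))"
      by (rule pow2_powr) (use m in \<open>simp add: field_simps\<close>)
    have 3: "?Y = R * ln R powr a" using R(2) by (simp add: La_def)
    have "2 ^ (2 * n * m + n * (q + k)) = R * ln R powr a * 2 ^ (n * (q + k))"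
      unfolding power_add 3 ..
    then show ?thesis unfolding R(2) 1 2 using R(1) by simp
  qed
  have le: "ennreal (?P * ln R powr a) * ?D \<le> ennreal C" using bound[OF RR0] unfolding coef .
  have lnRa: "0 < ln R powr a" using lnR by simp
  have PD: "ennreal ?P * ?D \<le> ennreal (C * ?s)"
  proof -
    have "ennreal ?P * ?D = ennreal (ln R powr (- a)) * (ennreal (?P * ln R powr a) * ?D)"
    proof -
      have "ln R powr (- a) * (?P * ln R powr a) = ?P" using lnRa by (simp add: powr_minus field_simps)
      then have "ennreal ?P = ennreal (ln R powr (- a)) * ennreal (?P * ln R powr a)"
        using P by (subst ennreal_mult[symmetric]) auto
      then show ?thesis by (simp only: mult.assoc)
    qed
    also have "\<dots> \<le> ennreal ?s * ennreal C" by (intro mult_mono le ennreal_leI s) auto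
    also have "\<dots> = ennreal (C * ?s)" using C by (simp add: ennreal_mult' mult.commute)
    finally show ?thesis .
  qed
  \<comment> \<open>An infinite distance would contradict the bound because P > 0; finiteness makes
    the slack below a strict increase.\<close>
  have "?D < \<infinity>"
  proof (rule ccontr)
    assume "\<not> ?D < \<infinity>"
    then have "?D = top" by (simp add: less_top[symmetric])
    moreover have "ennreal ?P \<noteq> 0" using P by (metis ennreal_eq_0_iff not_le)
    ultimately have "ennreal ?P * ?D = top" by (simp only: ennreal_mult_top if_False)
    then show False using PD by (simp add: top_unique)
  qed
  \<comment> \<open>The infimum need not be attained; the slack (1/2)^n / P becomes the summable
    (1/2)^n after multiplication by P.\<close>
  then have "?D < ?D + ennreal ((1/2) ^ n / ?P)"
    using P by (cases ?D) (auto simp: ennreal_plus[symmetric] ennreal_less_iff simp del: ennreal_plus)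
  then obtain \<nu> where \<nu>: "\<nu> \<in> Mball m q e R" "dk k \<mu> \<nu> < ?D + ennreal ((1/2) ^ n / ?P)"
    unfolding dk_set_def INF_less_iff by blast
  have "ennreal ?P * dk k \<mu> \<nu> \<le> ennreal ?P * (?D + ennreal ((1/2) ^ n / ?P))"
    by (intro mult_left_mono less_imp_le[OF \<nu>(2)]) simp
  also have "\<dots> = ennreal ?P * ?D + ennreal ((1/2) ^ n)"
  proof -
    have "ennreal ?P * ennreal ((1/2) ^ n / ?P) = ennreal ((1/2) ^ n)"
      using P by (subst ennreal_mult[symmetric]) auto
    then show ?thesis by (simp only: distrib_left)
  qed
  also have "\<dots> \<le> ennreal (C * ?s) + ennreal ((1/2) ^ n)" by (intro add_right_mono PD)
  also have "\<dots> = ennreal (C * ?s + (1/2) ^ n)" using C by (simp add: ennreal_plus)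
  finally have 1: "ennreal ?P * dk k \<mu> \<nu> \<le> ennreal (C * ?s + (1/2) ^ n)" .
  have "ennreal (inverse ?Y) * wsob (2 * m + q) (2 * m) e (pdens \<nu>) \<le> ennreal (inverse ?Y) * ennreal R"
    using \<nu>(1) by (intro mult_left_mono) (auto simp: Mball_def)
  also have "\<dots> = ennreal (R / ?Y)" using R(1) by (simp add: ennreal_mult[symmetric] divide_inverse mult.commute)
  also have "\<dots> \<le> ennreal ?s" unfolding RY by (rule ennreal_leI[OF s])
  finally show ?thesis using 1 \<nu>(1) by (intro bexI[of _ \<nu>]) (auto simp: Mball_def)
qed

lemma Bq_subset_Sspace:
  assumes e: "young e" and m: "m \<ge> 1"
  shows "(Bq q k m e :: (real^'n::finite) smeas set) \<subseteq> Sspace q k m e"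
proof
  fix \<mu> :: "(real^'n) smeas" assume B: "\<mu> \<in> Bq q k m e"
  then obtain a where \<mu>: "\<mu> \<in> fsm" and a: "a > 1" and L: "Limsup at_top (\<lambda>R::real.
        ennreal (La a R powr (1 + real (k + q) / (2 * real m))
                 * beta e (La a R powr (real CARD('n) / (2 * real m))) / R)
        * dk_set k \<mu> (Mball m q e R)) < \<infinity>"
    by (auto simp: Bq_def)
  obtain C R0 where C: "0 \<le> C" and bound: "\<And>R. R0 \<le> R \<Longrightarrow> ennreal (La a R powr (1 + real (k + q) / (2 * real m))
                 * beta e (La a R powr (real CARD('n) / (2 * real m))) / R) * dk_set k \<mu> (Mball m q e R) \<le> ennreal C"
    using Limsup_finite_bound[OF L] by blast
  define \<kappa> where "\<kappa> = 2 * real m * ln 2 / (1 + a)"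
  have \<kappa>: "\<kappa> > 0" using m a by (simp add: \<kappa>_def)
  obtain N0 :: nat where N0: "R0 / \<kappa> \<le> real N0" using real_arch_simple by blast
  define N where "N = max 1 N0"
  let ?P = "\<lambda>n. ennreal (2 ^ (n * (q + k)) * beta e (2 ^ (n * CARD('n))))"
  let ?W = "\<lambda>\<nu>. wsob (2 * m + q) (2 * m) e (pdens \<nu>)"
  have step: "\<exists>\<nu>\<in>Ma. ?P n * dk k \<mu> \<nu> \<le> ennreal (C * (\<kappa> * real n) powr (- a) + (1/2) ^ n)
           \<and> ennreal (inverse (2 ^ (2 * n * m))) * ?W \<nu> \<le> ennreal ((\<kappa> * real n) powr (- a))"
    if n: "N \<le> n" for n
    unfolding \<kappa>_def
  proof (rule Bq_step[OF e m a C bound])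
    have "R0 / \<kappa> \<le> real n" using N0 n by (auto simp: N_def)
    then show "R0 \<le> 2 * real m * ln 2 / (1 + a) * real n" unfolding \<kappa>_def[symmetric] using \<kappa> by (simp add: field_simps)
  qed (use n in \<open>auto simp: N_def\<close>)
  then have "\<forall>n\<in>{N..}. \<exists>\<nu>. \<nu> \<in> Ma \<and> ?P n * dk k \<mu> \<nu> \<le> ennreal (C * (\<kappa> * real n) powr (- a) + (1/2) ^ n)
           \<and> ennreal (inverse (2 ^ (2 * n * m))) * ?W \<nu> \<le> ennreal ((\<kappa> * real n) powr (- a))"
    by blast
  from bchoice[OF this] obtain \<nu> where \<nu>: "\<And>n. N \<le> n \<Longrightarrow> \<nu> n \<in> Ma"
    "\<And>n. N \<le> n \<Longrightarrow> ?P n * dk k \<mu> (\<nu> n) \<le> ennreal (C * (\<kappa> * real n) powr (- a) + (1/2) ^ n)"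
    "\<And>n. N \<le> n \<Longrightarrow> ennreal (inverse (2 ^ (2 * n * m))) * ?W (\<nu> n) \<le> ennreal ((\<kappa> * real n) powr (- a))"
    by auto
  \<comment> \<open>The estimates hold only from N on; the earlier places are filled with \<nu> N,
    which makes their finitely many terms finite.\<close>
  define \<mu>s where "\<mu>s n = (if n < N then \<nu> N else \<nu> n)" for n
  have Ma: "\<mu>s n \<in> Ma" for n using \<nu>(1) by (auto simp: \<mu>s_def)
  have fac: "x < \<infinity>" if "ennreal c * x \<le> ennreal y" "c > 0" for x and c y :: real
  proof (rule ccontr)
    assume "\<not> x < \<infinity>"
    then have "x = top" by (simp add: less_top[symmetric])
    moreover have "ennreal c \<noteq> 0" using that by (metis ennreal_eq_0_iff not_le)
    ultimately have "ennreal c * x = top" by (simp only: ennreal_mult_top if_False)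
    then show False using that(1) by (simp add: top_unique)
  qed
  have fin: "dk k \<mu> (\<nu> N) < \<infinity>" "?W (\<nu> N) < \<infinity>"
    using fac[OF \<nu>(2)[of N]] fac[OF \<nu>(3)[of N]] beta_pos[OF e] by auto
  have s: "summable (\<lambda>n. (\<kappa> * real n) powr (- a))"
  proof -
    have "summable (\<lambda>n. real n powr (- a))" using a by (simp add: summable_real_powr_iff)
    then have "summable (\<lambda>n. \<kappa> powr (- a) * real n powr (- a))" by (rule summable_mult)
    then show ?thesis using \<kappa> by (simp add: powr_mult)
  qed
  have "(\<Sum>n. ?P n * dk k \<mu> (\<mu>s n)) < \<infinity>"
  proof (rule suminf_ennreal_finite_tail[where N = N and t = "\<lambda>n. C * (\<kappa> * real n) powr (- a) + (1/2) ^ n"])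
    show "summable (\<lambda>n. C * (\<kappa> * real n) powr (- a) + (1/2) ^ n)"
      by (intro summable_add summable_mult s summable_geometric) simp
    show "n < N \<Longrightarrow> ?P n * dk k \<mu> (\<mu>s n) < \<infinity>" for n
      using fin(1) by (simp add: \<mu>s_def ennreal_mult_less_top)
  qed (use \<nu>(2) C in \<open>auto simp: \<mu>s_def\<close>)
  moreover have "(\<Sum>n. ennreal (inverse (2 ^ (2 * n * m))) * ?W (\<mu>s n)) < \<infinity>"
  proof (rule suminf_ennreal_finite_tail[where N = N and t = "\<lambda>n. (\<kappa> * real n) powr (- a)"])
    show "n < N \<Longrightarrow> ennreal (inverse (2 ^ (2 * n * m))) * ?W (\<mu>s n) < \<infinity>" for n
      using fin(2) by (simp add: \<mu>s_def ennreal_mult_less_top)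
  qed (use \<nu>(3) s in \<open>auto simp: \<mu>s_def\<close>)
  ultimately have "piF q k m e \<mu> \<mu>s < \<infinity>" unfolding piF_def by simp
  then have "rho q k m e \<mu> < \<infinity>"
    unfolding rho_def INF_less_iff using Ma by blast
  then show "\<mu> \<in> Sspace q k m e" using \<mu> by (simp add: Sspace_def)
qed

subsection \<open>Weighted Sobolev functions\<close>

text \<open>A pure derivative admits only one list of directions, so neither the choice in
  \<open>mi_list\<close> nor a reversal matters. This makes integration by parts usable for
  arbitrary smooth test functions in \<open>conv_smooth_by_parts\<close>.\<close>

lemma mi_list_single: "mi_list (\<lambda>i. if i = j then k else 0) = replicate k j"
proof -
  let ?a = "\<lambda>i. if i = j then k else 0"
  have "\<forall>y\<in>set (mi_list ?a). y = j"
  proof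
    fix y assume "y \<in> set (mi_list ?a)"
    then have "count_list (mi_list ?a) y \<noteq> 0" by (simp add: count_list_0_iff)
    then show "y = j" by (simp add: mi_list_count split: if_splits)
  qed
  then have "replicate (length (mi_list ?a)) j = mi_list ?a" by (simp add: replicate_length_same)
  then show ?thesis by (simp add: length_mi_list mi_abs_single)
qed

text \<open>A list realising \<open>b\<close> is cut after s entries: the first part can go to the
  function, the rest stays on the kernel.\<close>

lemma mi_split:
  fixes b :: "'n::finite \<Rightarrow> nat"
  assumes "mi_abs b \<le> s + t"
  obtains b1 b2 where "b = (\<lambda>i. b1 i + b2 i)" "mi_abs b1 \<le> s" "mi_abs b2 \<le> t"
proof -
  let ?l = "mi_list b"
  have len: "mi_abs (\<lambda>i. count_list xs i) = length xs" for xs :: "'n list"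
    using sum_count_set[of xs UNIV] by (simp add: mi_abs_def)
  have "b i = count_list (take s ?l) i + count_list (drop s ?l) i" for i
    by (metis append_take_drop_id count_list_append mi_list_count)
  then show ?thesis
    using assms by (intro that[of "\<lambda>i. count_list (take s ?l) i" "\<lambda>i. count_list (drop s ?l) i"])
      (auto simp: len length_mi_list)
qed

lemma xpow_bound: "\<bar>xpow g x\<bar> \<le> (1 + norm x) ^ mi_abs g"
proof -
  have "\<bar>xpow g x\<bar> = (\<Prod>i\<in>UNIV. \<bar>x $ i\<bar> ^ g i)" by (simp add: xpow_def abs_prod power_abs)
  also have "\<dots> \<le> (\<Prod>i\<in>UNIV. (1 + norm x) ^ g i)"
  proof (intro prod_mono conjI power_mono)
    fix i show "\<bar>x $ i\<bar> \<le> 1 + norm x" using component_le_norm_cart[of x i] by simp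
  qed auto
  finally show ?thesis by (simp add: mi_abs_def power_sum)
qed

lemma xpow_single: "xpow (\<lambda>i. if i = j then M else 0) x = (x $ j) ^ M"
proof -
  have "xpow (\<lambda>i. if i = j then M else 0) x = (\<Prod>i\<in>UNIV. if i = j then (x $ j) ^ M else 1)"
    unfolding xpow_def by (intro prod.cong) auto
  then show ?thesis by simp
qed

text \<open>The largest coordinate controls the norm: 1 + |x| \<le> (n + 1) max(1, |x_j|) in
  dimension n. The M-th power of the maximum is the modulus of one of the monomials 1 and x_j^M,
  both present in the sum.\<close>

lemma weight_le_xpow:
  fixes x :: "real^'n::finite"
  shows "(1 + norm x) ^ M \<le> (real CARD('n) + 1) ^ M * (\<Sum>g\<in>mi_upto M. \<bar>xpow g x\<bar>)"
proof -
  let ?s = "\<Sum>g\<in>mi_upto M. \<bar>xpow g x\<bar>"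
  have s: "\<bar>xpow g x\<bar> \<le> ?s" if "g \<in> mi_upto M" for g
    by (rule member_le_sum[OF that]) (auto simp: finite_mi_upto)
  have "Max (range (\<lambda>i. \<bar>x $ i\<bar>)) \<in> range (\<lambda>i. \<bar>x $ i\<bar>)" by (intro Max_in) auto
  then obtain j where j: "Max (range (\<lambda>i. \<bar>x $ i\<bar>)) = \<bar>x $ j\<bar>" by blast
  have j': "\<bar>x $ i\<bar> \<le> \<bar>x $ j\<bar>" for i unfolding j[symmetric] by (intro Max_ge) auto
  let ?t = "max 1 \<bar>x $ j\<bar>"
  have "norm x \<le> (\<Sum>i\<in>UNIV. \<bar>x $ i\<bar>)" by (rule norm_le_l1_cart)
  also have "\<dots> \<le> (\<Sum>i\<in>(UNIV::'n set). ?t)" using j' by (intro sum_mono) (simp add: le_max_iff_disj)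
  finally have "1 + norm x \<le> (real CARD('n) + 1) * ?t" by (simp add: distrib_right)
  then have "(1 + norm x) ^ M \<le> ((real CARD('n) + 1) * ?t) ^ M" by (intro power_mono) auto
  also have "\<dots> = (real CARD('n) + 1) ^ M * ?t ^ M" by (rule power_mult_distrib)
  also have "\<dots> \<le> (real CARD('n) + 1) ^ M * ?s"
  proof (rule mult_left_mono)
    show "?t ^ M \<le> ?s"
    proof (cases "\<bar>x $ j\<bar> \<le> 1")
      case True
      then show ?thesis using s[OF mi_upto_0] by (simp add: xpow_0 max_def)
    next
      case False
      have "(\<lambda>i. if i = j then M else 0) \<in> mi_upto M" by (simp add: mi_upto_def mi_abs_single)
      from s[OF this] show ?thesis using False by (simp add: xpow_single power_abs max_def)
    qed
  qed simp
  finally show ?thesis .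
qed

text \<open>A point with 2^n \<le> 1 + |x| < 2^(n+1) lies in the ball of radius 2^(n+1), and its
  weight is at most 2^(-nM). In dimension d the volume is of order 2^(nd), so the resulting series
  is geometric with ratio 2^(d-M) < 1.\<close>

lemma weight_integrable:
  assumes M: "CARD('n::finite) < M"
  shows "(\<integral>\<^sup>+x. ennreal (1 / (1 + norm x) ^ M) \<partial>(lborel :: (real^'n) measure)) < \<infinity>"
proof -
  let ?d = "CARD('n)"
  let ?V = "unit_ball_vol (real ?d)"
  let ?f = "\<lambda>n x. ennreal ((1/2) ^ (n * M)) * indicator (cball 0 (2 ^ Suc n)) (x :: real^'n)"
  have pw: "ennreal (1 / (1 + norm x) ^ M) \<le> (\<Sum>n. ?f n x)" for x :: "real^'n"
  proof -
    obtain n0 where n0: "1 + norm x < 2 ^ n0" using real_arch_pow[of 2 "1 + norm x"] by auto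
    define N where "N = (LEAST n. 1 + norm x < 2 ^ n)"
    have N: "1 + norm x < 2 ^ N" unfolding N_def by (rule LeastI[of _ n0]) (rule n0)
    have "N \<noteq> 0"
    proof
      assume "N = 0" then show False using N by simp
    qed
    then obtain n where n: "N = Suc n" by (cases N) auto
    have "\<not> 1 + norm x < 2 ^ n" unfolding N_def[symmetric] using not_less_Least[of n "\<lambda>n. 1 + norm x < 2 ^ n"] n by (simp add: N_def)
    then have "(2 ^ n) ^ M \<le> (1 + norm x) ^ M" by (intro power_mono) auto
    then have "1 / (1 + norm x) ^ M \<le> 1 / (2 ^ n) ^ M"
      by (intro divide_left_mono mult_pos_pos zero_less_power add_pos_nonneg) auto
    also have "\<dots> = (1/2) ^ (n * M)" by (simp add: power_mult power_one_over)
    finally have "ennreal (1 / (1 + norm x) ^ M) \<le> ?f n x" using N n by (simp add: ennreal_leI)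
    also have "?f n x \<le> (\<Sum>i. ?f i x)"
    proof -
      define F where "F i = ?f i x" for i
      have "sum F {n} \<le> suminf F" by (rule sum_le_suminf[OF summableI]) auto
      then show ?thesis unfolding F_def by (simp only: sum.insert finite.emptyI empty_iff not_False_eq_True sum.empty add_0_right)
    qed
    finally show ?thesis .
  qed
  let ?r = "(1/2::real) ^ (M - ?d)"
  have r: "0 \<le> ?r" "?r < 1" using M by (auto simp: power_less_one_iff)
  have em: "ennreal ((1/2) ^ (n * M)) * emeasure lborel (cball (0::real^'n) (2 ^ Suc n)) = ennreal (?V * 2 ^ ?d * ?r ^ n)" for n
  proof -
    have "(1/2::real) ^ (n * M) = ?r ^ n * (1/2) ^ (n * ?d)"
      using M by (simp add: power_mult[symmetric] power_add[symmetric] add_mult_distrib2[symmetric] mult.commute)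
    moreover have "(2::real) ^ (n * ?d) * (1/2) ^ (n * ?d) = 1"
      by (simp add: power_mult_distrib[symmetric])
    ultimately have "(1/2) ^ (n * M) * (?V * (2 ^ Suc n) ^ ?d) = ?V * 2 ^ ?d * ?r ^ n"
      by (simp add: power_mult[symmetric] power_add mult_ac)
    then show ?thesis
      by (subst emeasure_cball) (auto simp: ennreal_mult[symmetric] unit_ball_vol_nonneg simp del: power_Suc)
  qed
  have "(\<integral>\<^sup>+x. ennreal (1 / (1 + norm x) ^ M) \<partial>(lborel :: (real^'n) measure)) \<le> (\<integral>\<^sup>+x. (\<Sum>n. ?f n x) \<partial>lborel)"
    by (intro nn_integral_mono pw)
  also have "\<dots> = (\<Sum>n. \<integral>\<^sup>+x. ?f n x \<partial>lborel)"
  proof (rule nn_integral_suminf)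
    fix n
    have "?f n \<in> borel_measurable borel"
      by (intro borel_measurable_times_ennreal borel_measurable_const borel_measurable_indicator) auto
    then show "?f n \<in> borel_measurable lborel" by (simp del: power_Suc)
  qed
  also have "\<dots> = (\<Sum>n. ennreal (?V * 2 ^ ?d * ?r ^ n))"
    by (subst nn_integral_cmult_indicator) (simp_all add: em del: power_Suc)
  also have "\<dots> < \<infinity>"
  proof -
    have "summable (\<lambda>n. ?V * 2 ^ ?d * ?r ^ n)" by (intro summable_mult summable_geometric) (use r in simp)
    then have "(\<Sum>n. ennreal (?V * 2 ^ ?d * ?r ^ n)) \<noteq> top"
      by (rule ennreal_suminf_neq_top) (use r in simp)
    then show ?thesis by (simp only: infinity_ennreal_def less_top)
  qed
  finally show ?thesis .
qed

lemma loc_int_mult_continuous: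
  fixes w f :: "real^'n::finite \<Rightarrow> real"
  assumes w: "continuous_on UNIV w" and f: "loc_int f"
  shows "loc_int (\<lambda>x. w x * f x)"
  unfolding loc_int_def set_integrable_def
proof (intro conjI allI impI)
  have fm: "f \<in> borel_measurable borel" using f loc_int_def by auto
  have wm: "w \<in> borel_measurable borel" by (rule borel_measurable_continuous_onI[OF w])
  have wf: "(\<lambda>x. w x * f x) \<in> borel_measurable borel" by (intro borel_measurable_times fm wm)
  then show "(\<lambda>x. w x * f x) \<in> borel_measurable lborel" by simp
  fix K :: "(real^'n) set" assume K: "compact K"
  have Kb: "K \<in> sets borel" using K borel_compact by blast
  have "compact (w ` K)" by (intro compact_continuous_image continuous_on_subset[OF w] K) auto
  then obtain B where B: "\<And>y. y \<in> w ` K \<Longrightarrow> norm y \<le> B" using compact_imp_bounded bounded_iff by metis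
  have "integrable lborel (\<lambda>x. B * (indicator K x *\<^sub>R f x))"
    using f K by (intro integrable_mult_right) (auto simp: loc_int_def set_integrable_def)
  then show "integrable lborel (\<lambda>x. indicator K x *\<^sub>R (w x * f x))"
  proof (rule Bochner_Integration.integrable_bound)
    have "(\<lambda>x. indicator K x *\<^sub>R (w x * f x)) \<in> borel_measurable borel"
      by (intro borel_measurable_scaleR borel_measurable_indicator Kb wf)
    then show "(\<lambda>x. indicator K x *\<^sub>R (w x * f x)) \<in> borel_measurable lborel" by simp
    show "AE x in lborel. norm (indicator K x *\<^sub>R (w x * f x)) \<le> norm (B * (indicator K x *\<^sub>R f x))"
    proof (intro always_eventually allI)
      fix x show "norm (indicator K x *\<^sub>R (w x * f x)) \<le> norm (B * (indicator K x *\<^sub>R f x))"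
      proof (cases "x \<in> K")
        case True
        then have "\<bar>w x\<bar> \<le> \<bar>B\<bar>" using B[of "w x"] by auto
        then show ?thesis using True by (simp add: abs_mult mult_right_mono)
      qed simp
    qed
  qed
qed

text \<open>The monomial weights of \<open>wsob\<close> are exchanged for a radial weight, which is
  comparable at neighbouring points and so passes through a convolution.\<close>

lemma wsob_weighted:
  fixes f :: "real^'n::finite \<Rightarrow> real"
  assumes e: "young e" and fin: "wsob K M e f < \<infinity>" and a: "a \<in> mi_upto K"
  shows "orlicz e (\<lambda>x. (1 + norm x) ^ M * wd a f x) < \<infinity>"
proof -
  have ex: "\<forall>a \<in> mi_upto K. \<exists>g. weak_deriv a f g"
    using fin unfolding wsob_def by (auto split: if_splits)
  have "loc_int (wd a f)" using wsobD(1)[OF fin a] weak_deriv_def by blast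
  then have Fm: "wd a f \<in> borel_measurable borel" using loc_int_def by auto
  have xm: "xpow g \<in> borel_measurable borel" for g :: "'n \<Rightarrow> nat"
    unfolding xpow_def[abs_def] by (intro borel_measurable_continuous_onI continuous_intros)
  let ?k = "(real CARD('n) + 1) ^ M"
  have each: "orlicz e (\<lambda>x. xpow g x * wd a f x) < \<infinity>" if g: "g \<in> mi_upto M" for g
  proof -
    have "orlicz e (\<lambda>x. xpow g x * wd a f x) \<le> (\<Sum>a\<in>mi_upto K. orlicz e (\<lambda>x. xpow g x * wd a f x))"
      by (rule member_le_sum[OF a]) (auto simp: finite_mi_upto)
    also have "\<dots> \<le> (\<Sum>g\<in>mi_upto M. \<Sum>a\<in>mi_upto K. orlicz e (\<lambda>x. xpow g x * wd a f x))"
      by (rule member_le_sum[OF g]) (auto simp: finite_mi_upto)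
    also have "\<dots> = wsob K M e f" using ex by (simp add: wsob_def)
    finally show ?thesis using fin by (rule order_le_less_trans)
  qed
  have "orlicz e (\<lambda>x. (1 + norm x) ^ M * wd a f x) \<le> (\<Sum>g\<in>mi_upto M. orlicz e (\<lambda>x. ?k * (xpow g x * wd a f x)))"
  proof (rule orlicz_sum[OF e finite_mi_upto])
    show "(\<lambda>x. ?k * (xpow g x * wd a f x)) \<in> borel_measurable borel" for g
      by (intro borel_measurable_times borel_measurable_const xm Fm)
    show "AE x in lborel. \<bar>(1 + norm x) ^ M * wd a f x\<bar> \<le> (\<Sum>g\<in>mi_upto M. \<bar>?k * (xpow g x * wd a f x)\<bar>)"
    proof (intro always_eventually allI)
      fix x
      have "\<bar>(1 + norm x) ^ M * wd a f x\<bar> = (1 + norm x) ^ M * \<bar>wd a f x\<bar>" by (simp add: abs_mult)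
      also have "\<dots> \<le> (?k * (\<Sum>g\<in>mi_upto M. \<bar>xpow g x\<bar>)) * \<bar>wd a f x\<bar>"
        by (intro mult_right_mono weight_le_xpow) simp
      also have "\<dots> = (\<Sum>g\<in>mi_upto M. \<bar>?k * (xpow g x * wd a f x)\<bar>)"
        by (simp add: sum_distrib_left sum_distrib_right abs_mult mult.assoc)
      finally show "\<bar>(1 + norm x) ^ M * wd a f x\<bar> \<le> (\<Sum>g\<in>mi_upto M. \<bar>?k * (xpow g x * wd a f x)\<bar>)" .
    qed
  qed
  also have "\<dots> \<le> (\<Sum>g\<in>mi_upto M. ennreal \<bar>?k\<bar> * orlicz e (\<lambda>x. xpow g x * wd a f x))"
    by (intro sum_mono orlicz_cmult[OF e])
  also have "\<dots> < \<infinity>" using each by (simp add: finite_mi_upto ennreal_mult_less_top)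
  finally show ?thesis .
qed

text \<open>\<open>wd a f\<close> is (1 + |x|)^(-M) times the weighted derivative, and this negative
  power is an integrable weight because M exceeds the dimension. With M = 2m this is where m > d/2
  enters.\<close>

lemma wsob_integrable:
  fixes f :: "real^'n::finite \<Rightarrow> real"
  assumes e: "young e" and fin: "wsob K M e f < \<infinity>" and a: "a \<in> mi_upto K" and M: "CARD('n) < M"
  shows "integrable lborel (wd a f)"
proof -
  have "loc_int (wd a f)" using wsobD(1)[OF fin a] weak_deriv_def by blast
  then have Fm[measurable]: "wd a f \<in> borel_measurable borel" using loc_int_def by auto
  let ?w = "\<lambda>x :: real^'n. 1 / (1 + norm x) ^ M"
  have pos: "0 < (1 + norm x) ^ M" for x :: "real^'n" by (intro zero_less_power add_pos_nonneg) auto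
  have "(\<integral>\<^sup>+x. ennreal (norm (wd a f x)) \<partial>lborel) = (\<integral>\<^sup>+x. ennreal (?w x * \<bar>(1 + norm x) ^ M * wd a f x\<bar>) \<partial>lborel)"
  proof (intro nn_integral_cong arg_cong[where f = ennreal])
    fix x show "norm (wd a f x) = ?w x * \<bar>(1 + norm x) ^ M * wd a f x\<bar>"
    proof -
      have "1 + norm x \<noteq> 0" using norm_ge_zero[of x] by linarith
      then show ?thesis by (simp add: abs_mult)
    qed
  qed
  also have "\<dots> \<le> ((\<integral>\<^sup>+x. ennreal (?w x) \<partial>lborel) + ennreal (1 / e 1)) * orlicz e (\<lambda>x. (1 + norm x) ^ M * wd a f x)"
  proof (rule weighted_L1_le_orlicz[OF e])
    show "?w x \<le> 1" for x
      using one_le_power[of "1 + norm x" M] pos[of x] by (simp only: divide_le_eq_1_pos) simp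
    show "(\<integral>\<^sup>+x. ennreal (?w x) \<partial>lborel) < \<infinity>" by (rule weight_integrable[OF M])
  qed simp_all
  also have "\<dots> < \<infinity>" using weight_integrable[OF M] wsob_weighted[OF e fin a] by (simp add: ennreal_mult_less_top)
  finally show ?thesis by (subst integrable_iff_bounded) simp
qed

lemma weak_deriv_zero: "loc_int f \<Longrightarrow> weak_deriv (\<lambda>_. 0) f f"
  by (simp add: weak_deriv_def Dm_0 mi_abs_def)

text \<open>At most s derivatives are absorbed by \<open>f\<close> and at most t fall on the kernel,
  at the price \<delta>^(-t). The radial weight is carried inside the convolution, since the kernels
  at all scales \<delta> \<le> 1 are supported in one ball of radius r.\<close>

lemma wsob_regularised_term:
  fixes f :: "real^'n::finite \<Rightarrow> real"
  assumes e: "young e" and fin: "wsob s M e f < \<infinity>" and H: "csm H" and b: "mi_abs b \<le> s + t"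
  shows "\<exists>c\<ge>0. \<forall>g\<in>mi_upto M. \<forall>\<delta>. 0 < \<delta> \<longrightarrow> \<delta> \<le> 1 \<longrightarrow>
    orlicz e (\<lambda>x. xpow g x * conv lborel f (tens (dv b (scs \<delta> (\<lambda>_. H)))) x) \<le> ennreal (c / \<delta> ^ t)"
proof -
  obtain b1 b2 where b12: "b = (\<lambda>i. b1 i + b2 i)" "mi_abs b1 \<le> s" "mi_abs b2 \<le> t" using mi_split[OF b] by blast
  let ?H = "\<lambda>_::'n. H"
  have hH: "csms ?H" using H by simp
  have b1: "b1 \<in> mi_upto s" using b12 by (simp add: mi_upto_def)
  let ?F = "wd b1 f"
  have wF: "weak_deriv b1 f ?F" by (rule wsobD(1)[OF fin b1])
  have lF: "loc_int ?F" using wF weak_deriv_def by blast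
  obtain r where r: "r > 0" "\<And>z. r < norm z \<Longrightarrow> tens (dv b2 ?H) z = 0" using tens_support[OF csms_dv[OF hH]] by blast
  let ?W = "\<lambda>x. (1 + norm x) ^ M * ?F x"
  have lW: "loc_int ?W" by (intro loc_int_mult_continuous lF continuous_intros)
  obtain o' where o': "orlicz e ?W = ennreal o'" "0 \<le> o'"
    using wsob_weighted[OF e fin b1] by (cases "orlicz e ?W") auto
  let ?L = "L1t (dv b2 ?H) + 1"
  have L: "?L > 0" using L1t_nonneg[of "dv b2 ?H"] by simp
  let ?c = "(1 + r) ^ M * ?L * o'"
  show ?thesis
  proof (intro exI[of _ ?c] conjI ballI allI impI)
    show "0 \<le> ?c" using r(1) L o' by (intro mult_nonneg_nonneg) auto
    fix g :: "'n \<Rightarrow> nat" and \<delta> :: real assume g: "g \<in> mi_upto M" and d: "0 < \<delta>" "\<delta> \<le> 1"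
    let ?h = "dv b2 (scs \<delta> ?H)"
    have hs: "csms ?h" by (intro csms_dv csms_scs d hH)
    note tm = tens_measurable[OF hs]
    \<comment> \<open>For \<delta> \<le> 1 division by \<delta> only increases the norm, so the
      rescaled kernel vanishes wherever the unscaled one does by its radius r.\<close>
    have hsup: "tens ?h z = 0" if "r < norm z" for z
    proof -
      have "norm z \<le> norm (inverse \<delta> *\<^sub>R z)"
        using d mult_right_mono[of \<delta> 1 "norm z"] by (simp add: field_simps)
      then have "tens (dv b2 ?H) (inverse \<delta> *\<^sub>R z) = 0" using that by (intro r(2)) simp
      then show ?thesis using d by (simp add: tens_dv_scs hH tens_scs)
    qed
    have eq: "conv lborel f (tens (dv b (scs \<delta> ?H))) = conv lborel ?F (tens ?h)"
      unfolding b12(1) dv_dv[symmetric] by (rule conv_weak_deriv[OF wF hs])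
    let ?G = "\<lambda>x. \<integral>y. \<bar>?W y\<bar> * \<bar>tens ?h (x - y)\<bar> \<partial>lborel"
    have iW: "integrable lborel (\<lambda>y. \<bar>?W y\<bar> * \<bar>tens ?h (x - y)\<bar>)" for x
      using integrable_abs[OF conv_integrable[OF locint_loc_int[OF lW] hs, of x]] by (simp only: abs_mult)
    have iF: "integrable lborel (\<lambda>y. \<bar>?F y\<bar> * \<bar>tens ?h (x - y)\<bar>)" for x
      using integrable_abs[OF conv_integrable[OF locint_loc_int[OF lF] hs, of x]] by (simp only: abs_mult)
    have pw: "\<bar>xpow g x * conv lborel ?F (tens ?h) x\<bar> \<le> \<bar>(1 + r) ^ M * ?G x\<bar>" for x
    proof -
      have "\<bar>xpow g x\<bar> \<le> (1 + norm x) ^ mi_abs g" by (rule xpow_bound)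
      also have "\<dots> \<le> (1 + norm x) ^ M" using g by (intro power_increasing) (auto simp: mi_upto_def)
      finally have x1: "\<bar>xpow g x\<bar> \<le> (1 + norm x) ^ M" .
      have x2: "\<bar>conv lborel ?F (tens ?h) x\<bar> \<le> (\<integral>y. \<bar>?F y\<bar> * \<bar>tens ?h (x - y)\<bar> \<partial>lborel)"
        unfolding conv_def abs_mult[symmetric] by (rule integral_abs_bound)
      have "\<bar>xpow g x * conv lborel ?F (tens ?h) x\<bar> \<le> (1 + norm x) ^ M * (\<integral>y. \<bar>?F y\<bar> * \<bar>tens ?h (x - y)\<bar> \<partial>lborel)"
        unfolding abs_mult by (intro mult_mono x1 x2) auto
      also have "\<dots> = (\<integral>y. (1 + norm x) ^ M * (\<bar>?F y\<bar> * \<bar>tens ?h (x - y)\<bar>) \<partial>lborel)" by simp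
      also have "\<dots> \<le> (\<integral>y. (1 + r) ^ M * (\<bar>?W y\<bar> * \<bar>tens ?h (x - y)\<bar>) \<partial>lborel)"
      proof (rule integral_mono[OF integrable_mult_right[OF iF] integrable_mult_right[OF iW]])
        fix y
        show "(1 + norm x) ^ M * (\<bar>?F y\<bar> * \<bar>tens ?h (x - y)\<bar>) \<le> (1 + r) ^ M * (\<bar>?W y\<bar> * \<bar>tens ?h (x - y)\<bar>)"
        proof (cases "r < norm (x - y)")
          case True then show ?thesis by (simp add: hsup)
        next
          case False
          have "norm x \<le> norm (x - y) + norm y" using norm_triangle_ineq[of "x - y" y] by simp
          \<comment> \<open>On the support of the kernel |x - y| \<le> r, so moving the weight from
            x to y costs only the factor 1 + r.\<close>
          have "1 + norm x \<le> (1 + r) * (1 + norm y)"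
          proof -
            have "0 \<le> r * norm y" using r(1) by (intro mult_nonneg_nonneg) auto
            moreover have "(1 + r) * (1 + norm y) = 1 + r + norm y + r * norm y" by (simp add: algebra_simps)
            ultimately show ?thesis using False \<open>norm x \<le> norm (x - y) + norm y\<close> by linarith
          qed
          then have "(1 + norm x) ^ M \<le> ((1 + r) * (1 + norm y)) ^ M" by (intro power_mono) auto
          then have "(1 + norm x) ^ M * (\<bar>?F y\<bar> * \<bar>tens ?h (x - y)\<bar>) \<le> ((1 + r) * (1 + norm y)) ^ M * (\<bar>?F y\<bar> * \<bar>tens ?h (x - y)\<bar>)"
            by (intro mult_right_mono) auto
          then show ?thesis by (simp add: power_mult_distrib abs_mult mult_ac)
        qed
      qed
      also have "\<dots> = (1 + r) ^ M * ?G x" by simp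
      finally show ?thesis by simp
    qed
    have "orlicz e (\<lambda>x. xpow g x * conv lborel ?F (tens ?h) x) \<le> orlicz e (\<lambda>x. (1 + r) ^ M * ?G x)"
      by (rule orlicz_mono[OF e]) (intro always_eventually allI pw)
    also have "\<dots> \<le> ennreal \<bar>(1 + r) ^ M\<bar> * orlicz e ?G" by (rule orlicz_cmult[OF e])
    also have "\<dots> \<le> ennreal \<bar>(1 + r) ^ M\<bar> * (ennreal (?L / \<delta> ^ t) * orlicz e ?W)"
    proof (rule mult_left_mono[OF orlicz_convolution[OF e lW hs]])
      show "0 < ?L / \<delta> ^ t" using L d by simp
      have "\<delta> ^ t \<le> \<delta> ^ mi_abs b2" using d b12 by (intro power_decreasing) auto
      then have "L1t (dv b2 ?H) / \<delta> ^ mi_abs b2 \<le> ?L / \<delta> ^ t"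
        using d L1t_nonneg[of "dv b2 ?H"] by (intro frac_le) auto
      then show "L1t ?h \<le> ?L / \<delta> ^ t" using d by (simp add: L1t_dv_scs hH)
    qed simp
    also have "\<dots> = ennreal (?c / \<delta> ^ t)"
    proof -
      have n: "0 \<le> (1 + r) ^ M" "0 \<le> ?L / \<delta> ^ t" using r(1) L d by auto
      have "ennreal \<bar>(1 + r) ^ M\<bar> * (ennreal (?L / \<delta> ^ t) * ennreal o') = ennreal ((1 + r) ^ M * (?L / \<delta> ^ t * o'))"
        by (simp only: abs_of_nonneg[OF n(1)] ennreal_mult[OF n(1) mult_nonneg_nonneg[OF n(2) o'(2)]] ennreal_mult[OF n(2) o'(2)])
      then show ?thesis unfolding o'(1) by (simp add: mult.assoc)
    qed
    finally show "orlicz e (\<lambda>x. xpow g x * conv lborel f (tens (dv b (scs \<delta> ?H))) x) \<le> ennreal (?c / \<delta> ^ t)"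
      unfolding eq .
  qed
qed

lemma wsob_regularised:
  fixes f :: "real^'n::finite \<Rightarrow> real"
  assumes e: "young e" and fin: "wsob s M e f < \<infinity>" and H: "csm H" and lf: "loc_int f"
  obtains C where "C > 0"
    "\<And>\<delta> p. 0 < \<delta> \<Longrightarrow> \<delta> \<le> 1 \<Longrightarrow> p \<in> borel_measurable borel \<Longrightarrow>
      AE x in lborel. conv lborel f (tens (scs \<delta> (\<lambda>_. H))) x = p x \<Longrightarrow> wsob (s + t) M e p \<le> ennreal (C / \<delta> ^ t)"
proof -
  let ?H = "\<lambda>_::'n. H"
  let ?I = "mi_upto (s + t) :: ('n \<Rightarrow> nat) set" and ?J = "mi_upto M :: ('n \<Rightarrow> nat) set"
  have "\<forall>b\<in>?I. \<exists>c. c \<ge> 0 \<and> (\<forall>g\<in>?J. \<forall>\<delta>. 0 < \<delta> \<longrightarrow> \<delta> \<le> 1 \<longrightarrow>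
    orlicz e (\<lambda>x. xpow g x * conv lborel f (tens (dv b (scs \<delta> ?H))) x) \<le> ennreal (c / \<delta> ^ t))"
    using wsob_regularised_term[OF e fin H] by (auto simp: mi_upto_def)
  from bchoice[OF this] obtain c where c0: "\<And>b. b \<in> ?I \<Longrightarrow> 0 \<le> c b" and
    c: "\<And>b g \<delta>. b \<in> ?I \<Longrightarrow> g \<in> ?J \<Longrightarrow> 0 < \<delta> \<Longrightarrow> \<delta> \<le> 1 \<Longrightarrow>
      orlicz e (\<lambda>x. xpow g x * conv lborel f (tens (dv b (scs \<delta> ?H))) x) \<le> ennreal (c b / \<delta> ^ t)"
    by blast
  define C where "C = 1 + (\<Sum>g\<in>?J. \<Sum>b\<in>?I. c b)"
  have "0 \<le> (\<Sum>g\<in>?J. \<Sum>b\<in>?I. c b)" by (intro sum_nonneg c0)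
  then have C: "C > 0" by (simp add: C_def)
  have "wsob (s + t) M e p \<le> ennreal (C / \<delta> ^ t)"
    if d: "0 < \<delta>" "\<delta> \<le> 1" and p: "p \<in> borel_measurable borel" "AE x in lborel. conv lborel f (tens (scs \<delta> ?H)) x = p x" for \<delta> p
  proof -
    have hs: "csms (scs \<delta> ?H)" using H d by (intro csms_scs) auto
    have w: "weak_deriv b p (conv lborel f (tens (dv b (scs \<delta> ?H))))" for b
      by (rule weak_deriv_AE[OF weak_deriv_smooth_conv[OF locint_loc_int[OF lf] hs] p])
    have "wsob (s + t) M e p = (\<Sum>g\<in>?J. \<Sum>b\<in>?I. orlicz e (\<lambda>x. xpow g x * wd b p x))"
      unfolding wsob_def using w by auto
    also have "\<dots> = (\<Sum>g\<in>?J. \<Sum>b\<in>?I. orlicz e (\<lambda>x. xpow g x * conv lborel f (tens (dv b (scs \<delta> ?H))) x))"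
    proof (intro sum.cong refl orlicz_AE_cong[OF e])
      fix g b :: "'n \<Rightarrow> nat"
      show "AE x in lborel. xpow g x * wd b p x = xpow g x * conv lborel f (tens (dv b (scs \<delta> ?H))) x"
        using wd_AE[OF w[of b]] by eventually_elim simp
    qed
    also have "\<dots> \<le> (\<Sum>g\<in>?J. \<Sum>b\<in>?I. ennreal (c b / \<delta> ^ t))" by (intro sum_mono c d)
    also have "\<dots> = ennreal (\<Sum>g\<in>?J. \<Sum>b\<in>?I. c b / \<delta> ^ t)"
    proof -
      have "(\<Sum>b\<in>?I. ennreal (c b / \<delta> ^ t)) = ennreal (\<Sum>b\<in>?I. c b / \<delta> ^ t)"
        using c0 d by (intro sum_ennreal) auto
      then show ?thesis using c0 d by (simp only:) (intro sum_ennreal sum_nonneg, auto)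
    qed
    also have "\<dots> \<le> ennreal (C / \<delta> ^ t)"
      unfolding sum_divide_distrib[symmetric] C_def using d by (intro ennreal_leI divide_right_mono) auto
    finally show ?thesis .
  qed
  then show ?thesis using that[OF C] by blast
qed

section \<open>Approximation rate in the distance\<close>

lemma conv_smooth_by_parts:
  fixes \<phi> :: "real^'n::finite \<Rightarrow> real"
  assumes \<phi>: "smooth \<phi>" and B: "\<And>x. \<bar>Dm (\<lambda>i. if i = j then k else 0) \<phi> x\<bar> \<le> 1" and hs: "csms hs"
  shows "\<bar>conv lborel \<phi> (tens (rf 0 (dv (\<lambda>i. if i = j then k else 0) hs))) y\<bar> \<le> L1t hs"
proof -
  let ?b = "\<lambda>i. if i = j then k else 0"
  let ?h = "rf y (rf 0 hs)"
  have h: "csms ?h" by (intro csms_rf hs)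
  obtain r where r: "\<And>x. r < norm x \<Longrightarrow> tens ?h x = 0" using tens_support[OF h] by blast
  have th: "tens ?h x = tens hs (x - y)" for x by (simp add: tens_rf)
  have tb: "pderivs (mi_list ?b) (tens ?h) x = tens (rf 0 (dv ?b hs)) (y - x)" for x
  proof -
    have "pderivs (mi_list ?b) (tens ?h) x = tens (dv ?b ?h) x" using Dm_tens[OF h, of ?b] by (simp add: Dm_def)
    also have "\<dots> = (-1) ^ mi_abs ?b * ((-1) ^ mi_abs ?b * tens (dv ?b hs) (x - y))"
      by (simp add: tens_dv_rf csms_rf hs)
    also have "\<dots> = tens (dv ?b hs) (x - y)" by (simp add: power_mult_distrib[symmetric] flip: mult.assoc)
    finally show ?thesis by (simp add: tens_rf)
  qed
  have "conv lborel \<phi> (tens (rf 0 (dv ?b hs))) y = (\<integral>x. \<phi> x * pderivs (mi_list ?b) (tens ?h) x \<partial>lborel)"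
    by (simp add: conv_def tb)
  also have "\<dots> = (-1) ^ length (mi_list ?b) * (\<integral>x. pderivs (rev (mi_list ?b)) \<phi> x * tens ?h x \<partial>lborel)"
    by (rule integral_by_parts_pderivs[OF \<phi> smooth_tens[OF h] r])
  \<comment> \<open>The list repeats a single direction, so it equals its reversal.\<close>
  also have "pderivs (rev (mi_list ?b)) \<phi> = Dm ?b \<phi>" by (simp add: Dm_def mi_list_single)
  finally have "\<bar>conv lborel \<phi> (tens (rf 0 (dv ?b hs))) y\<bar> = \<bar>\<integral>x. Dm ?b \<phi> x * tens ?h x \<partial>lborel\<bar>"
    by (simp add: abs_mult power_abs)
  also have "\<dots> \<le> (\<integral>x. \<bar>Dm ?b \<phi> x * tens ?h x\<bar> \<partial>lborel)" by (rule integral_abs_bound)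
  also have "\<dots> \<le> (\<integral>x. \<bar>tens ?h x\<bar> \<partial>lborel)"
  proof (rule integral_mono)
    have "smooth (Dm ?b \<phi>)" unfolding Dm_def by (rule smooth_pderivs[OF \<phi>])
    then have "integrable lborel (\<lambda>x. Dm ?b \<phi> x * tens ?h x)"
      using r by (intro integrable_continuous_support[where r = r] continuous_on_mult smooth_continuous tens_continuous h) auto
    then show "integrable lborel (\<lambda>x. \<bar>Dm ?b \<phi> x * tens ?h x\<bar>)" by (rule integrable_abs)
    show "integrable lborel (\<lambda>x. \<bar>tens ?h x\<bar>)" by (intro integrable_abs tens_integrable h)
    fix x show "\<bar>Dm ?b \<phi> x * tens ?h x\<bar> \<le> \<bar>tens ?h x\<bar>"
      unfolding abs_mult using B[of x] mult_right_mono[of "\<bar>Dm ?b \<phi> x\<bar>" 1 "\<bar>tens ?h x\<bar>"] by simp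
  qed
  also have "\<dots> = L1t hs"
    unfolding th L1t_def using integral_lborel_translate[of "\<lambda>x. \<bar>tens hs x\<bar>" "- y"] tens_measurable[OF hs] by simp
  finally show ?thesis .
qed

lemma conv_integrable_lborel:
  "integrable lborel f \<Longrightarrow> csms hs \<Longrightarrow> integrable lborel (conv lborel f (tens hs))"
  using conv_fubini(2)[OF lborel.sigma_finite_measure_axioms _ _ _ _ , of f hs "\<lambda>_. 1" 1] by simp

text \<open>The N = s + k pure derivatives in the direction \<open>dir j\<close> are shared between
  the weak derivative \<open>F\<close> and the test function, which leaves an undifferentiated
  kernel whose L^1 norm is independent of the scale. Repeated halving with a geometric sum then
  reaches \<open>f\<close> itself.\<close>

lemma dk_regularised:
  fixes f :: "real^'n::finite \<Rightarrow> real" and \<Gamma> :: "nat \<Rightarrow> 'n \<Rightarrow> real \<Rightarrow> real"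
  assumes ks: "kernel_system (s + k) H \<Gamma> dir"
    and s: "s \<ge> 1" and f: "integrable lborel f"
    and wF: "\<And>j. weak_deriv (\<lambda>i. if i = j then s else 0) f (F j)" and F: "\<And>j. integrable lborel (F j)"
  obtains C where "C \<ge> 0"
    "\<And>\<delta>. 0 < \<delta> \<Longrightarrow> \<delta> \<le> 1 \<Longrightarrow> dk k (fmeas f) (fmeas (conv lborel f (tens (scs \<delta> (\<lambda>_. H))))) \<le> ennreal (C * \<delta> ^ (s + k))"
proof -
  note H = kernel_systemD(1,2)[OF ks] and \<Gamma> = kernel_systemD(3)[OF ks]
  let ?H = "\<lambda>_::'n. H" and ?N = "s + k"
  have hH: "csms ?H" using H by simp
  have lf: "loc_int f" by (rule loc_int_integrable[OF f])
  define A where "A = (\<Sum>j<CARD('n). L1t (\<Gamma> j) * (\<integral>y. \<bar>F (dir j) y\<bar> \<partial>lborel))"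
  have A: "A \<ge> 0" unfolding A_def by (intro sum_nonneg mult_nonneg_nonneg L1t_nonneg integral_nonneg_AE) auto
  let ?f = "\<lambda>\<delta>. conv lborel f (tens (scs \<delta> ?H))"
  have fi: "integrable lborel (?f \<delta>)" if "\<delta> > 0" for \<delta>
    by (intro conv_integrable_lborel f csms_scs that hH)
  \<comment> \<open>The factor 2 is the sum of the geometric series over the halvings.\<close>
  have "dk k (fmeas f) (fmeas (?f \<delta>)) \<le> ennreal (2 * A * \<delta> ^ ?N)" if d: "0 < \<delta>" "\<delta> \<le> 1" for \<delta>
    unfolding dk_def
  proof (rule SUP_least, clarify)
    fix \<phi> :: "real^'n \<Rightarrow> real" assume \<phi>: "smooth \<phi>" and cn: "cnorm k \<phi> \<le> 1"
    have \<phi>m: "\<phi> \<in> borel_measurable borel" by (rule smooth_measurable[OF \<phi>])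
    have \<phi>1: "\<bar>\<phi> x\<bar> \<le> 1" for x using cnorm_bound[OF cn mi_upto_0] by (simp add: Dm_0)
    define I where "I \<eta> = (\<integral>x. \<phi> x * ?f \<eta> x \<partial>lborel)" for \<eta>
    have step: "\<bar>I (\<eta>/2) - I \<eta>\<bar> \<le> A * \<eta> ^ ?N" if \<eta>: "\<eta> > 0" for \<eta>
    proof -
      let ?k = "\<lambda>j i. if i = dir j then k else 0"
      let ?h = "\<lambda>j. dv (?k j) (scs \<eta> (\<Gamma> j))"
      have h0: "csms (scs \<eta> (\<Gamma> j))" and h: "csms (?h j)" for j
        by (intro csms_dv csms_scs \<eta> \<Gamma>)+
      have diff: "?f (\<eta>/2) x - ?f \<eta> x = \<eta> ^ ?N * (\<Sum>j<CARD('n). conv lborel (F (dir j)) (tens (?h j)) x)" for x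
      proof -
        have "?f (\<eta>/2) x - ?f \<eta> x = \<eta> ^ ?N * (\<Sum>j<CARD('n). conv lborel f (tens (dv (\<lambda>i. 0 + (if i = dir j then ?N else 0)) (scs \<eta> (\<Gamma> j)))) x)"
          using conv_kernel_diff[OF ks \<eta> lf, of "\<lambda>_. 0" x] by (simp only: dv_0)
        moreover have "conv lborel f (tens (dv (\<lambda>i. 0 + (if i = dir j then ?N else 0)) (scs \<eta> (\<Gamma> j)))) = conv lborel (F (dir j)) (tens (?h j))" for j
        proof -
          have "(\<lambda>i. 0 + (if i = dir j then ?N else 0)) = (\<lambda>i. (if i = dir j then s else 0) + ?k j i)" by auto
          then show ?thesis using conv_weak_deriv[OF wF h, of "dir j" j] by (simp only: dv_dv)
        qed
        ultimately show ?thesis by (simp only:)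
      qed
      have ij: "integrable lborel (\<lambda>x. \<phi> x * conv lborel (F (dir j)) (tens (?h j)) x)"
        and fj: "(\<integral>x. \<phi> x * conv lborel (F (dir j)) (tens (?h j)) x \<partial>lborel)
           = (\<integral>y. F (dir j) y * conv lborel \<phi> (tens (rf 0 (?h j))) y \<partial>lborel)"
        and iy: "integrable lborel (\<lambda>y. F (dir j) y * conv lborel \<phi> (tens (rf 0 (?h j))) y)" for j
        using conv_fubini[OF lborel.sigma_finite_measure_axioms sets_lborel F h \<phi>m \<phi>1, of "dir j" j] by auto
      have bj: "\<bar>\<integral>x. \<phi> x * conv lborel (F (dir j)) (tens (?h j)) x \<partial>lborel\<bar> \<le> L1t (\<Gamma> j) * (\<integral>y. \<bar>F (dir j) y\<bar> \<partial>lborel)" for j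
      proof -
        have cb: "\<bar>conv lborel \<phi> (tens (rf 0 (?h j))) y\<bar> \<le> L1t (\<Gamma> j)" for y
        proof -
          have "?k j \<in> mi_upto k" by (simp add: mi_upto_def mi_abs_single)
          from conv_smooth_by_parts[OF \<phi> cnorm_bound[OF cn this] h0, where y = y]
          show ?thesis by (simp add: L1t_scs \<Gamma> \<eta>)
        qed
        have "\<bar>\<integral>y. F (dir j) y * conv lborel \<phi> (tens (rf 0 (?h j))) y \<partial>lborel\<bar>
          \<le> (\<integral>y. \<bar>F (dir j) y * conv lborel \<phi> (tens (rf 0 (?h j))) y\<bar> \<partial>lborel)" by (rule integral_abs_bound)
        also have "\<dots> \<le> (\<integral>y. L1t (\<Gamma> j) * \<bar>F (dir j) y\<bar> \<partial>lborel)"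
        proof (rule integral_mono)
          show "integrable lborel (\<lambda>y. \<bar>F (dir j) y * conv lborel \<phi> (tens (rf 0 (?h j))) y\<bar>)" by (rule integrable_abs[OF iy])
          show "integrable lborel (\<lambda>y. L1t (\<Gamma> j) * \<bar>F (dir j) y\<bar>)" by (intro integrable_mult_right integrable_abs F)
          fix y show "\<bar>F (dir j) y * conv lborel \<phi> (tens (rf 0 (?h j))) y\<bar> \<le> L1t (\<Gamma> j) * \<bar>F (dir j) y\<bar>"
            unfolding abs_mult mult.commute[of "\<bar>F (dir j) y\<bar>"] by (intro mult_right_mono cb) simp
        qed
        finally show ?thesis unfolding fj by simp
      qed
      have iphi: "integrable lborel (\<lambda>x. \<phi> x * ?f \<zeta> x)" if "\<zeta> > 0" for \<zeta>
        using conv_fubini(2)[OF lborel.sigma_finite_measure_axioms sets_lborel f csms_scs[OF that hH] \<phi>m \<phi>1] .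
      have "I (\<eta>/2) - I \<eta> = (\<integral>x. \<phi> x * ?f (\<eta>/2) x - \<phi> x * ?f \<eta> x \<partial>lborel)"
        unfolding I_def using iphi[of "\<eta>/2"] iphi[OF \<eta>] \<eta> by simp
      also have "\<dots> = (\<integral>x. \<eta> ^ ?N * (\<Sum>j<CARD('n). \<phi> x * conv lborel (F (dir j)) (tens (?h j)) x) \<partial>lborel)"
        unfolding right_diff_distrib[symmetric] diff
        by (intro Bochner_Integration.integral_cong) (auto simp: sum_distrib_left mult_ac)
      also have "\<dots> = \<eta> ^ ?N * (\<Sum>j<CARD('n). \<integral>x. \<phi> x * conv lborel (F (dir j)) (tens (?h j)) x \<partial>lborel)"
        unfolding integral_mult_right_zero by (subst Bochner_Integration.integral_sum) (auto intro: ij)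
      finally have "\<bar>I (\<eta>/2) - I \<eta>\<bar> = \<eta> ^ ?N * \<bar>\<Sum>j<CARD('n). \<integral>x. \<phi> x * conv lborel (F (dir j)) (tens (?h j)) x \<partial>lborel\<bar>"
        using \<eta> by (simp add: abs_mult power_abs)
      also have "\<dots> \<le> \<eta> ^ ?N * A"
        unfolding A_def using \<eta> by (intro mult_left_mono order_trans[OF sum_abs] sum_mono bj) auto
      finally show ?thesis by (simp add: mult.commute)
    qed
    define d where "d n = \<delta> * (1/2) ^ n" for n :: nat
    have dn: "d n > 0" "d (Suc n) = d n / 2" "d 0 = \<delta>" for n using d by (auto simp: d_def)
    have d0: "d \<longlonglongrightarrow> 0"
      unfolding d_def by (rule tendsto_mult_right_zero[OF LIMSEQ_power_zero]) simp
    have part: "\<bar>I (d n) - I \<delta>\<bar> \<le> 2 * A * \<delta> ^ ?N" for n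
    proof -
      have "\<bar>I (d n) - I \<delta>\<bar> \<le> A * \<delta> ^ ?N * (\<Sum>i<n. (1/2) ^ i)"
      proof (induction n)
        case 0 then show ?case by (simp add: dn)
      next
        case (Suc n)
        have "\<bar>I (d (Suc n)) - I \<delta>\<bar> \<le> \<bar>I (d n / 2) - I (d n)\<bar> + \<bar>I (d n) - I \<delta>\<bar>" by (simp add: dn)
        also have "\<bar>I (d n / 2) - I (d n)\<bar> \<le> A * d n ^ ?N" by (rule step[OF dn(1)])
        also have "A * d n ^ ?N \<le> A * (\<delta> ^ ?N * (1/2) ^ n)"
        proof (rule mult_left_mono[OF _ A])
          \<comment> \<open>Since s \<ge> 1 the exponent N is at least 1, so each halving gains at
            least a factor 1/2.\<close>
          have "((1/2::real) ^ n) ^ ?N \<le> ((1/2) ^ n) ^ 1"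
            using s by (intro power_decreasing) (auto simp: power_le_one)
          then show "d n ^ ?N \<le> \<delta> ^ ?N * (1/2) ^ n"
            unfolding d_def power_mult_distrib using d by (intro mult_left_mono) auto
        qed
        finally show ?case using Suc by (simp add: algebra_simps)
      qed
      also have "\<dots> \<le> A * \<delta> ^ ?N * 2"
      proof (rule mult_left_mono)
        have "(\<Sum>i<n. (1/2::real) ^ i) \<le> (\<Sum>i. (1/2) ^ i)"
          by (rule sum_le_suminf) (auto intro: summable_geometric)
        also have "\<dots> = 2" by (simp add: suminf_geometric)
        finally show "(\<Sum>i<n. (1/2::real) ^ i) \<le> 2" .
        show "0 \<le> A * \<delta> ^ ?N" using A d by simp
      qed
      finally show ?thesis by (simp add: mult_ac)
    qed
    have lim: "(\<lambda>n. I (d n)) \<longlonglongrightarrow> (\<integral>x. f x * \<phi> x \<partial>lborel)"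
    proof -
      have eq: "I (d n) = (\<integral>y. f y * conv lborel \<phi> (tens (rf 0 (scs (d n) ?H))) y \<partial>lborel)" for n
        unfolding I_def
        by (rule conv_fubini(1)[OF lborel.sigma_finite_measure_axioms sets_lborel f csms_scs[OF dn(1) hH] \<phi>m \<phi>1])
      have lp: "locint lborel \<phi>" by (intro locint_loc_int loc_int_bounded[OF \<phi>m \<phi>1])
      have fm: "f \<in> borel_measurable borel" using lf loc_int_def by auto
      have "(\<lambda>n. \<integral>y. f y * conv lborel \<phi> (tens (rf 0 (scs (d n) ?H))) y \<partial>lborel) \<longlonglongrightarrow> (\<integral>x. f x * \<phi> x \<partial>lborel)"
      proof (rule integral_dominated_convergence[where w = "\<lambda>y. L1t ?H * \<bar>f y\<bar>"])
        show "integrable lborel (\<lambda>y. L1t ?H * \<bar>f y\<bar>)" using f by (intro integrable_mult_right integrable_abs)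
        show "(\<lambda>x. f x * \<phi> x) \<in> borel_measurable lborel" using borel_measurable_times[OF fm \<phi>m] by simp
        show "(\<lambda>y. f y * conv lborel \<phi> (tens (rf 0 (scs (d n) ?H))) y) \<in> borel_measurable lborel" for n
          using borel_measurable_times[OF fm conv_measurable[OF lp csms_rf[OF csms_scs[OF dn(1) hH]]]] by simp
        show "AE y in lborel. (\<lambda>n. f y * conv lborel \<phi> (tens (rf 0 (scs (d n) ?H))) y) \<longlonglongrightarrow> f y * \<phi> y"
          by (intro always_eventually allI tendsto_mult tendsto_const conv_approx_identity[OF smooth_continuous[OF \<phi>] \<phi>1 H dn(1) d0])
        show "AE y in lborel. norm (f y * conv lborel \<phi> (tens (rf 0 (scs (d n) ?H))) y) \<le> L1t ?H * \<bar>f y\<bar>" for n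
        proof (intro always_eventually allI)
          fix y
          have "\<bar>conv lborel \<phi> (tens (rf 0 (scs (d n) ?H))) y\<bar> \<le> 1 * L1t (rf 0 (scs (d n) ?H))"
            by (rule conv_bounded[OF \<phi>m \<phi>1 csms_rf[OF csms_scs[OF dn(1) hH]]])
          also have "L1t (rf 0 (scs (d n) ?H)) = L1t ?H"
            using L1t_rf[OF csms_scs[OF dn(1)[of n] hH], of "\<lambda>_. 0" 0] L1t_scs[OF hH dn(1)[of n]] by (simp add: dv_0)
          finally have "\<bar>conv lborel \<phi> (tens (rf 0 (scs (d n) ?H))) y\<bar> * \<bar>f y\<bar> \<le> L1t ?H * \<bar>f y\<bar>"
            by (intro mult_right_mono) auto
          then show "norm (f y * conv lborel \<phi> (tens (rf 0 (scs (d n) ?H))) y) \<le> L1t ?H * \<bar>f y\<bar>"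
            by (simp add: abs_mult mult.commute)
        qed
      qed
      then show ?thesis unfolding eq .
    qed
    have "\<bar>(\<integral>x. f x * \<phi> x \<partial>lborel) - I \<delta>\<bar> \<le> 2 * A * \<delta> ^ ?N"
    proof (rule LIMSEQ_le_const2)
      show "(\<lambda>n. \<bar>I (d n) - I \<delta>\<bar>) \<longlonglongrightarrow> \<bar>(\<integral>x. f x * \<phi> x \<partial>lborel) - I \<delta>\<bar>"
        by (intro tendsto_rabs tendsto_diff lim tendsto_const)
    qed (use part in auto)
    moreover have "sint (fmeas f) \<phi> = (\<integral>x. f x * \<phi> x \<partial>lborel)"
      by (rule sint_density[OF fmeas_fsm[OF f] fmeas_density[OF f] \<phi>m \<phi>1])
    moreover have "sint (fmeas (?f \<delta>)) \<phi> = I \<delta>"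
      unfolding I_def sint_density[OF fmeas_fsm[OF fi[OF d(1)]] fmeas_density[OF fi[OF d(1)]] \<phi>m \<phi>1]
      by (simp only: mult.commute)
    ultimately show "ennreal \<bar>sint (fmeas f) \<phi> - sint (fmeas (?f \<delta>)) \<phi>\<bar> \<le> ennreal (2 * A * \<delta> ^ ?N)"
      by (intro ennreal_leI) simp
  qed
  then show ?thesis using that[of "2 * A"] A by simp
qed

section \<open>Powers against logarithms\<close>

lemma powr_ln_bounded:
  assumes \<epsilon>: "\<epsilon> > 0" and c: "c \<ge> 0" and R: "R \<ge> 1"
  shows "R powr (- \<epsilon>) * ln R powr c \<le> (((c + 1) / \<epsilon>) powr c :: real)"
proof -
  \<comment> \<open>With this exponent the bound ln R \<le> R^\<eta> / \<eta> costs only the power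
    \<eta> c < \<epsilon>; the summand 1 covers c = 0 as well.\<close>
  let ?\<eta> = "\<epsilon> / (c + 1)"
  have \<eta>: "?\<eta> > 0" using \<epsilon> c by simp
  have "ln R powr c \<le> (R powr ?\<eta> / ?\<eta>) powr c"
    using ln_powr_bound[OF R \<eta>] R c by (intro powr_mono2) auto
  also have "\<dots> = R powr (?\<eta> * c) * (1 / ?\<eta>) powr c"
    using \<eta> R by (simp add: powr_divide powr_powr powr_one_eq_one divide_inverse inverse_powr powr_mult)
  finally have "R powr (- \<epsilon>) * ln R powr c \<le> R powr (- \<epsilon>) * (R powr (?\<eta> * c) * (1 / ?\<eta>) powr c)"
    by (intro mult_left_mono) auto
  also have "\<dots> = R powr (- \<epsilon> + ?\<eta> * c) * (1 / ?\<eta>) powr c" by (simp only: powr_add mult.assoc)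
  also have "\<dots> \<le> 1 * (1 / ?\<eta>) powr c"
  proof (rule mult_right_mono)
    have "?\<eta> * c \<le> \<epsilon>" using \<epsilon> c by (simp add: field_simps)
    then have "R powr (- \<epsilon> + ?\<eta> * c) \<le> R powr 0" using R by (intro powr_mono) auto
    then show "R powr (- \<epsilon> + ?\<eta> * c) \<le> 1" using R by simp
  qed simp
  finally show ?thesis using \<epsilon> c by simp
qed

lemma beta_bound:
  assumes "e \<in> classE_ag al ga" and "young e"
  obtains C R0 where "C > 0" "\<And>R. R0 \<le> R \<Longrightarrow> beta e R \<le> C * (R powr al * ln R powr ga)"
proof -
  have "Limsup at_top (\<lambda>R. ereal (beta e R / (R powr al * ln R powr ga))) < \<infinity>"
    using assms by (simp add: classE_ag_def)
  then obtain c where "Limsup at_top (\<lambda>R. ereal (beta e R / (R powr al * ln R powr ga))) < ereal c"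
    using ereal_dense2 by blast
  then have "eventually (\<lambda>R. ereal (beta e R / (R powr al * ln R powr ga)) < ereal c) at_top" by (rule Limsup_lessD)
  then have "eventually (\<lambda>R. beta e R \<le> max c 1 * (R powr al * ln R powr ga)) at_top"
    using eventually_gt_at_top[of 1]
  proof eventually_elim
    case (elim R)
    have pos: "0 < R powr al * ln R powr ga" using elim by simp
    have "beta e R / (R powr al * ln R powr ga) \<le> max c 1" using elim by simp
    then show ?case using pos by (simp add: divide_le_eq)
  qed
  then obtain R0 where "\<And>R. R0 \<le> R \<Longrightarrow> beta e R \<le> max c 1 * (R powr al * ln R powr ga)"
    unfolding eventually_at_top_linorder by blast
  then show ?thesis by (intro that[of "max c 1" R0]) auto
qed

text \<open>For \<open>La 2 R\<close> = R (ln R)^2 the left side is at most a constant times R^(p -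
  1 - \<nu>) times a power of ln R, where p = p0 + d al. The strict inequality makes the exponent of
  R negative, and this absorbs all logarithms.\<close>

lemma rate_bounded:
  fixes d p0 \<nu> al ga :: real
  assumes e: "young e" and ag: "e \<in> classE_ag al ga" "0 \<le> al" "0 \<le> ga"
    and d: "d > 0" and p0: "p0 \<ge> 0" and neg: "p0 + d * al < 1 + \<nu>"
  obtains C R0 where "\<And>R. R0 \<le> R \<Longrightarrow> La 2 R powr p0 * beta e (La 2 R powr d) / R * R powr (- \<nu>) \<le> C"
proof -
  obtain C R1 where C: "C > 0" and R1: "\<And>R. R1 \<le> R \<Longrightarrow> beta e R \<le> C * (R powr al * ln R powr ga)"
    using beta_bound[OF ag(1) e] by blast
  let ?p = "p0 + d * al"
  let ?K = "C * (3 * d) powr ga"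
  let ?\<epsilon> = "1 + \<nu> - ?p" and ?c = "2 * ?p + ga"
  have p: "?p \<ge> 0" using p0 d ag by simp
  \<comment> \<open>Beyond exp 1 the logarithm is at least 1; the second entry makes
    \<open>La 2 R powr d\<close> reach the threshold R1 of \<open>beta_bound\<close>.\<close>
  define R0 where "R0 = max (exp 1) (max 1 R1 powr (1 / d))"
  have "La 2 R powr p0 * beta e (La 2 R powr d) / R * R powr (- \<nu>) \<le> ?K * ((?c + 1) / ?\<epsilon>) powr ?c" if R: "R0 \<le> R" for R
  proof -
    have Re: "exp 1 \<le> R" using R by (simp add: R0_def)
    then have Rpos: "R > 0" using exp_gt_zero[of 1] by linarith
    have ln1: "1 \<le> ln R" using Re Rpos by (simp add: ln_ge_iff)
    have R1': "1 \<le> R" using Rpos ln1 ln_le_minus_one[of R] by linarith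
    have RY: "R \<le> La 2 R"
    proof -
      have "1 powr 2 \<le> ln R powr 2" using ln1 by (intro powr_mono2) auto
      then have "R * 1 \<le> R * ln R powr 2" using Rpos by (intro mult_left_mono) auto
      then show ?thesis by (simp add: La_def)
    qed
    let ?Y = "La 2 R"
    have Y: "1 \<le> ?Y" using RY R1' by linarith
    let ?T = "?Y powr d"
    have T1: "1 \<le> ?T" using Y d by (simp add: ge_one_powr_ge_zero)
    have "R1 \<le> (max 1 R1 powr (1 / d)) powr d" using d by (simp add: powr_powr)
    also have "\<dots> \<le> ?T" using R RY d by (intro powr_mono2) (auto simp: R0_def)
    finally have bT: "beta e ?T \<le> C * (?T powr al * ln ?T powr ga)" by (rule R1)
    \<comment> \<open>The 3 arises from ln (R (ln R)^2) = ln R + 2 ln (ln R) together with ln (ln R)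
      \<le> ln R.\<close>
    have lnY: "ln ?Y \<le> 3 * ln R"
    proof -
      have "ln ?Y = ln R + 2 * ln (ln R)" unfolding La_def using Rpos ln1 by (simp add: ln_mult ln_powr)
      also have "ln (ln R) \<le> ln R" using ln_le_minus_one[of "ln R"] ln1 by simp
      finally show ?thesis by simp
    qed
    have lnT: "ln ?T = d * ln ?Y" using Y by (simp add: ln_powr)
    have lnT0: "0 \<le> ln ?T" by (rule ln_ge_zero[OF T1])
    have lnT3: "ln ?T \<le> 3 * d * ln R" unfolding lnT using mult_left_mono[OF lnY, of d] d by simp
    have "ln ?T powr ga \<le> (3 * d * ln R) powr ga" using lnT0 lnT3 ag by (intro powr_mono2) auto
    also have "\<dots> = (3 * d) powr ga * ln R powr ga" using d ln1 by (simp add: powr_mult)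
    finally have lnTg: "ln ?T powr ga \<le> (3 * d) powr ga * ln R powr ga" .
    have Tal: "?T powr al = ?Y powr (d * al)" by (simp add: powr_powr)
    have "beta e ?T \<le> C * (?Y powr (d * al) * ((3 * d) powr ga * ln R powr ga))"
      using bT unfolding Tal by (rule order_trans) (use C lnTg in \<open>intro mult_left_mono; simp\<close>)
    then have "?Y powr p0 * beta e ?T \<le> ?Y powr p0 * (C * (?Y powr (d * al) * ((3 * d) powr ga * ln R powr ga)))"
      by (intro mult_left_mono) auto
    also have "\<dots> = ?K * (?Y powr ?p * ln R powr ga)" by (simp add: powr_add mult_ac)
    also have "?Y powr ?p = R powr ?p * ln R powr (2 * ?p)"
      unfolding La_def using Rpos ln1 by (simp add: powr_mult powr_powr)
    finally have "?Y powr p0 * beta e ?T \<le> ?K * (R powr ?p * ln R powr (2 * ?p) * ln R powr ga)" .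
    then have "?Y powr p0 * beta e ?T / R * R powr (- \<nu>) \<le> ?K * (R powr ?p * ln R powr (2 * ?p) * ln R powr ga) / R * R powr (- \<nu>)"
      using Rpos by (intro mult_right_mono divide_right_mono) auto
    also have "\<dots> = ?K * ((R powr ?p * R powr (- 1) * R powr (- \<nu>)) * (ln R powr (2 * ?p) * ln R powr ga))"
    proof -
      have "R powr (- 1) = inverse R" using Rpos by (simp add: powr_minus)
      then show ?thesis by (simp only: divide_inverse mult_ac)
    qed
    also have "\<dots> = ?K * (R powr (- ?\<epsilon>) * ln R powr ?c)"
    proof -
      have "- ?\<epsilon> = ?p + (- 1) + (- \<nu>)" by simp
      then show ?thesis by (simp only: powr_add mult.assoc)
    qed
    also have "\<dots> \<le> ?K * ((?c + 1) / ?\<epsilon>) powr ?c"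
      using C p ag neg R1' by (intro mult_left_mono powr_ln_bounded) auto
    finally show ?thesis .
  qed
  then show ?thesis using that by blast
qed

text \<open>Scale and radius are matched by C1 / \<delta>^(2m-1) = R, so the distance to
  \<open>Mball\<close> is of order R^(-\<nu>) with \<nu> = (q + 1 + k) / (2m - 1). The exponent a =
  2 serves in \<open>Bq\<close>, as \<open>rate_bounded\<close> leaves a genuine power of R to
  absorb the logarithms.\<close>

lemma Wkl_subset_Bq:
  fixes f :: "real^'n::finite \<Rightarrow> real"
  assumes m: "m \<ge> 1" and e: "young e" and ag: "e \<in> classE_ag al ga" "0 \<le> al" "0 \<le> ga"
    and al: "al < real (2 * m + k + q) / (real CARD('n) * (2 * real m - 1))"
    and md: "real m > real CARD('n) / 2"
    and f: "f \<in> Wkl (q + 1) (2 * m) e"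
  shows "fmeas f \<in> Bq q k m e"
proof -
  let ?s = "q + 1" and ?t = "2 * m - 1"
  have fin: "wsob ?s (2 * m) e f < \<infinity>" using f by (simp add: Wkl_def)
  have M: "CARD('n) < 2 * m" using md by linarith
  have wf: "weak_deriv a f (wd a f)" and wi: "integrable lborel (wd a f)" if "a \<in> mi_upto ?s" for a
    using wsobD(1)[OF fin that] wsob_integrable[OF e fin that M] by auto
  have lf: "loc_int f" using wf[OF mi_upto_0] weak_deriv_def by blast
  then have fm: "f \<in> borel_measurable lborel" using loc_int_def by auto
  \<comment> \<open>\<open>wd\<close> picks some weak derivative even at order 0, and it agrees with
    \<open>f\<close> only almost everywhere.\<close>
  have "AE x in lborel. wd (\<lambda>_. 0) f x = f x" by (rule wd_AE[OF weak_deriv_zero[OF lf]])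
  then have fi: "integrable lborel f"
    using wi[OF mi_upto_0] fm by (subst integrable_cong_AE[of _ _ "wd (\<lambda>_. 0) f"]) (auto elim: eventually_mono)
  obtain H and \<Gamma> :: "nat \<Rightarrow> 'n \<Rightarrow> real \<Rightarrow> real" and dir where ks: "kernel_system (?s + k) H \<Gamma> dir"
    using kernel_exists by blast
  note H = kernel_systemD(1)[OF ks]
  let ?f = "\<lambda>\<delta>. conv lborel f (tens (scs \<delta> (\<lambda>_. H)))"
  have ej: "(\<lambda>i. if i = j then ?s else 0) \<in> mi_upto ?s" for j :: 'n by (simp add: mi_upto_def mi_abs_single)
  obtain C2 where C2: "C2 \<ge> 0" and dk2: "\<And>\<delta>. 0 < \<delta> \<Longrightarrow> \<delta> \<le> 1 \<Longrightarrow> dk k (fmeas f) (fmeas (?f \<delta>)) \<le> ennreal (C2 * \<delta> ^ (?s + k))"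
    by (rule dk_regularised[OF ks _ fi wf[OF ej] wi[OF ej]]) auto
  obtain C1 where C1: "C1 > 0" and ws: "\<And>\<delta> p. 0 < \<delta> \<Longrightarrow> \<delta> \<le> 1 \<Longrightarrow> p \<in> borel_measurable borel \<Longrightarrow>
      AE x in lborel. ?f \<delta> x = p x \<Longrightarrow> wsob (?s + ?t) (2 * m) e p \<le> ennreal (C1 / \<delta> ^ ?t)"
    by (rule wsob_regularised[OF e fin H lf, where t = ?t]) blast
  have st: "?s + ?t = 2 * m + q" using m by simp
  have t1: "?t \<ge> 1" using m by simp
  let ?\<nu> = "real (?s + k) / real ?t"
  have dkset: "dk_set k (fmeas f) (Mball m q e R) \<le> ennreal (C2 * C1 powr ?\<nu> * R powr (- ?\<nu>))" if R: "C1 \<le> R" for R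
  proof -
    have Rpos: "R > 0" using C1 R by simp
    \<comment> \<open>This solves C1 / \<delta>^(2m-1) = R; it is at most 1 because R \<ge>
      C1.\<close>
    define \<delta> where "\<delta> = (C1 / R) powr (1 / real ?t)"
    have d: "0 < \<delta>" "\<delta> \<le> 1"
      using C1 R Rpos by (auto simp: \<delta>_def intro!: powr_le1)
    have dt: "\<delta> ^ ?t = C1 / R"
      using C1 Rpos t1 unfolding \<delta>_def by (subst powr_realpow[symmetric]) (auto simp: powr_powr)
    have dN: "\<delta> ^ (?s + k) = C1 powr ?\<nu> * R powr (- ?\<nu>)"
    proof -
      have "\<delta> ^ (?s + k) = \<delta> powr real (?s + k)" using d by (subst powr_realpow) auto
      also have "\<dots> = (C1 / R) powr ?\<nu>" unfolding \<delta>_def powr_powr by simp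
      also have "\<dots> = C1 powr ?\<nu> / R powr ?\<nu>" by (rule powr_divide)
      also have "\<dots> = C1 powr ?\<nu> * R powr (- ?\<nu>)" by (simp only: powr_minus divide_inverse)
      finally show ?thesis .
    qed
    have hs: "csms (scs \<delta> (\<lambda>_::'n. H))" using H d by (intro csms_scs) auto
    have fdi: "integrable lborel (?f \<delta>)" by (rule conv_integrable_lborel[OF fi hs])
    have Ma: "fmeas (?f \<delta>) \<in> Ma" unfolding Ma_def using fmeas_fsm[OF fdi] fmeas_density[OF fdi] by blast
    have "AE x in lborel. ?f \<delta> x = pdens (fmeas (?f \<delta>)) x"
      by (rule is_density_unique[OF fmeas_density[OF fdi] is_density_pdens[OF Ma]])
    moreover have "pdens (fmeas (?f \<delta>)) \<in> borel_measurable borel"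
      using pdens_loc_int[OF Ma] loc_int_def by auto
    ultimately have "wsob (?s + ?t) (2 * m) e (pdens (fmeas (?f \<delta>))) \<le> ennreal (C1 / \<delta> ^ ?t)"
      by (intro ws d)
    also have "C1 / \<delta> ^ ?t = R" unfolding dt using C1 by simp
    finally have "fmeas (?f \<delta>) \<in> Mball m q e R" using Ma unfolding Mball_def st by simp
    then have "dk_set k (fmeas f) (Mball m q e R) \<le> dk k (fmeas f) (fmeas (?f \<delta>))"
      unfolding dk_set_def by (rule INF_lower)
    also have "\<dots> \<le> ennreal (C2 * \<delta> ^ (?s + k))" by (rule dk2[OF d])
    finally show ?thesis unfolding dN by (simp only: mult.assoc)
  qed
  let ?p0 = "1 + real (k + q) / (2 * real m)" and ?d = "real CARD('n) / (2 * real m)"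
  \<comment> \<open>This is equivalent to the bound assumed for \<open>al\<close>: in (2m - 1) (k +
    q + n al) < 2m (q + 1 + k), with n the dimension, cancellation leaves n al (2m - 1) < 2m + k +
    q.\<close>
  have neg: "?p0 + ?d * al < 1 + ?\<nu>"
  proof -
    let ?n = "real CARD('n)"
    have t: "real ?t = 2 * real m - 1" using m by (simp add: of_nat_diff)
    have tp: "0 < 2 * real m - 1" using m by simp
    have n: "?n > 0" by simp
    have "?n * al < real (2 * m + k + q) / (2 * real m - 1)"
      using al n tp by (simp add: field_simps)
    then have "real (k + q) + ?n * al < real (k + q) + real (2 * m + k + q) / (2 * real m - 1)" by simp
    also have "\<dots> = (2 * real m) * (real (?s + k) / (2 * real m - 1))"
      using tp by (simp add: field_simps)
    finally have "(real (k + q) + ?n * al) / (2 * real m) < real (?s + k) / (2 * real m - 1)"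
      using m by (simp add: divide_less_eq mult.commute)
    then show ?thesis unfolding t by (simp add: add_divide_distrib)
  qed
  obtain C3 R3 where R3: "\<And>R. R3 \<le> R \<Longrightarrow> La 2 R powr ?p0 * beta e (La 2 R powr ?d) / R * R powr (- ?\<nu>) \<le> C3"
    by (rule rate_bounded[OF e ag(1) ag(2) ag(3) _ _ neg]) (use m in auto)
  have "Limsup at_top (\<lambda>R::real. ennreal (La 2 R powr ?p0 * beta e (La 2 R powr ?d) / R) * dk_set k (fmeas f) (Mball m q e R))
     \<le> ennreal (C2 * C1 powr ?\<nu> * C3)"
  proof (rule Limsup_bounded)
    show "eventually (\<lambda>R. ennreal (La 2 R powr ?p0 * beta e (La 2 R powr ?d) / R) * dk_set k (fmeas f) (Mball m q e R)
       \<le> ennreal (C2 * C1 powr ?\<nu> * C3)) at_top"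
      using eventually_ge_at_top[of "max C1 (max R3 2)"]
    proof eventually_elim
      case (elim R)
      let ?c = "La 2 R powr ?p0 * beta e (La 2 R powr ?d) / R"
      have c0: "0 \<le> ?c"
      proof -
        have "La 2 R > 0" using elim by (simp add: La_def)
        then have "beta e (La 2 R powr ?d) > 0" by (intro beta_pos[OF e]) simp
        then show ?thesis using elim by simp
      qed
      have "ennreal ?c * dk_set k (fmeas f) (Mball m q e R) \<le> ennreal ?c * ennreal (C2 * C1 powr ?\<nu> * R powr (- ?\<nu>))"
        using elim by (intro mult_left_mono dkset) auto
      also have "\<dots> = ennreal (C2 * C1 powr ?\<nu> * (?c * R powr (- ?\<nu>)))"
        unfolding ennreal_mult'[OF c0, symmetric] by (simp only: mult_ac)
      also have "\<dots> \<le> ennreal (C2 * C1 powr ?\<nu> * C3)"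
        using R3[of R] elim C2 by (intro ennreal_leI mult_left_mono) auto
      finally show ?case .
    qed
  qed
  also have "\<dots> < \<infinity>" by simp
  finally have "Limsup at_top (\<lambda>R::real. ennreal (La 2 R powr ?p0 * beta e (La 2 R powr ?d) / R) * dk_set k (fmeas f) (Mball m q e R)) < \<infinity>" .
  then show ?thesis using fmeas_fsm[OF fi] unfolding Bq_def by (intro CollectI conjI exI[of _ 2]) auto
qed

theorem mainTheorem2:
  fixes q k m :: nat and e :: "real \<Rightarrow> real"
  assumes "m \<ge> 1" and "e \<in> classE"
  shows "(Bq q k m e :: (real^'n::finite) smeas set) \<subseteq> Sspace q k m e
       \<and> (\<forall>\<mu> \<in> (Sspace q k m e :: (real^'n) smeas set). \<exists>p. is_density \<mu> p \<and> p \<in> W q e)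
       \<and> (\<forall>al ga. e \<in> classE_ag al ga \<and> 0 \<le> al
             \<and> al < real (2 * m + k + q) / (real CARD('n) * (2 * real m - 1))
             \<and> 0 \<le> ga \<and> real m > real CARD('n) / 2
           \<longrightarrow> (\<forall>f :: real^'n \<Rightarrow> real. f \<in> Wkl (q + 1) (2 * m) e \<longrightarrow> fmeas f \<in> Bq q k m e))"
proof -
  have e: "young e" by (rule classE_young[OF assms(2)])
  show ?thesis
  proof (intro conjI ballI allI impI)
    show "(Bq q k m e :: (real^'n) smeas set) \<subseteq> Sspace q k m e" by (rule Bq_subset_Sspace[OF e assms(1)])
    show "\<exists>p. is_density \<mu> p \<and> p \<in> W q e" if "\<mu> \<in> Sspace q k m e" for \<mu> :: "(real^'n) smeas"
      by (rule Sspace_density[OF e that])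
    fix al ga and f :: "real^'n \<Rightarrow> real"
    assume "e \<in> classE_ag al ga \<and> 0 \<le> al
             \<and> al < real (2 * m + k + q) / (real CARD('n) * (2 * real m - 1))
             \<and> 0 \<le> ga \<and> real m > real CARD('n) / 2" and "f \<in> Wkl (q + 1) (2 * m) e"
    then show "fmeas f \<in> Bq q k m e" by (intro Wkl_subset_Bq[OF assms(1) e]) auto
  qed
qed

end
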